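(* Let $\delta=[2]$, $\delta_L=[w_1]$, $\kappa_L=[w_1+1]$, $\delta_R=[w_2]$, $\kappa_R=[w_2+1]$. Let $\Gamma_{2n}(l)$ denote the Gram determinant of the cell module $\mathcal S_{2n}(l)$ with respect to the basis specified in the context. Then, up to sign: for $n\ge3$, $\ \Gamma_{2n}(-(n-2))=[w_1+1]\,[w_2+1]\,[w_1+w_2-n+2]$; for $n\ge4$, $\ \Gamma_{2n}(-(n-3))=[w_2]^{n+1}\,[w_2-1]\,[w_1+1]\,[-w_1+w_2+n-2]$; for $n\ge4$, $\ \Gamma_{2n}(n-3)=[w_1]^{n+1}\,[w_1-1]\,[w_2+1]\,[w_1-w_2+n-2]$; for $n\ge5$, $\ \Gamma_{2n}(n-4)=[w_1]^{n+1}\,[w_2]^{n+1}\,[w_1-1]\,[w_2-1]\,[w_1+w_2+n-2]$.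
   Context: **Quantum numbers.** $k$ is a field, $q\in k$ nonzero with $q\ne q^{-1}$, and $[a]=(q^a-q^{-a})/(q-q^{-1})$; here $q^{w_1},q^{w_2}$ denote fixed nonzero elements of $k$ (e.g. $w_1,w_2$ integers), and $[\pm w_1\pm w_2+c]$ is interpreted accordingly. The parameter $\kappa_{LR}\in k$ does not affect the modules below. **The algebra.** The affine symmetric Temperley--Lieb algebra $b_{2n}^\phi$ is isomorphic (with the same parameters, and matching diagram bases) to the symplectic blob algebra $b_n^x$; we identify the two. It is defined as follows. A pseudo Temperley--Lieb diagram is a rectangle with vertices $1,\dots,n$ on the top edge and $1',\dots,n'$ on the bottom edge, joined in pairs by non-crossing lines, possibly with closed loops, up to isotopy. A line is propagating if it joins top to bottom. Lines and loops may carry left blobs $L$ and right blobs $R$; a left-right blob pseudo-diagram is such a decorated diagram that can be deformed, without crossings, so that all $L$-blobs touch the left side and all $R$-blobs touch the right side simultaneously. The product $dd'$ is $d$ stacked on top of $d'$. Relations: an undecorated loop is removed with factor $\delta$, a loop with a single $L$ with factor $\kappa_L$, with a single $R$ with factor $\kappa_R$, with one $L$ and one $R$ with factor $\kappa_{LR}$; on a line $LL=\delta_LL$, $RR=\delta_RR$, $LRL=\kappa_{LR}L$, $RLR=\kappa_{LR}R$; and if a diagram $D$ has a top arc carrying both $L$ and $R$ and a bottom arc carrying both $L$ and $R$, then $D=\kappa_{LR}D'$, where $D'$ is obtained by cutting both arcs between their $L$ and $R$ and joining the left halves into a propagating line decorated by one $L$ and the right halves into a propagating line decorated by one $R$. The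 basis $B$ consists of left-right blob pseudo-diagrams without loops, with no consecutive $LL,RR,LRL,RLR$ on a line, and not having simultaneously a top arc and a bottom arc each carrying both $L$ and $R$. The diagram $e$ (resp. $f$) is the identity diagram with its leftmost (resp. rightmost) line decorated by one $L$ (resp. one $R$); $e_i$ ($1\le i\le n-1$) is the undecorated diagram with arcs joining $i,i+1$ and $i',(i+1)'$ and vertical lines elsewhere. **Cell modules and Gram determinants.** For $m\ge 0$ let $T_m$ be the two-sided ideal spanned by the $d\in B$ having at most $m$ undecorated propagating lines. The cell module is $\mathcal S_{2n}(l)=(b_{2n}^\phi d+T_{|l|-1})/T_{|l|-1}$, with generating diagram $d$ and ($(n+1)$-element) basis as follows: $l=-(n-2)$, $d=e_1$: basis $ee_1,\ e_1,\ e_2e_1,\ e_3e_2e_1,\dots,\ e_{n-1}\cdots e_2e_1,\ fe_{n-1}\cdots e_2e_1$; $l=-(n-3)$, $d=e_1f$: basis $ee_1f,\ e_1f,\ e_2e_1f,\dots,\ e_{n-1}\cdots e_2e_1f,\ fe_{n-1}\cdots e_2e_1f$; $l=n-3$, $d=ee_2$: basis $ee_1ee_2,\ e_1ee_2,\ ee_2,\ e_3ee_2,\ e_4e_3ee_2,\dots,\ e_{n-1}\cdots e_3ee_2,\ fe_{n-1}\cdots e_3ee_2$; $l=n-4$, $d=ee_2f$: basis $ee_1ee_2f,\ e_1ee_2f,\ ee_2f,\ e_3ee_2f,\ e_4e_3ee_2f,\dots,\ e_{n-1}\cdots e_3ee_2f,\ fe_{n-1}\cdots e_3ee_2f$. Let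 $b\mapsto b^\circ$ be the anti-automorphism turning diagrams upside down. For basis elements $b_1,b_2$ the inner product $\langle b_1,b_2\rangle\in k$ is defined by $b_2^\circ b_1\equiv\langle b_1,b_2\rangle\, d \pmod{T_{|l|-1}}$. The Gram determinant $\Gamma_{2n}(l)$ is the determinant of the $(n+1)\times(n+1)$ matrix of inner products of the basis elements. *)

theory Defs
  imports
    "HOL-Library.Poly_Mapping"
    "HOL-Library.Multiset"
    "HOL-Library.Sublist"
    "Jordan_Normal_Form.Determinant"
begin

section \<open>Decorated diagrams\<close>

datatype blob = LB | RB

text \<open>Vertices are numbered from 1: \<open>Top i\<close> is the vertex i of the top edge and
  \<open>Bot i\<close> the vertex i' of the bottom edge.\<close>

datatype vertex = Top nat | Bot nat

text \<open>A triple \<open>(x, w, y)\<close> is a line between \<open>x\<close> and \<open>y\<close> whose blobs, read from \<open>x\<close> to \<open>y\<close>,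
  form the word \<open>w\<close>. Every line is recorded in both directions, i.e. together with
  \<open>(y, rev w, x)\<close>. A closed loop is recorded by its word, read from an arbitrary starting point
  in an arbitrary direction. The place of a loop inside the diagram is not recorded, since no
  relation depends on it.\<close>

type_synonym line = "vertex \<times> blob list \<times> vertex"

datatype diagram = Diagram (lines: "line set") (loops: "blob list multiset")

definition both_ways :: "line set \<Rightarrow> line set" where
  "both_ways S = S \<union> {(y, rev w, x) | x w y. (x, w, y) \<in> S}"

definition vertices :: "nat \<Rightarrow> vertex set" where
  "vertices n = Top ` {1..n} \<union> Bot ` {1..n}"

text \<open>Positions on the boundary of the rectangle, clockwise from the left side: the left side (as
  one point), top vertices 1 to n, the right side (as one point), bottom vertices n to 1.\<close>

definition left_pos :: nat where
  "left_pos = 0"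

definition right_pos :: "nat \<Rightarrow> nat" where
  "right_pos n = n + 1"

fun pos :: "nat \<Rightarrow> vertex \<Rightarrow> nat" where
  "pos n (Top i) = i"
| "pos n (Bot i) = 2 * n + 2 - i"

definition noncrossing :: "nat set \<Rightarrow> nat set \<Rightarrow> bool" where
  "noncrossing A B \<longleftrightarrow> \<not> (\<exists>a\<in>A. \<exists>b\<in>B. \<exists>c\<in>A. \<exists>d\<in>B.
     a < b \<and> b < c \<and> c < d \<or> b < a \<and> a < d \<and> d < c)"

definition sides :: "nat \<Rightarrow> blob list \<Rightarrow> nat set" where
  "sides n w = (if LB \<in> set w then {left_pos} else {}) \<union> (if RB \<in> set w then {right_pos n} else {})"

definition block :: "nat \<Rightarrow> line \<Rightarrow> nat set" where
  "block n = (\<lambda>(x, w, y). {pos n x, pos n y} \<union> sides n w)"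

text \<open>A decorated diagram can be deformed so that all L-blobs touch the left side and all R-blobs
  touch the right side simultaneously iff every L-blob can be tethered to the left side and every
  R-blob to the right side, without a tether crossing a line, a loop or another tether. A line or
  loop with its tethers is a connected set meeting the boundary in its end points and the sides it
  is tethered to; condition \<open>lines_cross\<close> says that two such sets do not cross.
  Condition \<open>order\<close> is the same for two parts of one line: if L precedes R on a line from x to y,
  the part up to L joins x to the left side and the part from R on joins the right side to y (the
  case of R preceding L is that of the reversed line). On a loop the
  tethers of the L-blobs are not separated by those of the R-blobs.\<close>

locale left_right_diagram =
  fixes n :: nat and D :: diagram
  assumes ends: "(x, w, y) \<in> lines D \<Longrightarrow> x \<in> vertices n \<and> y \<in> vertices n \<and> x \<noteq> y"
    and reverse: "(x, w, y) \<in> lines D \<Longrightarrow> (y, rev w, x) \<in> lines D"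
    and matching: "x \<in> vertices n \<Longrightarrow> \<exists>!(w, y). (x, w, y) \<in> lines D"
    and lines_cross: "(x, w, y) \<in> lines D \<Longrightarrow> (x', w', y') \<in> lines D \<Longrightarrow> {x, y} \<noteq> {x', y'} \<Longrightarrow>
      noncrossing (block n (x, w, y)) (block n (x', w', y'))"
    and order: "(x, u @ LB # v @ RB # u', y) \<in> lines D \<Longrightarrow>
      noncrossing {pos n x, left_pos} {pos n y, right_pos n}"
    and loops_cross: "w \<in># loops D \<Longrightarrow> l \<in> lines D \<Longrightarrow> noncrossing (sides n w) (block n l)"
    and loop_order: "w \<in># loops D \<Longrightarrow> \<exists>k a b. rotate k w = replicate a LB @ replicate b RB"

definition gen_e :: "nat \<Rightarrow> diagram" where
  "gen_e n = Diagram (both_ways {(Top j, if j = 1 then [LB] else [], Bot j) | j. j \<in> {1..n}}) {#}"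

definition gen_f :: "nat \<Rightarrow> diagram" where
  "gen_f n = Diagram (both_ways {(Top j, if j = n then [RB] else [], Bot j) | j. j \<in> {1..n}}) {#}"

definition gen_U :: "nat \<Rightarrow> nat \<Rightarrow> diagram" where
  "gen_U n i = Diagram (both_ways ({(Top i, [], Top (i + 1)), (Bot i, [], Bot (i + 1))} \<union>
     {(Top j, [], Bot j) | j. j \<in> {1..n} - {i, i + 1}})) {#}"

fun flip_vertex :: "vertex \<Rightarrow> vertex" where
  "flip_vertex (Top i) = Bot i"
| "flip_vertex (Bot i) = Top i"

definition flip :: "diagram \<Rightarrow> diagram" where
  "flip D = Diagram ((\<lambda>(x, w, y). (flip_vertex x, w, flip_vertex y)) ` lines D) (loops D)"


section \<open>Stacking\<close>

text \<open>When \<open>D\<close> is stacked on top of \<open>D'\<close>, the bottom vertices of \<open>D\<close> and the top vertices of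
  \<open>D'\<close> become the middle sites.\<close>

datatype site = Upper nat | Middle nat | Lower nat

fun site_in_upper :: "vertex \<Rightarrow> site" where
  "site_in_upper (Top i) = Upper i"
| "site_in_upper (Bot i) = Middle i"

fun site_in_lower :: "vertex \<Rightarrow> site" where
  "site_in_lower (Top i) = Middle i"
| "site_in_lower (Bot i) = Lower i"

fun outer_site :: "vertex \<Rightarrow> site" where
  "outer_site (Top i) = Upper i"
| "outer_site (Bot i) = Lower i"

definition layer :: "diagram \<Rightarrow> diagram \<Rightarrow> bool \<Rightarrow> (site \<times> blob list \<times> site) set" where
  "layer D D' upper =
     (if upper then (\<lambda>(x, w, y). (site_in_upper x, w, site_in_upper y)) ` lines D
      else (\<lambda>(x, w, y). (site_in_lower x, w, site_in_lower y)) ` lines D')"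

text \<open>\<open>trail D D' k s x w t y\<close>: alternating between lines of the two layers, starting in layer
  \<open>s\<close> and ending in layer \<open>t\<close>, one gets from \<open>x\<close> to \<open>y\<close> along a curve with blobs \<open>w\<close>, and all
  middle sites strictly inside this curve have a number greater than \<open>k\<close>.\<close>

inductive trail :: "diagram \<Rightarrow> diagram \<Rightarrow> nat \<Rightarrow> bool \<Rightarrow> site \<Rightarrow> blob list \<Rightarrow> bool \<Rightarrow> site \<Rightarrow> bool"
  for D D' :: diagram and k :: nat where
  start: "(x, w, y) \<in> layer D D' s \<Longrightarrow> trail D D' k s x w s y"
| step: "trail D D' k s x w t (Middle j) \<Longrightarrow> k < j \<Longrightarrow> (Middle j, v, y) \<in> layer D D' (\<not> t) \<Longrightarrow>
    trail D D' k s x (w @ v) (\<not> t) y"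

text \<open>A loop created by stacking is read once: from its middle site \<open>i\<close> with the smallest number,
  leaving into the upper layer, until the first return to \<open>i\<close>.\<close>

definition stack :: "diagram \<Rightarrow> diagram \<Rightarrow> diagram" where
  "stack D D' = Diagram
     {(x, w, y). \<exists>s t. trail D D' 0 s (outer_site x) w t (outer_site y)}
     (loops D + loops D' +
      image_mset snd (mset_set {(i, w). trail D D' i True (Middle i) w False (Middle i)}))"


section \<open>The algebra by generators and relations\<close>

record 'k parameters =
  delta :: 'k
  delta_L :: 'k
  delta_R :: 'k
  kappa_L :: 'k
  kappa_R :: 'k
  kappa_LR :: 'k

definition line_rules :: "'k parameters \<Rightarrow> (blob list \<times> 'k \<times> blob list) set" where
  "line_rules p = {([LB, LB], delta_L p, [LB]), ([RB, RB], delta_R p, [RB]),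
     ([LB, RB, LB], kappa_LR p, [LB]), ([RB, LB, RB], kappa_LR p, [RB])}"

definition loop_rules :: "'k parameters \<Rightarrow> (blob list \<times> 'k) set" where
  "loop_rules p = {([], delta p), ([LB], kappa_L p), ([RB], kappa_R p),
     ([LB, RB], kappa_LR p), ([RB, LB], kappa_LR p)}"

text \<open>\<open>relation p n D c D'\<close> is the relation \<open>D = c D'\<close>. The rules for LRL and RLR hold on lines
  with end points only; a loop becomes one of the five in \<open>loop_rules\<close> by reducing LL and RR. In
  \<open>top_bottom\<close> an arc with one L and one R carries L before R from left to right, because of the
  condition \<open>order\<close> above.\<close>

inductive relation :: "'k parameters \<Rightarrow> nat \<Rightarrow> diagram \<Rightarrow> 'k \<Rightarrow> diagram \<Rightarrow> bool"
  for p :: "'k parameters" and n :: nat where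
  loop_removal:
    "\<lbrakk>left_right_diagram n (Diagram S (add_mset w M)); (w, c) \<in> loop_rules p\<rbrakk> \<Longrightarrow>
     relation p n (Diagram S (add_mset w M)) c (Diagram S M)"
| loop_LL:
    "\<lbrakk>left_right_diagram n (Diagram S (add_mset w M)); rotate k w = LB # LB # v\<rbrakk> \<Longrightarrow>
     relation p n (Diagram S (add_mset w M)) (delta_L p) (Diagram S (add_mset (LB # v) M))"
| loop_RR:
    "\<lbrakk>left_right_diagram n (Diagram S (add_mset w M)); rotate k w = RB # RB # v\<rbrakk> \<Longrightarrow>
     relation p n (Diagram S (add_mset w M)) (delta_R p) (Diagram S (add_mset (RB # v) M))"
| on_line:
    "\<lbrakk>left_right_diagram n (Diagram S M); (z, c, z') \<in> line_rules p; (x, u @ z @ v, y) \<in> S\<rbrakk> \<Longrightarrow>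
     relation p n (Diagram S M) c
       (Diagram (S - both_ways {(x, u @ z @ v, y)} \<union> both_ways {(x, u @ z' @ v, y)}) M)"
| top_bottom:
    "\<lbrakk>left_right_diagram n (Diagram S M);
      (Top i, [LB, RB], Top j) \<in> S; (Bot i', [LB, RB], Bot j') \<in> S;
      S' = S - both_ways {(Top i, [LB, RB], Top j), (Bot i', [LB, RB], Bot j')}
             \<union> both_ways {(Top i, [LB], Bot i'), (Top j, [RB], Bot j')};
      left_right_diagram n (Diagram S' M)\<rbrakk> \<Longrightarrow>
     relation p n (Diagram S M) (kappa_LR p) (Diagram S' M)"

definition scale :: "'k::field \<Rightarrow> ('a \<Rightarrow>\<^sub>0 'k) \<Rightarrow> ('a \<Rightarrow>\<^sub>0 'k)" where
  "scale c v = Poly_Mapping.map ((*) c) v"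

lemma lookup_scale [simp]: "Poly_Mapping.lookup (scale c v) a = c * Poly_Mapping.lookup v a"
  by (simp add: scale_def map.rep_eq when_def)

interpretation combinations: vector_space "scale :: 'k::field \<Rightarrow> ('a \<Rightarrow>\<^sub>0 'k) \<Rightarrow> ('a \<Rightarrow>\<^sub>0 'k)"
  by unfold_locales (auto intro!: poly_mapping_eqI simp: lookup_add algebra_simps)

definition relators :: "'k::field parameters \<Rightarrow> nat \<Rightarrow> (diagram \<Rightarrow>\<^sub>0 'k) set" where
  "relators p n =
     {Poly_Mapping.single D 1 - scale c (Poly_Mapping.single D' 1) | D c D'. relation p n D c D'}"

definition basis_diagrams :: "nat \<Rightarrow> diagram set" where
  "basis_diagrams n = {D. left_right_diagram n D \<and> loops D = {#} \<and>
     (\<forall>(x, w, y)\<in>lines D. \<forall>z\<in>{[LB, LB], [RB, RB], [LB, RB, LB], [RB, LB, RB]}. \<not> sublist z w) \<and>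
     \<not> ((\<exists>i w j. (Top i, w, Top j) \<in> lines D \<and> {LB, RB} \<subseteq> set w) \<and>
        (\<exists>i w j. (Bot i, w, Bot j) \<in> lines D \<and> {LB, RB} \<subseteq> set w))}"

definition undecorated_propagating :: "diagram \<Rightarrow> nat" where
  "undecorated_propagating D = card {(i, j). (Top i, [], Bot j) \<in> lines D}"

text \<open>The algebra is the space of linear combinations of left-right blob pseudo-diagrams modulo the
  span of \<open>relators\<close>. \<open>ideal_T p n m\<close> is the preimage of \<open>T\<^sub>m\<close> under this quotient map, so
  two combinations agree in the algebra modulo \<open>T\<^sub>m\<close> iff their difference lies in it.\<close>

definition ideal_T :: "'k::field parameters \<Rightarrow> nat \<Rightarrow> int \<Rightarrow> (diagram \<Rightarrow>\<^sub>0 'k) set" where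
  "ideal_T p n m = combinations.span (relators p n \<union>
     {Poly_Mapping.single D 1 | D. D \<in> basis_diagrams n \<and> int (undecorated_propagating D) \<le> m})"


section \<open>Cell modules and Gram determinants\<close>

text \<open>\<open>climb n i j D\<close> is the diagram of the product of \<open>e\<^sub>j\<close>, \dots, \<open>e\<^sub>i\<close> (decreasing
  indices) and \<open>D\<close>; it is \<open>D\<close> if \<open>j < i\<close>.\<close>

definition climb :: "nat \<Rightarrow> nat \<Rightarrow> nat \<Rightarrow> diagram \<Rightarrow> diagram" where
  "climb n i j D = fold (\<lambda>k D'. stack (gen_U n k) D') [i..<Suc j] D"

definition cell_generator :: "nat \<Rightarrow> int \<Rightarrow> diagram" where
  "cell_generator n l =
    (if l = - (int n - 2) then gen_U n 1
     else if l = - (int n - 3) then stack (gen_U n 1) (gen_f n)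
     else if l = int n - 3 then stack (gen_e n) (gen_U n 2)
     else if l = int n - 4 then stack (gen_e n) (stack (gen_U n 2) (gen_f n))
     else undefined)"

definition cell_basis :: "nat \<Rightarrow> int \<Rightarrow> diagram list" where
  "cell_basis n l = (let d = cell_generator n l in
     if l = - (int n - 2) \<or> l = - (int n - 3) then
       [stack (gen_e n) d]
       @ map (\<lambda>j. climb n 2 j d) [1..<n]
       @ [stack (gen_f n) (climb n 2 (n - 1) d)]
     else if l = int n - 3 \<or> l = int n - 4 then
       [stack (gen_e n) (stack (gen_U n 1) d), stack (gen_U n 1) d]
       @ map (\<lambda>j. climb n 3 j d) [2..<n]
       @ [stack (gen_f n) (climb n 3 (n - 1) d)]
     else undefined)"

definition inner_prod :: "'k::field parameters \<Rightarrow> nat \<Rightarrow> int \<Rightarrow> diagram \<Rightarrow> diagram \<Rightarrow> 'k" where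
  "inner_prod p n l b\<^sub>1 b\<^sub>2 = (THE c.
     Poly_Mapping.single (stack (flip b\<^sub>2) b\<^sub>1) 1
       - scale c (Poly_Mapping.single (cell_generator n l) 1)
     \<in> ideal_T p n (\<bar>l\<bar> - 1))"

definition gram_det :: "'k::field parameters \<Rightarrow> nat \<Rightarrow> int \<Rightarrow> 'k" where
  "gram_det p n l = det (mat (n + 1) (n + 1)
     (\<lambda>(i, j). inner_prod p n l (cell_basis n l ! i) (cell_basis n l ! j)))"


section \<open>Quantum numbers\<close>

text \<open>\<open>quantum q Q\<^sub>1 Q\<^sub>2 a b c\<close> is the quantum number \<open>[a w\<^sub>1 + b w\<^sub>2 + c]\<close>, where
  \<open>Q\<^sub>1\<close> and \<open>Q\<^sub>2\<close> stand for the elements \<open>q\<close> to the power \<open>w\<^sub>1\<close> and \<open>w\<^sub>2\<close> of the field.\<close>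

definition quantum :: "'k::field \<Rightarrow> 'k \<Rightarrow> 'k \<Rightarrow> int \<Rightarrow> int \<Rightarrow> int \<Rightarrow> 'k" where
  "quantum q Q\<^sub>1 Q\<^sub>2 a b c =
     (let x = Q\<^sub>1 powi a * Q\<^sub>2 powi b * q powi c in (x - inverse x) / (q - inverse q))"

definition quantum_parameters :: "'k::field \<Rightarrow> 'k \<Rightarrow> 'k \<Rightarrow> 'k \<Rightarrow> 'k parameters" where
  "quantum_parameters q Q\<^sub>1 Q\<^sub>2 \<kappa> =
    \<lparr>delta = quantum q Q\<^sub>1 Q\<^sub>2 0 0 2,
     delta_L = quantum q Q\<^sub>1 Q\<^sub>2 1 0 0,
     delta_R = quantum q Q\<^sub>1 Q\<^sub>2 0 1 0,
     kappa_L = quantum q Q\<^sub>1 Q\<^sub>2 1 0 1,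
     kappa_R = quantum q Q\<^sub>1 Q\<^sub>2 0 1 1,
     kappa_LR = \<kappa>\<rparr>"

end

theory Submission
  imports Defs
begin

text \<open>Number the elements of each cell basis in the given order from \<open>0\<close> to \<open>n\<close>. All of them have the
same bottom edge as the generating diagram \<open>d\<close>, with a single arc, and their top edge also has a
single arc: it joins \<open>k\<close> and \<open>k + 1\<close> in the \<open>k\<close>-th element for \<open>0 < k < n\<close>, whereas elements \<open>0\<close> and
\<open>n\<close> have the arc at \<open>1, 2\<close> decorated by L and the arc at \<open>n - 1, n\<close> decorated by R. The other lines
propagate in order, and the first carries an L, and the last an R, exactly when this is so in \<open>d\<close>
(lemma \<open>cell_basis_label\<close>). An inner product therefore amounts to stacking one bottom arc on one top
arc (lemmas \<open>stack_same_arc\<close> to \<open>stack_arc_far_left\<close>). Arcs at the same place form a loop. Neighbouring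
arcs straighten into a piece of a propagating line, which inherits their blobs. Arcs further apart
close two propagating lines on each edge, so that too few undecorated propagating lines are left and
the inner product is \<open>0\<close>.

Up to the factor \<open>\<delta>\<^sub>L\<close> or \<open>\<delta>\<^sub>R\<close> for every blob of \<open>d\<close>, which each product doubles, the Gram matrix
thus has \<open>\<delta>\<close> on the diagonal and \<open>1\<close> beside it, except near its two corners, where decorated arcs are
involved (lemmas \<open>inner_prod_cell\<close> and \<open>gram_left\<close> to \<open>gram_zero\<close>). If \<open>d\<close> carries an L, then row \<open>0\<close>
is \<open>\<delta>\<^sub>L\<close> times row \<open>1\<close> except in column \<open>1\<close>, and expanding along the difference removes this row and
column with the factor \<open>[w\<^sub>1 - 1]\<close> up to sign; the same happens for R at the other corner. The remaining
matrix is tridiagonal, its leading minors are quantum numbers, up to a common factor, because of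
\<open>[2] [x] - [x - 1] = [x + 1]\<close>, and the last row contributes a difference of two products, evaluated by
\<open>[a] [b] - [a + 1] [b + 1] = - [a + b + 1]\<close>.

Two facts about the algebra are used to evaluate inner products. Firstly, \<open>d\<close> is not \<open>0\<close> modulo smaller
diagrams, so that the inner product is well defined. This is shown by a linear functional, the
coefficient of \<open>d\<close>, which is given by an explicit formula on diagrams and respects all relations
(lemma \<open>coefficient_relation\<close>). The formula is consistent because \<open>d\<close> has an undecorated propagating
line: it keeps the left side apart from the right side, so that no line of a planar diagram of the
same shape carries both blobs. Secondly, the product is congruent to a multiple of a basis
diagram with the same undecorated lines (lemma \<open>reduce_to_basis\<close>). Relations are only available for
planar diagrams, and planarity of the products is read off from their top and bottom edges (lemma
\<open>left_right_joined\<close>).\<close>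

section \<open>Diagrams glued from two halves\<close>

text \<open>One edge of a diagram. The line at a vertex is either an arc, with its word, to another vertex of the
same edge, or the \<open>r\<close>-th propagating line counted from the left; conversely, \<open>place\<close> locates the end
point of the \<open>r\<close>-th propagating line. Since propagating lines do not cross, two such halves with the
same number of them determine the connections of a diagram.\<close>

datatype fate = Arc "blob list" nat | Thru nat

datatype half = Half (fate: "nat \<Rightarrow> fate") (place: "nat \<Rightarrow> nat")

text \<open>In a diagram there is exactly one line at each vertex, so its set of lines is the graph of a pair of
functions; in this form lines can be looked up by rewriting.\<close>

definition wires :: "nat \<Rightarrow> (vertex \<Rightarrow> vertex) \<Rightarrow> (vertex \<Rightarrow> blob list) \<Rightarrow> line set" where
  "wires n \<sigma> \<omega> = (\<lambda>x. (x, \<omega> x, \<sigma> x)) ` vertices n"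

locale wiring =
  fixes n :: nat and \<sigma> :: "vertex \<Rightarrow> vertex" and \<omega> :: "vertex \<Rightarrow> blob list"
  assumes other_end: "x \<in> vertices n \<Longrightarrow> \<sigma> x \<in> vertices n"
    and no_fixpoint: "x \<in> vertices n \<Longrightarrow> \<sigma> x \<noteq> x"
    and involution: "x \<in> vertices n \<Longrightarrow> \<sigma> (\<sigma> x) = x"
    and word_reverse: "x \<in> vertices n \<Longrightarrow> \<omega> (\<sigma> x) = rev (\<omega> x)"

fun join_end :: "half \<Rightarrow> half \<Rightarrow> vertex \<Rightarrow> vertex" where
  "join_end A C (Top i) = (case fate A i of Arc v j \<Rightarrow> Top j | Thru r \<Rightarrow> Bot (place C r))"
| "join_end A C (Bot i) = (case fate C i of Arc v j \<Rightarrow> Bot j | Thru r \<Rightarrow> Top (place A r))"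

fun join_word :: "half \<Rightarrow> half \<Rightarrow> (nat \<Rightarrow> blob list) \<Rightarrow> vertex \<Rightarrow> blob list" where
  "join_word A C w (Top i) = (case fate A i of Arc v j \<Rightarrow> v | Thru r \<Rightarrow> w r)"
| "join_word A C w (Bot i) = (case fate C i of Arc v j \<Rightarrow> v | Thru r \<Rightarrow> rev (w r))"

definition joined :: "nat \<Rightarrow> half \<Rightarrow> half \<Rightarrow> (nat \<Rightarrow> blob list) \<Rightarrow> line set" where
  "joined n A C w = wires n (join_end A C) (join_word A C w)"

locale half_diagram =
  fixes n p :: nat and A :: half
  assumes arc: "i \<in> {1..n} \<Longrightarrow> fate A i = Arc v j \<Longrightarrow> j \<in> {1..n} \<and> j \<noteq> i \<and> fate A j = Arc (rev v) i"
    and thru: "i \<in> {1..n} \<Longrightarrow> fate A i = Thru r \<Longrightarrow> r \<in> {1..p} \<and> place A r = i"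
    and place: "r \<in> {1..p} \<Longrightarrow> place A r \<in> {1..n} \<and> fate A (place A r) = Thru r"

text \<open>The conditions for a half to occur in a diagram whose blobs reach the sides. That only one arc is
decorated keeps an R-arc from lying to the left of an L-arc, where the tethers would cross; products
of cell basis elements close at most one decorated arc on each edge.\<close>

locale planar_half = half_diagram +
  assumes place_mono: "r \<in> {1..p} \<Longrightarrow> r' \<in> {1..p} \<Longrightarrow> r < r' \<Longrightarrow> place A r < place A r'"
    and nested: "i \<in> {1..n} \<Longrightarrow> fate A i = Arc v j \<Longrightarrow> i < k \<Longrightarrow> k < j \<Longrightarrow>
      \<exists>u m. fate A k = Arc u m \<and> i < m \<and> m < j"
    and left_exposed: "i \<in> {1..n} \<Longrightarrow> fate A i = Arc v j \<Longrightarrow> i < j \<Longrightarrow> LB \<in> set v \<Longrightarrow>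
      1 \<le> k \<Longrightarrow> k < i \<Longrightarrow> \<exists>u m. fate A k = Arc u m \<and> m < i"
    and right_exposed: "i \<in> {1..n} \<Longrightarrow> fate A i = Arc v j \<Longrightarrow> i < j \<Longrightarrow> RB \<in> set v \<Longrightarrow>
      j < k \<Longrightarrow> k \<le> n \<Longrightarrow> \<exists>u m. fate A k = Arc u m \<and> j < m"
    and one_decorated: "i \<in> {1..n} \<Longrightarrow> i' \<in> {1..n} \<Longrightarrow> fate A i = Arc v j \<Longrightarrow> fate A i' = Arc v' j' \<Longrightarrow>
      v \<noteq> [] \<Longrightarrow> v' \<noteq> [] \<Longrightarrow> i' = i \<or> i' = j"
    and arc_order: "i \<in> {1..n} \<Longrightarrow> fate A i = Arc (u @ LB # v @ RB # u') j \<Longrightarrow> i < j"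

lemma vertices_simps [simp]:
  "Top i \<in> vertices n \<longleftrightarrow> i \<in> {1..n}" "Bot i \<in> vertices n \<longleftrightarrow> i \<in> {1..n}"
  by (auto simp: vertices_def)

lemma mem_wires [simp]:
  "(x, w, y) \<in> wires n \<sigma> \<omega> \<longleftrightarrow> x \<in> vertices n \<and> w = \<omega> x \<and> y = \<sigma> x"
  by (auto simp: wires_def)

lemma wires_cong:
  "(\<And>x. x \<in> vertices n \<Longrightarrow> \<sigma> x = \<sigma>' x \<and> \<omega> x = \<omega>' x) \<Longrightarrow> wires n \<sigma> \<omega> = wires n \<sigma>' \<omega>'"
  by (auto simp: wires_def)

lemma wiring_joined:
  assumes "half_diagram n p A" and "half_diagram n p C"
  shows "wiring n (join_end A C) (join_word A C w)"
proof -
  interpret A: half_diagram n p A by fact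
  interpret C: half_diagram n p C by fact
  have "join_end A C x \<in> vertices n \<and> join_end A C x \<noteq> x \<and> join_end A C (join_end A C x) = x \<and>
     join_word A C w (join_end A C x) = rev (join_word A C w x)" if x: "x \<in> vertices n" for x
  proof (cases x)
    case (Top i)
    with x have i: "i \<in> {1..n}" by simp
    show ?thesis
    proof (cases "fate A i")
      case (Arc v j)
      with A.arc[OF i Arc] show ?thesis using Top by simp
    next
      case (Thru r)
      with A.thru[OF i Thru] C.place[of r] show ?thesis using Top by simp
    qed
  next
    case (Bot i)
    with x have i: "i \<in> {1..n}" by simp
    show ?thesis
    proof (cases "fate C i")
      case (Arc v j)
      with C.arc[OF i Arc] show ?thesis using Bot by simp
    next
      case (Thru r)
      with C.thru[OF i Thru] A.place[of r] show ?thesis using Bot by simp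
    qed
  qed
  then show ?thesis by unfold_locales blast+
qed

lemma (in wiring) wires_reverse: "(x, w, y) \<in> wires n \<sigma> \<omega> \<Longrightarrow> (y, rev w, x) \<in> wires n \<sigma> \<omega>"
  using other_end involution word_reverse by auto

lemma flip_joined: "flip (Diagram (joined n A C w) M) = Diagram (joined n C A (\<lambda>r. rev (w r))) M"
proof -
  have a: "flip_vertex ` vertices n = vertices n"
    by (simp add: vertices_def image_Un image_image Un_commute)
  have b: "flip_vertex (flip_vertex x) = x" for x by (cases x) auto
  have "(\<lambda>(x, w, y). (flip_vertex x, w, flip_vertex y)) ` joined n A C w
      = (\<lambda>x. (flip_vertex x, join_word A C w x, flip_vertex (join_end A C x))) ` vertices n"
    by (simp add: joined_def wires_def image_image)
  also have "\<dots> = (\<lambda>x. (x, join_word A C w (flip_vertex x), flip_vertex (join_end A C (flip_vertex x)))) ` flip_vertex ` vertices n"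
    by (simp add: image_image b)
  also have "\<dots> = joined n C A (\<lambda>r. rev (w r))"
    unfolding a joined_def wires_def
  proof (intro image_cong refl)
    fix x show "(x, join_word A C w (flip_vertex x), flip_vertex (join_end A C (flip_vertex x))) =
        (x, join_word C A (\<lambda>r. rev (w r)) x, join_end C A x)"
      by (cases x) (auto split: fate.splits)
  qed
  finally show ?thesis by (simp add: flip_def)
qed

section \<open>Planarity\<close>

lemma noncrossing_commute: "noncrossing A B \<longleftrightarrow> noncrossing B A"
  by (auto simp: noncrossing_def)

text \<open>The reason for all non-crossing facts below: one block lies in an interval whose interior the other
block avoids.\<close>

lemma noncrossing_interval:
  "A \<subseteq> {lo..hi} \<Longrightarrow> B \<inter> {lo<..<hi} = {} \<Longrightarrow> noncrossing A B"
proof -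
  assume A: "A \<subseteq> {lo..hi}" and B: "B \<inter> {lo<..<hi} = {}"
  have False if "a \<in> A" "b \<in> B" "c \<in> A" "a < b" "b < c" for a b c
  proof -
    from that(1,3) A have "lo \<le> a" "c \<le> hi" by auto
    with that have "b \<in> B \<inter> {lo<..<hi}" by auto
    with B show False by simp
  qed
  moreover have False if "a \<in> A" "d \<in> B" "c \<in> A" "a < d" "d < c" for a c d
    using that calculation by blast
  ultimately show ?thesis unfolding noncrossing_def by blast
qed

lemma noncrossing_mono: "noncrossing A B \<Longrightarrow> A' \<subseteq> A \<Longrightarrow> B' \<subseteq> B \<Longrightarrow> noncrossing A' B'"
  unfolding noncrossing_def by blast

lemma sides_subset: "sides n w \<subseteq> {0, n + 1}"
  by (auto simp: sides_def left_pos_def right_pos_def)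

lemma sides_rev [simp]: "sides n (rev w) = sides n w"
  by (simp add: sides_def)

lemma sides_Nil [simp]: "sides n [] = {}"
  by (simp add: sides_def)

context planar_half
begin

text \<open>The positions from the arc to the sides it is tethered to form an interval without end points of
propagating lines: an L on the arc puts all of them to its right, an R to its left.\<close>

lemma arc_thru_noncrossing:
  assumes i: "i \<in> {1..n}" and a: "fate A i = Arc v j" "i < j" and r: "r \<in> {1..p}"
    and q: "n + 1 < q" "q < 2 * n + 2" and s: "RB \<in> set s \<Longrightarrow> r = p" "LB \<in> set s \<Longrightarrow> r = 1"
  shows "noncrossing ({i, j} \<union> sides n v) ({place A r, q} \<union> sides n s)"
proof -
  from arc[OF i a(1)] have j: "j \<in> {1..n}" by simp
  from place[OF r] have g: "place A r \<in> {1..n}" "fate A (place A r) = Thru r" by auto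
  have out: "place A r < i \<or> j < place A r"
  proof (rule ccontr)
    assume "\<not> ?thesis"
    moreover have "place A r \<noteq> i" "place A r \<noteq> j" using g(2) a(1) arc[OF i a(1)] by auto
    ultimately have "i < place A r" "place A r < j" by auto
    from nested[OF i a(1) this] g(2) show False by simp
  qed
  have L: "j < place A r" if "LB \<in> set v"
    using left_exposed[OF i a that, of "place A r"] out g by auto
  have R: "place A r < i" if "RB \<in> set v"
    using right_exposed[OF i a that, of "place A r"] out g by auto
  define lo where "lo = (if LB \<in> set v then 0 else i)"
  define hi where "hi = (if RB \<in> set v then n + 1 else j)"
  show ?thesis
  proof (rule noncrossing_interval)
    show "{i, j} \<union> sides n v \<subseteq> {lo..hi}"
      using a(2) i j L R by (auto simp: lo_def hi_def sides_def left_pos_def right_pos_def)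
    show "({place A r, q} \<union> sides n s) \<inter> {lo<..<hi} = {}"
      using out L R q sides_subset[of n s] j g(1) a(2)
      by (auto simp: lo_def hi_def split: if_splits)
  qed
qed

text \<open>If the first arc is nested in the second, it is not exposed to a side and hence undecorated, and its
own interval separates the two. Otherwise the interval of the second arc does.\<close>

lemma arc_arc_noncrossing_undecorated:
  assumes i: "i \<in> {1..n}" "fate A i = Arc v j" "i < j" and i': "i' \<in> {1..n}" "fate A i' = Arc [] j'" "i' < j'"
    and ne: "{i, j} \<noteq> {i', j'}"
  shows "noncrossing ({i, j} \<union> sides n v) {i', j'}"
proof -
  from arc[OF i(1,2)] have j: "j \<in> {1..n}" "fate A j = Arc (rev v) i" by simp_all
  from arc[OF i'(1,2)] have j': "j' \<in> {1..n}" "fate A j' = Arc [] i'" by simp_all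
  have ne': "i \<noteq> i'" "i \<noteq> j'" "j \<noteq> i'" "j \<noteq> j'" using i i' j j' ne by auto
  show ?thesis
  proof (cases "i' < i \<and> j < j'")
    case True
    have "LB \<notin> set v" using left_exposed[OF i, of i'] i' i(3) True by auto
    moreover have "RB \<notin> set v" using right_exposed[OF i, of j'] j' i(3) True by auto
    ultimately have "sides n v = {}" by (simp add: sides_def)
    then show ?thesis
      using True i(3) by (intro noncrossing_interval[of _ i j]) auto
  next
    case False
    have "i < i' \<and> i' < j \<longrightarrow> j' < j" using nested[OF i(1,2), of i'] i'(2) by auto
    moreover have "i' < i \<and> i < j' \<longrightarrow> j < j'" using nested[OF i'(1,2), of i] i(2) by auto
    ultimately have "\<not> (i' < i \<and> i < j')" "\<not> (i' < j \<and> j < j')"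
      using False ne' by auto
    then have "({i, j} \<union> sides n v) \<inter> {i'<..<j'} = {}"
      using sides_subset[of n v] i' j' by auto
    then show ?thesis
      using i'(3) by (subst noncrossing_commute) (intro noncrossing_interval[of _ i' j'], auto)
  qed
qed

lemma arc_arc_noncrossing:
  assumes i: "i \<in> {1..n}" "fate A i = Arc v j" "i < j" and i': "i' \<in> {1..n}" "fate A i' = Arc v' j'" "i' < j'"
    and ne: "{i, j} \<noteq> {i', j'}"
  shows "noncrossing ({i, j} \<union> sides n v) ({i', j'} \<union> sides n v')"
proof (cases "v' = []")
  case True
  then show ?thesis using arc_arc_noncrossing_undecorated[OF i, of i' j'] i' ne by simp
next
  case False
  have "v = []"
  proof (rule ccontr)
    assume v: "v \<noteq> []"
    from one_decorated[OF i(1) i'(1) i(2) i'(2) v False] ne i i' arc[OF i(1,2)]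
    show False by auto
  qed
  then show ?thesis using arc_arc_noncrossing_undecorated[OF i', of i j] i ne noncrossing_commute by auto
qed

end

text \<open>Every line is recorded in both directions; for crossings the direction does not matter, and an arc
may be taken from left to right.\<close>

lemma joined_line_cases:
  assumes A: "half_diagram n p A" and C: "half_diagram n p C" and l: "(x, u, y) \<in> joined n A C w"
  obtains (top) i v j where "i \<in> {1..n}" "fate A i = Arc v j" "i < j" "{x, y} = {Top i, Top j}"
      "block n (x, u, y) = {i, j} \<union> sides n v"
  | (bottom) i v j where "i \<in> {1..n}" "fate C i = Arc v j" "i < j" "{x, y} = {Bot i, Bot j}"
      "block n (x, u, y) = {2 * n + 2 - i, 2 * n + 2 - j} \<union> sides n v"
  | (through) r where "r \<in> {1..p}" "{x, y} = {Top (place A r), Bot (place C r)}"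
      "block n (x, u, y) = {place A r, 2 * n + 2 - place C r} \<union> sides n (w r)"
proof -
  interpret A: half_diagram n p A by fact
  interpret C: half_diagram n p C by fact
  from l have x: "x \<in> vertices n" and u: "u = join_word A C w x" and y: "y = join_end A C x"
    by (auto simp: joined_def)
  show thesis
  proof (cases x)
    case [simp]: (Top i)
    with x have i: "i \<in> {1..n}" by simp
    show thesis
    proof (cases "fate A i")
      case [simp]: (Arc v j)
      note j = A.arc[OF i Arc]
      show thesis
      proof (cases "i < j")
        case True
        then show thesis using i u y by (intro top[of i v j]) (auto simp: block_def)
      next
        case False
        then show thesis using i j u y by (intro top[of j "rev v" i]) (auto simp: block_def)
      qed
    next
      case [simp]: (Thru r)
      from A.thru[OF i Thru] show thesis
        using u y by (intro through[of r]) (auto simp: block_def)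
    qed
  next
    case [simp]: (Bot i)
    with x have i: "i \<in> {1..n}" by simp
    show thesis
    proof (cases "fate C i")
      case [simp]: (Arc v j)
      note j = C.arc[OF i Arc]
      show thesis
      proof (cases "i < j")
        case True
        then show thesis using i u y by (intro bottom[of i v j]) (auto simp: block_def)
      next
        case False
        then show thesis using i j u y by (intro bottom[of j "rev v" i]) (auto simp: block_def)
      qed
    next
      case [simp]: (Thru r)
      from C.thru[OF i Thru] show thesis
        using u y by (intro through[of r]) (auto simp: block_def)
    qed
  qed
qed

lemma top_bottom_noncrossing:
  assumes "i \<le> n" "j \<le> n" "i' \<le> n" "j' \<le> n"
  shows "noncrossing ({i, j} \<union> sides n v) ({2 * n + 2 - i', 2 * n + 2 - j'} \<union> sides n v')"
  using assms sides_subset[of n v] sides_subset[of n v']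
  by (intro noncrossing_interval[of _ 0 "n + 1"]) auto

text \<open>Turning the rectangle upside down reverses the order of the positions but fixes the left side, which
is position \<open>0\<close>. This preserves non-crossing pairs, as the circular order is merely reversed, and
carries facts about the top edge over to the bottom edge.\<close>

definition upside :: "nat \<Rightarrow> nat \<Rightarrow> nat" where
  "upside n k = (if k = 0 then 0 else 2 * n + 2 - k)"

lemma upside_less:
  "a \<le> 2 * n + 1 \<Longrightarrow> b \<le> 2 * n + 1 \<Longrightarrow> upside n a < upside n b \<longleftrightarrow> b \<noteq> 0 \<and> (a = 0 \<or> b < a)"
  by (simp add: upside_def) arith

lemma noncrossing_upside:
  assumes nc: "noncrossing X Y" and "X \<subseteq> {0..2 * n + 1}" and "Y \<subseteq> {0..2 * n + 1}"
  shows "noncrossing (upside n ` X) (upside n ` Y)"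
proof -
  have "False" if h: "a \<in> X" "b \<in> Y" "c \<in> X" "d \<in> Y" and
     o: "upside n a < upside n b \<and> upside n b < upside n c \<and> upside n c < upside n d \<or>
       upside n b < upside n a \<and> upside n a < upside n d \<and> upside n d < upside n c" for a b c d
  proof -
    have bd: "a \<le> 2 * n + 1" "b \<le> 2 * n + 1" "c \<le> 2 * n + 1" "d \<le> 2 * n + 1"
      using h assms by auto
    have "a < d \<and> d < c \<and> c < b \<or> d < c \<and> c < b \<and> b < a \<or> b < c \<and> c < d \<and> d < a \<or> c < d \<and> d < a \<and> a < b"
      using o by (simp only: upside_less[OF bd(1,2)] upside_less[OF bd(2,3)] upside_less[OF bd(3,4)]
          upside_less[OF bd(2,1)] upside_less[OF bd(1,4)] upside_less[OF bd(4,3)]) auto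
    then show False using nc h unfolding noncrossing_def by blast
  qed
  then show ?thesis unfolding noncrossing_def by blast
qed

lemma upside_sides [simp]: "upside n ` sides n v = sides n v"
  by (auto simp: sides_def left_pos_def right_pos_def upside_def)

text \<open>Planarity splits into conditions on the two edges and one on the propagating lines, of which only the
first can reach the left side and only the last the right side.\<close>

lemma left_right_joined:
  assumes A: "planar_half n p A" and C: "planar_half n p C"
    and wL: "\<And>r. r \<in> {1..p} \<Longrightarrow> LB \<in> set (w r) \<Longrightarrow> r = 1"
    and wR: "\<And>r. r \<in> {1..p} \<Longrightarrow> RB \<in> set (w r) \<Longrightarrow> r = p"
    and M: "\<And>u. u \<in># M \<Longrightarrow> LB \<notin> set u \<or> RB \<notin> set u"
  shows "left_right_diagram n (Diagram (joined n A C w) M)"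
proof -
  interpret A: planar_half n p A by fact
  interpret C: planar_half n p C by fact
  have hA: "half_diagram n p A" and hC: "half_diagram n p C" by unfold_locales
  interpret W: wiring n "join_end A C" "join_word A C w" by (rule wiring_joined) fact+
  have through: "noncrossing ({place A r, 2 * n + 2 - place C r} \<union> sides n (w r))
      ({place A r', 2 * n + 2 - place C r'} \<union> sides n (w r'))"
    if r: "r \<in> {1..p}" "r' \<in> {1..p}" "r < r'" for r r'
  proof (subst noncrossing_commute, rule noncrossing_interval)
    have b: "place A r < place A r'" "place C r < place C r'"
       "place A r \<in> {1..n}" "place C r \<in> {1..n}" "place A r' \<in> {1..n}" "place C r' \<in> {1..n}"
      using r A.place_mono C.place_mono A.place C.place by auto
    have "LB \<notin> set (w r')" using wL[of r'] r by auto
    then show "{place A r', 2 * n + 2 - place C r'} \<union> sides n (w r') \<subseteq> {place A r' .. 2 * n + 2 - place C r'}"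
      using b by (auto simp: sides_def right_pos_def)
    have "RB \<notin> set (w r)" using wR[of r] r by auto
    then show "({place A r, 2 * n + 2 - place C r} \<union> sides n (w r)) \<inter> {place A r' <..< 2 * n + 2 - place C r'} = {}"
      using b by (auto simp: sides_def left_pos_def)
  qed
  have at: "noncrossing ({i, j} \<union> sides n v) ({place A r, 2 * n + 2 - place C r} \<union> sides n (w r))"
    if "i \<in> {1..n}" "fate A i = Arc v j" "i < j" "r \<in> {1..p}" for i v j r
    using that C.place[OF that(4)] wL[OF that(4)] wR[OF that(4)]
    by (intro A.arc_thru_noncrossing) auto
  have bt: "noncrossing ({2 * n + 2 - i, 2 * n + 2 - j} \<union> sides n v) ({place A r, 2 * n + 2 - place C r} \<union> sides n (w r))"
    if h: "i \<in> {1..n}" "fate C i = Arc v j" "i < j" "r \<in> {1..p}" for i v j r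
  proof -
    have j: "j \<in> {1..n}" using C.arc[OF h(1,2)] by simp
    have g: "place A r \<in> {1..n}" "place C r \<in> {1..n}" using A.place C.place h(4) by auto
    have "noncrossing ({i, j} \<union> sides n v) ({place C r, 2 * n + 2 - place A r} \<union> sides n (w r))"
      using h g wL[OF h(4)] wR[OF h(4)] by (intro C.arc_thru_noncrossing) auto
    then have "noncrossing (upside n ` ({i, j} \<union> sides n v)) (upside n ` ({place C r, 2 * n + 2 - place A r} \<union> sides n (w r)))"
      using h j g sides_subset[of n v] sides_subset[of n "w r"] by (intro noncrossing_upside) auto
    moreover have "upside n ` {i, j} = {2 * n + 2 - i, 2 * n + 2 - j}"
       "upside n ` {place C r, 2 * n + 2 - place A r} = {place A r, 2 * n + 2 - place C r}"
      using h j g by (auto simp: upside_def)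
    ultimately show ?thesis by (simp only: image_Un upside_sides)
  qed
  have bb: "noncrossing ({2 * n + 2 - i, 2 * n + 2 - j} \<union> sides n v) ({2 * n + 2 - i', 2 * n + 2 - j'} \<union> sides n v')"
    if h: "i \<in> {1..n}" "fate C i = Arc v j" "i < j" "i' \<in> {1..n}" "fate C i' = Arc v' j'" "i' < j'"
      "{i, j} \<noteq> {i', j'}" for i v j i' v' j'
  proof -
    have j: "j \<in> {1..n}" "j' \<in> {1..n}" using C.arc[OF h(1,2)] C.arc[OF h(4,5)] by simp_all
    have "noncrossing (upside n ` ({i, j} \<union> sides n v)) (upside n ` ({i', j'} \<union> sides n v'))"
      using h j C.arc_arc_noncrossing[OF h] sides_subset[of n v] sides_subset[of n v'] by (intro noncrossing_upside) auto
    moreover have "upside n ` {i, j} = {2 * n + 2 - i, 2 * n + 2 - j}"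
       "upside n ` {i', j'} = {2 * n + 2 - i', 2 * n + 2 - j'}"
      using h j by (auto simp: upside_def)
    ultimately show ?thesis by (simp only: image_Un upside_sides)
  qed
  show ?thesis
  proof (unfold_locales, unfold diagram.sel)
    fix x u y assume "(x, u, y) \<in> joined n A C w"
    then show "x \<in> vertices n \<and> y \<in> vertices n \<and> x \<noteq> y"
      using W.other_end W.no_fixpoint by (auto simp: joined_def dest: sym)
  next
    fix x u y assume "(x, u, y) \<in> joined n A C w"
    then show "(y, rev u, x) \<in> joined n A C w"
      unfolding joined_def by (rule W.wires_reverse)
  next
    fix x assume "x \<in> vertices n"
    then show "\<exists>!(u, y). (x, u, y) \<in> joined n A C w"
      by (auto simp: joined_def)
  next
    fix x u y x' u' y'
    assume l: "(x, u, y) \<in> joined n A C w" and l': "(x', u', y') \<in> joined n A C w" and ne: "{x, y} \<noteq> {x', y'}"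
    from hA hC l show "noncrossing (block n (x, u, y)) (block n (x', u', y'))"
    proof (cases rule: joined_line_cases)
      case t: (top i v j)
      note jj = A.arc[OF t(1,2)]
      from hA hC l' show ?thesis
      proof (cases rule: joined_line_cases)
        case t': (top i' v' j')
        have "{i, j} \<noteq> {i', j'}" using ne t(4) t'(4) by (auto simp: doubleton_eq_iff)
        then show ?thesis unfolding t(5) t'(5)
          using A.arc_arc_noncrossing[OF t(1-3) t'(1-3)] by simp
      next
        case t': (bottom i' v' j')
        show ?thesis unfolding t(5) t'(5)
          using t(1) t'(1) jj C.arc[OF t'(1,2)] by (intro top_bottom_noncrossing) auto
      next
        case t': (through r)
        show ?thesis unfolding t(5) t'(3) by (rule at[OF t(1-3) t'(1)])
      qed
    next
      case t: (bottom i v j)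
      note jj = C.arc[OF t(1,2)]
      from hA hC l' show ?thesis
      proof (cases rule: joined_line_cases)
        case t': (top i' v' j')
        show ?thesis unfolding t(5) t'(5) noncrossing_commute[of "{2 * n + 2 - i, _} \<union> _"]
          using t(1) t'(1) jj A.arc[OF t'(1,2)] by (intro top_bottom_noncrossing) auto
      next
        case t': (bottom i' v' j')
        have "{i, j} \<noteq> {i', j'}" using ne t(4) t'(4) by (auto simp: doubleton_eq_iff)
        then show ?thesis unfolding t(5) t'(5) by (rule bb[OF t(1-3) t'(1-3)])
      next
        case t': (through r)
        show ?thesis unfolding t(5) t'(3) by (rule bt[OF t(1-3) t'(1)])
      qed
    next
      case t: (through r)
      from hA hC l' show ?thesis
      proof (cases rule: joined_line_cases)
        case t': (top i v j)
        show ?thesis unfolding t(3) t'(5) noncrossing_commute[of "{place A r, _} \<union> _"] by (rule at[OF t'(1-3) t(1)])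
      next
        case t': (bottom i v j)
        show ?thesis unfolding t(3) t'(5) noncrossing_commute[of "{place A r, _} \<union> _"] by (rule bt[OF t'(1-3) t(1)])
      next
        case t': (through r')
        have "r \<noteq> r'" using ne t(2) t'(2) by auto
        then show ?thesis unfolding t(3) t'(3)
          using through[of r r'] through[of r' r] t(1) t'(1) noncrossing_commute by (cases "r < r'") auto
      qed
    qed
  next
    fix x u v u' y assume l: "(x, u @ LB # v @ RB # u', y) \<in> joined n A C w"
    then have x: "x \<in> vertices n" and u: "u @ LB # v @ RB # u' = join_word A C w x" and y: "y = join_end A C x"
      by (auto simp: joined_def)
    show "noncrossing {pos n x, left_pos} {pos n y, right_pos n}"
    proof (cases x)
      case [simp]: (Top i)
      with x have i: "i \<in> {1..n}" by simp
      show ?thesis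
      proof (cases "fate A i")
        case [simp]: (Arc s j)
        then have "s = u @ LB # v @ RB # u'" using u by simp
        with A.arc_order[OF i] Arc have "i < j" by auto
        then show ?thesis using y i
          by (intro noncrossing_interval[of _ 0 i]) (auto simp: left_pos_def right_pos_def)
      next
        case [simp]: (Thru r)
        have "place C r \<in> {1..n}" using A.thru[OF i Thru] C.place[of r] by simp
        then show ?thesis using y i
          by (intro noncrossing_interval[of _ 0 i]) (auto simp: left_pos_def right_pos_def)
      qed
    next
      case [simp]: (Bot i)
      with x have i: "i \<in> {1..n}" by simp
      show ?thesis
      proof (cases "fate C i")
        case [simp]: (Arc s j)
        then have "s = u @ LB # v @ RB # u'" using u by simp
        with C.arc_order[OF i] Arc have "i < j" by auto
        then show ?thesis using y i C.arc[OF i Arc]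
          by (subst noncrossing_commute, intro noncrossing_interval[of _ "n + 1" "2 * n + 2 - j"])
             (auto simp: left_pos_def right_pos_def)
      next
        case [simp]: (Thru r)
        have "place A r \<in> {1..n}" using C.thru[OF i Thru] A.place[of r] by simp
        then show ?thesis using y i
          by (subst noncrossing_commute, intro noncrossing_interval[of _ "place A r" "n + 1"])
             (auto simp: left_pos_def right_pos_def)
      qed
    qed
  next
    fix u l assume "u \<in># M" "l \<in> joined n A C w"
    have "noncrossing (sides n u) B" for B
      using M[OF \<open>u \<in># M\<close>] unfolding noncrossing_def sides_def by auto
    then show "noncrossing (sides n u) (block n l)" by blast
  next
    fix u assume "u \<in># M"
    from M[OF this] show "\<exists>k a b. rotate k u = replicate a LB @ replicate b RB"
    proof
      assume "LB \<notin> set u"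
      then have "\<forall>b\<in>set u. b = RB" by (metis blob.exhaust)
      then have "rotate 0 u = replicate 0 LB @ replicate (length u) RB"
        by (simp add: replicate_length_same)
      then show ?thesis by blast
    next
      assume "RB \<notin> set u"
      then have "\<forall>b\<in>set u. b = LB" by (metis blob.exhaust)
      then have "rotate 0 u = replicate (length u) LB @ replicate 0 RB"
        by (simp add: replicate_length_same)
      then show ?thesis by blast
    qed
  qed
qed

section \<open>Edges with few arcs\<close>

definition no_arc :: half where
  "no_arc = Half Thru (\<lambda>r. r)"

definition one_arc :: "nat \<Rightarrow> blob list \<Rightarrow> half" where
  "one_arc j a = Half (\<lambda>i. if i = j then Arc a (j + 1) else if i = j + 1 then Arc (rev a) j
       else Thru (if i < j then i else i - 2)) (\<lambda>r. if r < j then r else r + 2)"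

text \<open>The top edge of a product whose upper factor has top edge \<open>A\<close>: its propagating lines continue
according to \<open>B\<close>, where some of them are closed to arcs.\<close>

definition refine :: "half \<Rightarrow> half \<Rightarrow> half" where
  "refine A B = Half (\<lambda>i. case fate A i of Arc v j \<Rightarrow> Arc v j
       | Thru r \<Rightarrow> (case fate B r of Arc v r' \<Rightarrow> Arc v (place A r') | Thru u \<Rightarrow> Thru u))
     (\<lambda>u. place A (place B u))"

lemma no_arc_simps [simp]: "fate no_arc i = Thru i" "place no_arc r = r"
  by (simp_all add: no_arc_def)

lemma one_arc_simps [simp]:
  "fate (one_arc j a) j = Arc a (Suc j)" "fate (one_arc j a) (Suc j) = Arc (rev a) j"
  by (simp_all add: one_arc_def)

lemma fate_one_arc: "fate (one_arc j a) i = (if i = j then Arc a (j + 1) else if i = j + 1 then Arc (rev a) j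
       else Thru (if i < j then i else i - 2))"
  by (simp add: one_arc_def)

lemma place_one_arc: "place (one_arc j a) r = (if r < j then r else r + 2)"
  by (simp add: one_arc_def)

lemma half_no_arc: "half_diagram n n no_arc"
  by unfold_locales auto

lemma half_one_arc:
  assumes "1 \<le> j" "j < n"
  shows "half_diagram n (n - 2) (one_arc j a)"
  using assms by unfold_locales (auto simp: fate_one_arc place_one_arc split: if_splits)

text \<open>The word of an arc has to be read with all L before all R, from left to right.\<close>

lemma planar_one_arc:
  assumes j: "1 \<le> j" "j < n" and L: "LB \<in> set a \<Longrightarrow> j = 1" and R: "RB \<in> set a \<Longrightarrow> j = n - 1"
    and a: "a = replicate x LB @ replicate y RB"
  shows "planar_half n (n - 2) (one_arc j a)"
proof -
  interpret half_diagram n "n - 2" "one_arc j a" using j by (rule half_one_arc)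
  have no: "rev a \<noteq> u @ LB # v @ RB # u'" for u v u'
  proof
    assume "rev a = u @ LB # v @ RB # u'"
    then have "rev (rev a) = rev (u @ LB # v @ RB # u')" by simp
    then have e: "replicate x LB @ replicate y RB = rev u' @ RB # rev v @ LB # rev u"
      using a by simp
    have r: "sorted_wrt (\<lambda>b c. \<not> (b = RB \<and> c = LB)) (replicate z b)" for z b
      by (induction z) auto
    have "sorted_wrt (\<lambda>b c. \<not> (b = RB \<and> c = LB)) (replicate x LB @ replicate y RB)"
      using r by (auto simp: sorted_wrt_append)
    then have "sorted_wrt (\<lambda>b c. \<not> (b = RB \<and> c = LB)) (rev u' @ RB # rev v @ LB # rev u)"
      by (simp only: e)
    then show False by (simp add: sorted_wrt_append)
  qed
  show ?thesis
    by unfold_locales (use j L R no in \<open>auto simp: fate_one_arc place_one_arc split: if_splits\<close>)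
qed

lemma half_refine:
  assumes "half_diagram n p A" and "half_diagram p p' B"
  shows "half_diagram n p' (refine A B)"
proof -
  interpret A: half_diagram n p A by fact
  interpret B: half_diagram p p' B by fact
  show ?thesis
  proof
    fix i v j assume i: "i \<in> {1..n}" and f: "fate (refine A B) i = Arc v j"
    show "j \<in> {1..n} \<and> j \<noteq> i \<and> fate (refine A B) j = Arc (rev v) i"
    proof (cases "fate A i")
      case (Arc u k)
      with A.arc[OF i Arc] f show ?thesis by (simp add: refine_def)
    next
      case (Thru r)
      note t = A.thru[OF i Thru]
      from Thru f obtain r' where r': "fate B r = Arc v r'" "j = place A r'"
        by (auto simp: refine_def split: fate.splits)
      from B.arc[OF _ r'(1)] t have "r' \<in> {1..p}" "r' \<noteq> r" "fate B r' = Arc (rev v) r" by auto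
      moreover from A.place[OF this(1)] have "j \<in> {1..n}" "fate A j = Thru r'" using r' by auto
      ultimately show ?thesis using t Thru by (auto simp: refine_def)
    qed
  next
    fix i r assume i: "i \<in> {1..n}" and f: "fate (refine A B) i = Thru r"
    then obtain s where s: "fate A i = Thru s" "fate B s = Thru r"
      by (auto simp: refine_def split: fate.splits)
    from A.thru[OF i s(1)] B.thru[OF _ s(2)] show "r \<in> {1..p'} \<and> place (refine A B) r = i"
      by (auto simp: refine_def)
  next
    fix r assume "r \<in> {1..p'}"
    from B.place[OF this] A.place[of "place B r"]
    show "place (refine A B) r \<in> {1..n} \<and> fate (refine A B) (place (refine A B) r) = Thru r"
      by (simp add: refine_def)
  qed
qed

context planar_half
begin

lemma place_less_iff: "r \<in> {1..p} \<Longrightarrow> r' \<in> {1..p} \<Longrightarrow> place A r < place A r' \<longleftrightarrow> r < r'"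
  using place_mono[of r r'] place_mono[of r' r] by (metis nat_neq_iff order_less_asym)

lemma arc_thru_sides:
  assumes "i \<in> {1..n}" "fate A i = Arc u j" "k \<in> {1..n}" "fate A k = Thru r"
  shows "i < k \<longleftrightarrow> j < k"
proof -
  note j = arc[OF assms(1,2)]
  have "i \<noteq> k" "j \<noteq> k" using j assms by auto
  moreover have "\<not> (i < k \<and> k < j)" using nested[OF assms(1,2), of k] assms(4) by auto
  moreover have "\<not> (j < k \<and> k < i)" using nested[of j "rev u" i k] j assms(4) by auto
  ultimately show ?thesis by linarith
qed

end

text \<open>As \<open>place A\<close> preserves the order, the arcs of \<open>B\<close> are nested and exposed among the propagating lines
of \<open>A\<close> as they are in \<open>B\<close>, and the gaps between these lines are filled by complete arcs of \<open>A\<close>.\<close>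

lemma planar_refine:
  assumes "planar_half n p A" and "planar_half p p' B"
    and und: "\<And>i v j. i \<in> {1..n} \<Longrightarrow> fate A i = Arc v j \<Longrightarrow> v = []"
  shows "planar_half n p' (refine A B)"
proof -
  interpret A: planar_half n p A by fact
  interpret B: planar_half p p' B by fact
  interpret half_diagram n p' "refine A B" by (rule half_refine) unfold_locales
  have inner: "\<exists>r r'. fate A i = Thru r \<and> r \<in> {1..p} \<and> place A r = i \<and> fate B r = Arc v r' \<and> r' \<in> {1..p} \<and>
      place A r' = j \<and> fate A j = Thru r'"
    if "i \<in> {1..n}" "fate (refine A B) i = Arc v j" "\<And>u m. fate A i \<noteq> Arc u m" for i v j
  proof -
    from that(2,3) obtain r r' where r: "fate A i = Thru r" "fate B r = Arc v r'" "place A r' = j"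
      by (auto simp: refine_def split: fate.splits)
    from A.thru[OF that(1) r(1)] B.arc[OF _ r(2)] r A.place[of r'] show ?thesis by auto
  qed
  have inner': "\<exists>r r'. fate A i = Thru r \<and> r \<in> {1..p} \<and> place A r = i \<and> fate B r = Arc v r' \<and> r' \<in> {1..p} \<and>
      place A r' = j \<and> fate A j = Thru r'"
    if "i \<in> {1..n}" "fate (refine A B) i = Arc v j" "v \<noteq> []" for i v j
    using that und[OF that(1)] by (intro inner) (auto simp: refine_def)
  have arcA: "fate (refine A B) k = Arc u m" if "fate A k = Arc u m" for k u m
    using that by (simp add: refine_def)
  have arcB: "fate (refine A B) k = Arc u (place A m)" if "fate A k = Thru s" "fate B s = Arc u m" for k u s m
    using that by (simp add: refine_def)
  show ?thesis
  proof
    fix r r' assume "r \<in> {1..p'}" "r' \<in> {1..p'}" "r < r'"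
    then show "place (refine A B) r < place (refine A B) r'"
      using B.place[of r] B.place[of r'] by (simp add: refine_def A.place_mono B.place_mono)
  next
    fix i v j k assume i: "i \<in> {1..n}" and f: "fate (refine A B) i = Arc v j" and k: "i < k" "k < j"
    show "\<exists>u m. fate (refine A B) k = Arc u m \<and> i < m \<and> m < j"
    proof (cases "fate A i")
      case (Arc u m)
      then have "fate A i = Arc v j" using f by (simp add: refine_def)
      from A.nested[OF i this k] show ?thesis using arcA by blast
    next
      case (Thru r0)
      with inner[OF i f] obtain r r' where r: "fate A i = Thru r" "r \<in> {1..p}" "place A r = i"
        "fate B r = Arc v r'" "r' \<in> {1..p}" "place A r' = j" "fate A j = Thru r'" by auto
      have j: "j \<in> {1..n}" and kn: "k \<in> {1..n}" using A.place[OF r(5)] r(6) k i by auto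
      show ?thesis
      proof (cases "fate A k")
        case (Arc u m)
        with A.arc_thru_sides[OF kn Arc i r(1)] A.arc_thru_sides[OF kn Arc j r(7)] k A.arc[OF kn Arc] r
        have "i < m" "m < j" by (metis fate.distinct(1) linorder_neqE_nat order_less_asym)+
        then show ?thesis using arcA[OF Arc] by blast
      next
        case (Thru s)
        note t = A.thru[OF kn Thru]
        have "r < s" "s < r'" using A.place_less_iff r t k by metis+
        from B.nested[OF r(2,4) this] obtain u m where m: "fate B s = Arc u m" "r < m" "m < r'" by blast
        moreover from m r have "m \<in> {1..p}" by auto
        ultimately show ?thesis using arcB[OF Thru m(1)] A.place_less_iff r by metis
      qed
    qed
  next
    fix i v j k assume i: "i \<in> {1..n}" and f: "fate (refine A B) i = Arc v j" and ij: "i < j"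
      and L: "LB \<in> set v" and k: "1 \<le> k" "k < i"
    from L have "v \<noteq> []" by auto
    from inner'[OF i f this] obtain r r' where r: "fate A i = Thru r" "r \<in> {1..p}" "place A r = i"
        "fate B r = Arc v r'" "r' \<in> {1..p}" "place A r' = j" "fate A j = Thru r'" by auto
    have kn: "k \<in> {1..n}" using k i by auto
    have rr: "r < r'" using A.place_less_iff r ij by metis
    show "\<exists>u m. fate (refine A B) k = Arc u m \<and> m < i"
    proof (cases "fate A k")
      case (Arc u m)
      from A.arc_thru_sides[OF kn Arc i r(1)] k arcA[OF Arc] show ?thesis by auto
    next
      case (Thru s)
      note t = A.thru[OF kn Thru]
      have "s < r" using A.place_less_iff r t k by metis
      with B.left_exposed[OF r(2,4) rr L, of s] t obtain u m where m: "fate B s = Arc u m" "m < r" by auto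
      with B.arc[of s] t have "m \<in> {1..p}" by auto
      with m show ?thesis using arcB[OF Thru m(1)] A.place_less_iff r by metis
    qed
  next
    fix i v j k assume i: "i \<in> {1..n}" and f: "fate (refine A B) i = Arc v j" and ij: "i < j"
      and R: "RB \<in> set v" and k: "j < k" "k \<le> n"
    from R have "v \<noteq> []" by auto
    from inner'[OF i f this] obtain r r' where r: "fate A i = Thru r" "r \<in> {1..p}" "place A r = i"
        "fate B r = Arc v r'" "r' \<in> {1..p}" "place A r' = j" "fate A j = Thru r'" by auto
    have kn: "k \<in> {1..n}" using k i ij by auto
    have j: "j \<in> {1..n}" using A.place[OF r(5)] r(6) by auto
    have rr: "r < r'" using A.place_less_iff r ij by metis
    show "\<exists>u m. fate (refine A B) k = Arc u m \<and> j < m"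
    proof (cases "fate A k")
      case (Arc u m)
      note am = A.arc[OF kn Arc]
      with A.arc_thru_sides[OF kn Arc j r(7)] k r(7) have "j < m"
        by (metis fate.distinct(1) linorder_neqE_nat order_less_asym)
      then show ?thesis using arcA[OF Arc] by blast
    next
      case (Thru s)
      note t = A.thru[OF kn Thru]
      have "r' < s" using A.place_less_iff r t k by metis
      with B.right_exposed[OF r(2,4) rr R, of s] t obtain u m where m: "fate B s = Arc u m" "r' < m" by auto
      with B.arc[of s] t have "m \<in> {1..p}" by auto
      with m show ?thesis using arcB[OF Thru m(1)] A.place_less_iff r by metis
    qed
  next
    fix i i' v j v' j' assume i: "i \<in> {1..n}" and i': "i' \<in> {1..n}" and f: "fate (refine A B) i = Arc v j"
      and f': "fate (refine A B) i' = Arc v' j'" and "v \<noteq> []" "v' \<noteq> []"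
    with inner'[OF i f] inner'[OF i' f'] B.one_decorated show "i' = i \<or> i' = j" by metis
  next
    fix i u v u' j assume i: "i \<in> {1..n}" and f: "fate (refine A B) i = Arc (u @ LB # v @ RB # u') j"
    from inner'[OF i f] B.arc_order A.place_less_iff show "i < j" by (metis append_is_Nil_conv list.distinct(1))
  qed
qed

section \<open>Stacking\<close>

text \<open>The curves of \<open>trail\<close>, but built from the front, so that a curve can be followed from its starting
point.\<close>

inductive route :: "diagram \<Rightarrow> diagram \<Rightarrow> nat \<Rightarrow> bool \<Rightarrow> site \<Rightarrow> blob list \<Rightarrow> bool \<Rightarrow> site \<Rightarrow> bool"
  for D D' :: diagram and k :: nat where
  last: "(x, w, y) \<in> layer D D' s \<Longrightarrow> route D D' k s x w s y"
| first: "(x, v, Middle j) \<in> layer D D' s \<Longrightarrow> k < j \<Longrightarrow> route D D' k (\<not> s) (Middle j) w t y \<Longrightarrow>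
    route D D' k s x (v @ w) t y"

lemma route_extend:
  assumes "route D D' k s x w t z" and "z = Middle j" and "k < j" and "(Middle j, v, y) \<in> layer D D' (\<not> t)"
  shows "route D D' k s x (w @ v) (\<not> t) y"
  using assms
proof (induction)
  case (last x w z s)
  then show ?case by (auto intro: route.intros)
next
  case (first x u i s w t z)
  then show ?case using route.first[OF first.hyps(1,2)] by simp
qed

lemma trail_extend:
  assumes "trail D D' k s' z w t y" and "z = Middle j" and "s' = (\<not> s)" and "k < j" and "(x, v, Middle j) \<in> layer D D' s"
  shows "trail D D' k s x (v @ w) t y"
  using assms
proof (induction)
  case (start z w y s')
  then have "trail D D' k s x v s (Middle j)" by (auto intro: trail.start)
  from trail.step[OF this] start show ?case by auto
next
  case (step s' z w t i u y)
  then show ?case using trail.step[of D D' k s x "v @ w" t i u y] by simp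
qed

lemma trail_iff_route: "trail D D' k s x w t y \<longleftrightarrow> route D D' k s x w t y"
proof
  assume "trail D D' k s x w t y"
  then show "route D D' k s x w t y"
    by induction (auto intro: route.intros route_extend)
next
  assume "route D D' k s x w t y"
  then show "trail D D' k s x w t y"
    by induction (auto intro: trail.start trail_extend)
qed

definition functional :: "diagram \<Rightarrow> bool" where
  "functional D \<longleftrightarrow> (\<forall>x w y w' y'. (x, w, y) \<in> lines D \<longrightarrow> (x, w', y') \<in> lines D \<longrightarrow> w = w' \<and> y = y')"

lemma functional_wires: "functional (Diagram (wires n \<sigma> \<omega>) M)"
  by (simp add: functional_def)

lemma site_inj: "site_in_upper x = site_in_upper y \<longleftrightarrow> x = y" "site_in_lower x = site_in_lower y \<longleftrightarrow> x = y"
  "outer_site x = outer_site y \<longleftrightarrow> x = y"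
  by (cases x; cases y; simp)+

lemma layer_functional:
  assumes "functional D" "functional D'" "(x, w, y) \<in> layer D D' s" "(x, w', y') \<in> layer D D' s"
  shows "w = w' \<and> y = y'"
  using assms unfolding functional_def layer_def
  by (auto split: if_splits simp: site_inj)

text \<open>Each site has at most one line in either layer, so a curve can be followed in one way only, and an
outer site ends it. Hence one route found is the only one, which is how stacked diagrams are
computed.\<close>

lemma route_deterministic:
  assumes "route D D' k s x w t y" and "route D D' k s x w' t' y'"
    and D: "functional D" "functional D'" and "\<And>j. y \<noteq> Middle j" and y': "\<And>j. y' \<noteq> Middle j"
  shows "w = w' \<and> t = t' \<and> y = y'"
  using assms(1,2,5)
proof (induction arbitrary: w')
  case (last x w y s)
  from last(2,1,3) layer_functional[OF D] show ?case
    by cases blast+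
next
  case (first x v j s w t y)
  from first.prems(1) show ?case
  proof cases
    case last
    with first.hyps(1) layer_functional[OF D] y' show ?thesis by blast
  next
    case (first v' j' w'')
    with layer_functional[OF D this(2) \<open>(x, v, Middle j) \<in> layer D D' s\<close>] first.IH first.prems(2) show ?thesis by auto
  qed
qed

fun is_top :: "vertex \<Rightarrow> bool" where
  "is_top (Top i) = True"
| "is_top (Bot i) = False"

lemma outer_line:
  assumes "(outer_site x, w, y) \<in> layer (Diagram (wires n \<sigma> \<omega>) M) (Diagram (wires n \<sigma>' \<omega>') M') s"
  shows "s = is_top x \<and> x \<in> vertices n"
  using assms
proof (cases s)
  case True
  with assms obtain z where "z \<in> vertices n" "outer_site x = site_in_upper z" by (auto simp: layer_def)
  with True show ?thesis by (cases x; cases z) auto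
next
  case False
  with assms obtain z where "z \<in> vertices n" "outer_site x = site_in_lower z" by (auto simp: layer_def)
  with False show ?thesis by (cases x; cases z) auto
qed

lemma lines_stack_wires:
  fixes n :: nat and \<sigma>1 \<sigma>2 :: "vertex \<Rightarrow> vertex" and \<omega>1 \<omega>2 :: "vertex \<Rightarrow> blob list"
    and M M' :: "blob list multiset"
  defines "D \<equiv> Diagram (wires n \<sigma>1 \<omega>1) M" and "D' \<equiv> Diagram (wires n \<sigma>2 \<omega>2) M'"
  assumes r: "\<And>x. x \<in> vertices n \<Longrightarrow> \<exists>t. route D D' 0 (is_top x) (outer_site x) (\<omega> x) t (outer_site (\<sigma> x))"
  shows "lines (stack D D') = wires n \<sigma> \<omega>"
proof -
  have fn: "functional D" "functional D'" by (simp_all add: D_def D'_def functional_wires)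
  have out: "outer_site x \<noteq> Middle j" for x j by (cases x) auto
  have "(\<exists>s t. route D D' 0 s (outer_site x) w t (outer_site y)) \<longleftrightarrow> x \<in> vertices n \<and> w = \<omega> x \<and> y = \<sigma> x" for x w y
  proof
    assume "\<exists>s t. route D D' 0 s (outer_site x) w t (outer_site y)"
    then obtain s t where st: "route D D' 0 s (outer_site x) w t (outer_site y)" by blast
    then have "s = is_top x \<and> x \<in> vertices n"
      by cases (use outer_line[of x _ _ n \<sigma>1 \<omega>1 M \<sigma>2 \<omega>2 M' s] in \<open>auto simp: D_def D'_def\<close>)
    with r[of x] st obtain t' where "route D D' 0 s (outer_site x) (\<omega> x) t' (outer_site (\<sigma> x))" "x \<in> vertices n" by auto
    with route_deterministic[OF st this(1) fn out out] show "x \<in> vertices n \<and> w = \<omega> x \<and> y = \<sigma> x"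
      by (simp add: site_inj)
  next
    assume "x \<in> vertices n \<and> w = \<omega> x \<and> y = \<sigma> x"
    with r[of x] show "\<exists>s t. route D D' 0 s (outer_site x) w t (outer_site y)" by blast
  qed
  then have "(x, w, y) \<in> lines (stack D D') \<longleftrightarrow> (x, w, y) \<in> wires n \<sigma> \<omega>" for x w y
    by (simp add: stack_def trail_iff_route)
  then show ?thesis by auto
qed

text \<open>A line coming down to the middle site \<open>i\<close>, where \<open>K\<close> is the edge above and \<open>H\<close> the edge below the middle
sites, either continues downwards as the \<open>s\<close>-th propagating line of the lower layer, directly or after
one arc of each edge, or turns back along an arc of \<open>H\<close> and leaves as the \<open>r\<close>-th propagating line of
the upper layer. With one arc on each edge there are no longer detours. For lines coming up from
below, \<open>K\<close> and \<open>H\<close> change places.\<close>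

definition crosses :: "half \<Rightarrow> half \<Rightarrow> nat \<Rightarrow> blob list \<Rightarrow> nat \<Rightarrow> bool" where
  "crosses K H i v s \<longleftrightarrow> fate H i = Thru s \<and> v = [] \<or>
     (\<exists>x m x' m'. fate H i = Arc x m \<and> fate K m = Arc x' m' \<and> fate H m' = Thru s \<and> v = x @ x')"

definition turns :: "half \<Rightarrow> half \<Rightarrow> nat \<Rightarrow> blob list \<Rightarrow> nat \<Rightarrow> bool" where
  "turns K H i v r \<longleftrightarrow> (\<exists>m. fate H i = Arc v m \<and> fate K m = Thru r)"

text \<open>The upper diagram has top edge \<open>A\<close> and bottom edge \<open>K\<close>, the lower one top edge \<open>H\<close> and bottom edge
\<open>C\<close>; thus \<open>K\<close> and \<open>H\<close> meet at the middle sites.\<close>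

locale stacking =
  fixes n p p' :: nat and A K H C :: half and w w' :: "nat \<Rightarrow> blob list"
  assumes A: "half_diagram n p A" and K: "half_diagram n p K"
    and H: "half_diagram n p' H" and C: "half_diagram n p' C"
begin

sublocale A: half_diagram n p A by (rule A)
sublocale K: half_diagram n p K by (rule K)
sublocale H: half_diagram n p' H by (rule H)
sublocale C: half_diagram n p' C by (rule C)

definition "upper = Diagram (joined n A K w) {#}"
definition "lower = Diagram (joined n H C w') {#}"

lemma layer_upper_iff:
  "(Upper i, v, y) \<in> layer upper lower True \<longleftrightarrow> i \<in> {1..n} \<and>
     (v, y) = (case fate A i of Arc u j \<Rightarrow> (u, Upper j) | Thru r \<Rightarrow> (w r, Middle (place K r)))"
  "(Middle i, v, y) \<in> layer upper lower True \<longleftrightarrow> i \<in> {1..n} \<and>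
     (v, y) = (case fate K i of Arc u j \<Rightarrow> (u, Middle j) | Thru r \<Rightarrow> (rev (w r), Upper (place A r)))"
proof -
  have *: "(site_in_upper x, v, y) \<in> layer upper lower True \<longleftrightarrow> x \<in> vertices n \<and>
      v = join_word A K w x \<and> y = site_in_upper (join_end A K x)" for x
    by (auto simp: layer_def upper_def joined_def wires_def site_inj image_image image_iff)
  from *[of "Top i"] show "(Upper i, v, y) \<in> layer upper lower True \<longleftrightarrow> i \<in> {1..n} \<and>
     (v, y) = (case fate A i of Arc u j \<Rightarrow> (u, Upper j) | Thru r \<Rightarrow> (w r, Middle (place K r)))"
    by (auto split: fate.splits)
  from *[of "Bot i"] show "(Middle i, v, y) \<in> layer upper lower True \<longleftrightarrow> i \<in> {1..n} \<and>
     (v, y) = (case fate K i of Arc u j \<Rightarrow> (u, Middle j) | Thru r \<Rightarrow> (rev (w r), Upper (place A r)))"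
    by (auto split: fate.splits)
qed

lemma layer_lower_iff:
  "(Middle i, v, y) \<in> layer upper lower False \<longleftrightarrow> i \<in> {1..n} \<and>
     (v, y) = (case fate H i of Arc u j \<Rightarrow> (u, Middle j) | Thru r \<Rightarrow> (w' r, Lower (place C r)))"
  "(Lower i, v, y) \<in> layer upper lower False \<longleftrightarrow> i \<in> {1..n} \<and>
     (v, y) = (case fate C i of Arc u j \<Rightarrow> (u, Lower j) | Thru r \<Rightarrow> (rev (w' r), Middle (place H r)))"
proof -
  have *: "(site_in_lower x, v, y) \<in> layer upper lower False \<longleftrightarrow> x \<in> vertices n \<and>
      v = join_word H C w' x \<and> y = site_in_lower (join_end H C x)" for x
    by (auto simp: layer_def lower_def joined_def wires_def site_inj image_image image_iff)
  from *[of "Top i"] show "(Middle i, v, y) \<in> layer upper lower False \<longleftrightarrow> i \<in> {1..n} \<and>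
     (v, y) = (case fate H i of Arc u j \<Rightarrow> (u, Middle j) | Thru r \<Rightarrow> (w' r, Lower (place C r)))"
    by (auto split: fate.splits)
  from *[of "Bot i"] show "(Lower i, v, y) \<in> layer upper lower False \<longleftrightarrow> i \<in> {1..n} \<and>
     (v, y) = (case fate C i of Arc u j \<Rightarrow> (u, Lower j) | Thru r \<Rightarrow> (rev (w' r), Middle (place H r)))"
    by (auto split: fate.splits)
qed

lemma route_top_arc:
  "i \<in> {1..n} \<Longrightarrow> fate A i = Arc v j \<Longrightarrow> route upper lower 0 True (Upper i) v True (Upper j)"
  by (intro route.last) (simp add: layer_upper_iff)

lemma route_bottom_arc:
  "i \<in> {1..n} \<Longrightarrow> fate C i = Arc v j \<Longrightarrow> route upper lower 0 False (Lower i) v False (Lower j)"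
  by (intro route.last) (simp add: layer_lower_iff)

lemma route_top_turns:
  assumes i: "i \<in> {1..n}" "fate A i = Thru r" and t: "turns K H (place K r) v r'"
  shows "route upper lower 0 True (Upper i) (w r @ v @ rev (w r')) True (Upper (place A r'))"
proof -
  from t obtain m where m: "fate H (place K r) = Arc v m" "fate K m = Thru r'" by (auto simp: turns_def)
  have k: "place K r \<in> {1..n}" using A.thru[OF i] K.place by auto
  from H.arc[OF k m(1)] have mn: "m \<in> {1..n}" by simp
  have "route upper lower 0 True (Middle m) (rev (w r')) True (Upper (place A r'))"
    using m mn by (intro route.last) (simp add: layer_upper_iff)
  moreover have "(Middle (place K r), v, Middle m) \<in> layer upper lower False"
    using m k by (simp add: layer_lower_iff)
  ultimately have "route upper lower 0 False (Middle (place K r)) (v @ rev (w r')) True (Upper (place A r'))"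
    using mn by - (rule route.first[of _ _ m], auto)
  moreover have "(Upper i, w r, Middle (place K r)) \<in> layer upper lower True"
    using i by (simp add: layer_upper_iff)
  ultimately show ?thesis using k by - (rule route.first[of _ _ "place K r"], auto)
qed

lemma route_bottom_turns:
  assumes i: "i \<in> {1..n}" "fate C i = Thru s" and t: "turns H K (place H s) v s'"
  shows "route upper lower 0 False (Lower i) (rev (w' s) @ v @ w' s') False (Lower (place C s'))"
proof -
  from t obtain m where m: "fate K (place H s) = Arc v m" "fate H m = Thru s'" by (auto simp: turns_def)
  have k: "place H s \<in> {1..n}" using C.thru[OF i] H.place by auto
  from K.arc[OF k m(1)] have mn: "m \<in> {1..n}" by simp
  have "route upper lower 0 False (Middle m) (w' s') False (Lower (place C s'))"
    using m mn by (intro route.last) (simp add: layer_lower_iff)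
  moreover have "(Middle (place H s), v, Middle m) \<in> layer upper lower True"
    using m k by (simp add: layer_upper_iff)
  ultimately have "route upper lower 0 True (Middle (place H s)) (v @ w' s') False (Lower (place C s'))"
    using mn by - (rule route.first[of _ _ m], auto)
  moreover have "(Lower i, rev (w' s), Middle (place H s)) \<in> layer upper lower False"
    using i by (simp add: layer_lower_iff)
  ultimately show ?thesis using k by - (rule route.first[of _ _ "place H s"], auto)
qed

lemma route_top_crosses:
  assumes i: "i \<in> {1..n}" "fate A i = Thru r" and c: "crosses K H (place K r) v s"
  shows "route upper lower 0 True (Upper i) (w r @ v @ w' s) False (Lower (place C s))"
proof -
  have k: "place K r \<in> {1..n}" using A.thru[OF i] K.place by auto
  have last: "route upper lower 0 False (Middle m) (w' s) False (Lower (place C s))"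
    if "m \<in> {1..n}" "fate H m = Thru s" for m
    using that by (intro route.last) (simp add: layer_lower_iff)
  have "route upper lower 0 False (Middle (place K r)) (v @ w' s) False (Lower (place C s))"
    using c[unfolded crosses_def]
  proof (elim disjE exE conjE)
    assume "fate H (place K r) = Thru s" "v = []"
    then show ?thesis using last k by simp
  next
    fix x m x' m'
    assume h: "fate H (place K r) = Arc x m" "fate K m = Arc x' m'" "fate H m' = Thru s" "v = x @ x'"
    have m: "m \<in> {1..n}" using H.arc[OF k h(1)] by simp
    then have m': "m' \<in> {1..n}" using K.arc[OF _ h(2)] by simp
    have "route upper lower 0 True (Middle m) (x' @ w' s) False (Lower (place C s))"
      using m m' h last[OF m' h(3)] by - (rule route.first[of _ _ m'], auto simp: layer_upper_iff)
    then have "route upper lower 0 False (Middle (place K r)) (x @ x' @ w' s) False (Lower (place C s))"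
      using m k h by - (rule route.first[of _ _ m], auto simp: layer_lower_iff)
    then show ?thesis using h by simp
  qed
  moreover have "(Upper i, w r, Middle (place K r)) \<in> layer upper lower True"
    using i by (simp add: layer_upper_iff)
  ultimately show ?thesis using k by - (rule route.first[of _ _ "place K r"], auto)
qed

lemma route_bottom_crosses:
  assumes i: "i \<in> {1..n}" "fate C i = Thru s" and c: "crosses H K (place H s) v r"
  shows "route upper lower 0 False (Lower i) (rev (w' s) @ v @ rev (w r)) True (Upper (place A r))"
proof -
  have k: "place H s \<in> {1..n}" using C.thru[OF i] H.place by auto
  have last: "route upper lower 0 True (Middle m) (rev (w r)) True (Upper (place A r))"
    if "m \<in> {1..n}" "fate K m = Thru r" for m
    using that by (intro route.last) (simp add: layer_upper_iff)
  have "route upper lower 0 True (Middle (place H s)) (v @ rev (w r)) True (Upper (place A r))"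
    using c[unfolded crosses_def]
  proof (elim disjE exE conjE)
    assume "fate K (place H s) = Thru r" "v = []"
    then show ?thesis using last k by simp
  next
    fix x m x' m'
    assume h: "fate K (place H s) = Arc x m" "fate H m = Arc x' m'" "fate K m' = Thru r" "v = x @ x'"
    have m: "m \<in> {1..n}" using K.arc[OF k h(1)] by simp
    then have m': "m' \<in> {1..n}" using H.arc[OF _ h(2)] by simp
    have "route upper lower 0 False (Middle m) (x' @ rev (w r)) True (Upper (place A r))"
      using m m' h last[OF m' h(3)] by - (rule route.first[of _ _ m'], auto simp: layer_lower_iff)
    then have "route upper lower 0 True (Middle (place H s)) (x @ x' @ rev (w r)) True (Upper (place A r))"
      using m k h by - (rule route.first[of _ _ m], auto simp: layer_upper_iff)
    then show ?thesis using h by simp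
  qed
  moreover have "(Lower i, rev (w' s), Middle (place H s)) \<in> layer upper lower False"
    using i by (simp add: layer_lower_iff)
  ultimately show ?thesis using k by - (rule route.first[of _ _ "place H s"], auto)
qed

text \<open>\<open>P\<close> and \<open>Q\<close> describe what the middle does to the propagating lines: arcs of \<open>P\<close> join two lines of the
upper layer, arcs of \<open>Q\<close> two lines of the lower layer, and line \<open>u\<close> of the product is composed of line
\<open>place P u\<close> above and line \<open>place Q u\<close> below.\<close>

lemma lines_stack:
  assumes up: "\<And>r. r \<in> {1..p} \<Longrightarrow> (case fate P r of
        Arc v r' \<Rightarrow> \<exists>x. turns K H (place K r) x r' \<and> v = w r @ x @ rev (w r')
      | Thru u \<Rightarrow> \<exists>x. crosses K H (place K r) x (place Q u) \<and> w'' u = w r @ x @ w' (place Q u))"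
    and down: "\<And>s. s \<in> {1..p'} \<Longrightarrow> (case fate Q s of
        Arc v s' \<Rightarrow> \<exists>x. turns H K (place H s) x s' \<and> v = rev (w' s) @ x @ w' s'
      | Thru u \<Rightarrow> \<exists>x. crosses H K (place H s) x (place P u) \<and> w'' u = w (place P u) @ rev x @ w' s)"
  shows "lines (stack upper lower) = joined n (refine A P) (refine C Q) w''"
  unfolding upper_def lower_def joined_def
proof (rule lines_stack_wires, fold joined_def, fold upper_def lower_def)
  fix x assume x: "x \<in> vertices n"
  let ?R = "\<lambda>x. \<exists>t. route upper lower 0 (is_top x) (outer_site x) (join_word (refine A P) (refine C Q) w'' x) t
     (outer_site (join_end (refine A P) (refine C Q) x))"
  show "?R x"
  proof (cases x)
    case [simp]: (Top i)
    from x have i: "i \<in> {1..n}" by simp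
    show ?thesis
    proof (cases "fate A i")
      case (Arc v j)
      then show ?thesis using route_top_arc[OF i Arc] by (auto simp: refine_def)
    next
      case (Thru r)
      have r: "r \<in> {1..p}" using A.thru[OF i Thru] by simp
      show ?thesis
      proof (cases "fate P r")
        case (Arc v r')
        with up[OF r] obtain x where x: "turns K H (place K r) x r'" "v = w r @ x @ rev (w r')" by auto
        show ?thesis using Thru Arc route_top_turns[OF i Thru x(1)] x(2) by (auto simp: refine_def)
      next
        case T: (Thru u)
        with up[OF r] obtain x where x: "crosses K H (place K r) x (place Q u)" "w'' u = w r @ x @ w' (place Q u)" by auto
        show ?thesis using Thru T route_top_crosses[OF i Thru x(1)] x(2) by (auto simp: refine_def)
      qed
    qed
  next
    case [simp]: (Bot i)
    from x have i: "i \<in> {1..n}" by simp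
    show ?thesis
    proof (cases "fate C i")
      case (Arc v j)
      then show ?thesis using route_bottom_arc[OF i Arc] by (auto simp: refine_def)
    next
      case (Thru r)
      have r: "r \<in> {1..p'}" using C.thru[OF i Thru] by simp
      show ?thesis
      proof (cases "fate Q r")
        case (Arc v r')
        with down[OF r] obtain x where x: "turns H K (place H r) x r'" "v = rev (w' r) @ x @ w' r'" by auto
        show ?thesis using Thru Arc route_bottom_turns[OF i Thru x(1)] x(2) by (auto simp: refine_def)
      next
        case T: (Thru u)
        with down[OF r] obtain x where x: "crosses H K (place H r) x (place P u)" "w'' u = w (place P u) @ rev x @ w' r" by auto
        show ?thesis using Thru T route_bottom_crosses[OF i Thru x(1)] x(2) by (auto simp: refine_def)
      qed
    qed
  qed
qed

lemma loops_stack: "loops (stack upper lower) =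
    image_mset snd (mset_set {(i, v). route upper lower i True (Middle i) v False (Middle i)})"
  by (simp add: stack_def upper_def lower_def trail_iff_route)

text \<open>A loop is read from its smallest middle site, leaving upwards along an arc of \<open>K\<close>. The hypothesis says
that the curve does not return there, but goes on to an outer edge or to a smaller site.\<close>

lemma no_loops:
  assumes "\<And>i v m v' m'. i \<in> {1..n} \<Longrightarrow> fate K i = Arc v m \<Longrightarrow> i < m \<Longrightarrow> fate H m = Arc v' m' \<Longrightarrow>
    m' \<noteq> i \<and> (i < m' \<longrightarrow> (\<exists>r. fate K m' = Thru r))"
  shows "loops (stack upper lower) = {#}"
proof -
  have stuck: "\<not> route upper lower k True (Middle i) v False (Middle j)" if "fate K i = Thru r" for i j k v r
  proof
    assume "route upper lower k True (Middle i) v False (Middle j)"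
    then show False by cases (use that in \<open>simp_all add: layer_upper_iff\<close>)
  qed
  have "\<not> route upper lower i True (Middle i) v False (Middle i)" for i v
  proof
    assume "route upper lower i True (Middle i) v False (Middle i)"
    then show False
    proof cases
      case last
      then show False by simp
    next
      case (first v1 m v2)
      then have m: "i \<in> {1..n}" "fate K i = Arc v1 m" by (auto simp: layer_upper_iff split: fate.splits)
      from first(4) show False
      proof cases
        case last
        then have "fate H m = Arc v2 i" by (auto simp: layer_lower_iff split: fate.splits)
        from assms[OF m first(3) this] show False by simp
      next
        case (first v3 m' v4)
        then have "fate H m = Arc v3 m'" by (auto simp: layer_lower_iff split: fate.splits)
        from assms[OF m \<open>i < m\<close> this] first(3) obtain r where "fate K m' = Thru r" by auto
        from stuck[OF this] first(4) show False by simp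
      qed
    qed
  qed
  then show ?thesis by (simp add: loops_stack)
qed

lemma one_loop:
  assumes K: "K = one_arc j b" and H: "H = one_arc j a" and j: "1 \<le> j" "j < n"
  shows "loops (stack upper lower) = {#b @ rev a#}"
proof -
  have fK: "fate K i = (if i = j then Arc b (j + 1) else if i = j + 1 then Arc (rev b) j
       else Thru (if i < j then i else i - 2))"
    and fH: "fate H i = (if i = j then Arc a (j + 1) else if i = j + 1 then Arc (rev a) j
       else Thru (if i < j then i else i - 2))" for i
    using K H by (simp_all add: fate_one_arc)
  have "route upper lower i True (Middle i) v False (Middle i) \<longleftrightarrow> (i, v) = (j, b @ rev a)" for i v
  proof
    assume "route upper lower i True (Middle i) v False (Middle i)"
    then show "(i, v) = (j, b @ rev a)"
    proof cases
      case last
      then show ?thesis by simp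
    next
      case (first v1 m v2)
      then have m: "i = j" "m = j + 1" "v1 = b"
        by (auto simp: layer_upper_iff fK split: fate.splits if_splits)
      from first(4) show ?thesis
      proof cases
        case last
        then show ?thesis using m first(1,2) by (auto simp: layer_lower_iff fH)
      next
        case (first v3 m' v4)
        then show ?thesis using m by (auto simp: layer_lower_iff fH)
      qed
    qed
  next
    assume "(i, v) = (j, b @ rev a)"
    then have i: "i = j" "v = b @ rev a" by auto
    have "route upper lower j False (Middle (j + 1)) (rev a) False (Middle j)"
      using j by (intro route.last) (simp add: layer_lower_iff fH)
    then have "route upper lower j True (Middle j) (b @ rev a) False (Middle j)"
      using j by - (rule route.first[of _ _ "j + 1"], auto simp: layer_upper_iff fK)
    then show "route upper lower i True (Middle i) v False (Middle i)" by (simp add: i)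
  qed
  then have "{(i, v). route upper lower i True (Middle i) v False (Middle i)} = {(j, b @ rev a)}" by auto
  then show ?thesis by (simp add: loops_stack)
qed

end

section \<open>Products of diagrams with one arc\<close>

lemma refine_no_arc [simp]: "refine A no_arc = A" "refine no_arc A = A"
  unfolding refine_def
  by (cases A, auto split: fate.splits intro!: ext)+

text \<open>Numbers beyond an arc are written with an explicit offset, which lets the shift by two vertices in
\<open>one_arc\<close> simplify.\<close>

lemma beside_arc_cases:
  fixes r j :: nat
  obtains "r < j" | "r = j" | "r = j + 1" | d where "r = j + 2 + d"
proof -
  have "r < j \<or> r = j \<or> r = j + 1 \<or> r = j + 2 + (r - j - 2)" by arith
  then show thesis using that by blast
qed

lemma diagram_eqI: "lines D = S \<Longrightarrow> loops D = M \<Longrightarrow> D = Diagram S M"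
  by (cases D) auto

text \<open>Multiplication by \<open>e\<close> or \<open>f\<close> from the left is of this kind.\<close>

lemma stack_no_arc_one_arc:
  assumes A: "half_diagram n n A" and C: "half_diagram n (n - 2) C" and j: "1 \<le> j" "j < n"
  shows "stack (Diagram (joined n A no_arc w) {#}) (Diagram (joined n (one_arc j a) C w') {#}) =
    Diagram (joined n (refine A (one_arc j (w j @ a @ rev (w (j + 1))))) C (\<lambda>u. w (place (one_arc j a) u) @ w' u)) {#}"
proof -
  interpret stacking n n "n - 2" A no_arc "one_arc j a" C w w'
    by (intro stacking.intro half_no_arc half_one_arc A C j)
  have "lines (stack upper lower) = joined n (refine A (one_arc j (w j @ a @ rev (w (j + 1))))) (refine C no_arc)
      (\<lambda>u. w (place (one_arc j a) u) @ w' u)"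
    apply (rule lines_stack)
    subgoal for r by (rule beside_arc_cases[of r "j"]) (simp_all add: turns_def crosses_def fate_one_arc place_one_arc)
    subgoal for s by (rule beside_arc_cases[of s "j"]) (simp_all add: turns_def crosses_def fate_one_arc place_one_arc)
    done
  moreover have "loops (stack upper lower) = {#}" by (rule no_loops) auto
  ultimately show ?thesis unfolding upper_def lower_def by (auto intro!: diagram_eqI)
qed

lemma stack_one_arc_no_arc:
  assumes A: "half_diagram n (n - 2) A" and C: "half_diagram n n C" and j: "1 \<le> j" "j < n"
  shows "stack (Diagram (joined n A (one_arc j b) w) {#}) (Diagram (joined n no_arc C w') {#}) =
    Diagram (joined n A (refine C (one_arc j (rev (w' j) @ b @ w' (j + 1)))) (\<lambda>u. w u @ w' (place (one_arc j b) u))) {#}"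
proof -
  interpret stacking n "n - 2" n A "one_arc j b" no_arc C w w'
    by (intro stacking.intro half_no_arc half_one_arc A C j)
  have "lines (stack upper lower) = joined n (refine A no_arc) (refine C (one_arc j (rev (w' j) @ b @ w' (j + 1))))
      (\<lambda>u. w u @ w' (place (one_arc j b) u))"
    apply (rule lines_stack)
    subgoal for r by (rule beside_arc_cases[of r "j"]) (simp_all add: turns_def crosses_def fate_one_arc place_one_arc)
    subgoal for s by (rule beside_arc_cases[of s "j"]) (simp_all add: turns_def crosses_def fate_one_arc place_one_arc)
    done
  moreover have "loops (stack upper lower) = {#}" by (rule no_loops) auto
  ultimately show ?thesis unfolding upper_def lower_def by (auto intro!: diagram_eqI)
qed

context
  fixes n :: nat and A C :: half and w w' :: "nat \<Rightarrow> blob list"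
  assumes A: "half_diagram n (n - 2) A" and C: "half_diagram n (n - 2) C"
begin

lemma stacking_one_arcs: "1 \<le> j \<Longrightarrow> j < n \<Longrightarrow> 1 \<le> j' \<Longrightarrow> j' < n \<Longrightarrow>
  stacking n (n - 2) (n - 2) A (one_arc j b) (one_arc j' a) C"
  by (intro stacking.intro half_one_arc A C)

lemma stack_same_arc:
  assumes j: "1 \<le> j" "j < n"
  shows "stack (Diagram (joined n A (one_arc j b) w) {#}) (Diagram (joined n (one_arc j a) C w') {#}) =
    Diagram (joined n A C (\<lambda>u. w u @ w' u)) {#b @ rev a#}"
proof -
  interpret stacking n "n - 2" "n - 2" A "one_arc j b" "one_arc j a" C w w'
    using j by (intro stacking_one_arcs)
  have "lines (stack upper lower) = joined n (refine A no_arc) (refine C no_arc) (\<lambda>u. w u @ w' u)"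
    apply (rule lines_stack)
    subgoal for r by (rule beside_arc_cases[of r "j"]) (simp_all add: turns_def crosses_def fate_one_arc place_one_arc)
    subgoal for s by (rule beside_arc_cases[of s "j"]) (simp_all add: turns_def crosses_def fate_one_arc place_one_arc)
    done
  moreover have "loops (stack upper lower) = {#b @ rev a#}" by (rule one_loop) (use j in auto)
  ultimately show ?thesis unfolding upper_def lower_def by (auto intro!: diagram_eqI)
qed

text \<open>Following line \<open>j\<close> downwards, one passes the lower arc and then the upper arc, both from right to left.\<close>

lemma stack_next_arc:
  assumes j: "1 \<le> j" "j + 1 < n"
  shows "stack (Diagram (joined n A (one_arc j b) w) {#}) (Diagram (joined n (one_arc (j + 1) a) C w') {#}) =
    Diagram (joined n A C (\<lambda>u. w u @ (if u = j then rev a @ rev b else []) @ w' u)) {#}"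
proof -
  interpret stacking n "n - 2" "n - 2" A "one_arc j b" "one_arc (j + 1) a" C w w'
    using j by (intro stacking_one_arcs) auto
  have "lines (stack upper lower) = joined n (refine A no_arc) (refine C no_arc)
     (\<lambda>u. w u @ (if u = j then rev a @ rev b else []) @ w' u)"
    apply (rule lines_stack)
    subgoal for r by (rule beside_arc_cases[of r "j"]) (simp_all add: turns_def crosses_def fate_one_arc place_one_arc)
    subgoal for s by (rule beside_arc_cases[of s "j"]) (simp_all add: turns_def crosses_def fate_one_arc place_one_arc)
    done
  moreover have "loops (stack upper lower) = {#}" by (rule no_loops) (auto simp: fate_one_arc split: if_splits)
  ultimately show ?thesis unfolding upper_def lower_def by (auto intro!: diagram_eqI)
qed

lemma stack_previous_arc:
  assumes j: "1 \<le> j" "j + 1 < n"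
  shows "stack (Diagram (joined n A (one_arc (j + 1) b) w) {#}) (Diagram (joined n (one_arc j a) C w') {#}) =
    Diagram (joined n A C (\<lambda>u. w u @ (if u = j then a @ b else []) @ w' u)) {#}"
proof -
  interpret stacking n "n - 2" "n - 2" A "one_arc (j + 1) b" "one_arc j a" C w w'
    using j by (intro stacking_one_arcs) auto
  have "lines (stack upper lower) = joined n (refine A no_arc) (refine C no_arc)
     (\<lambda>u. w u @ (if u = j then a @ b else []) @ w' u)"
    apply (rule lines_stack)
    subgoal for r by (rule beside_arc_cases[of r "j"]) (simp_all add: turns_def crosses_def fate_one_arc place_one_arc)
    subgoal for s by (rule beside_arc_cases[of s "j"]) (simp_all add: turns_def crosses_def fate_one_arc place_one_arc)
    done
  moreover have "loops (stack upper lower) = {#}" by (rule no_loops) (auto simp: fate_one_arc split: if_splits)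
  ultimately show ?thesis unfolding upper_def lower_def by (auto intro!: diagram_eqI)
qed

text \<open>Each of the two arcs joins two propagating lines of the other diagram.\<close>

lemma stack_arc_far_right:
  assumes j: "1 \<le> j" "j + 2 + d < n"
  shows "stack (Diagram (joined n A (one_arc j b) w) {#}) (Diagram (joined n (one_arc (j + 2 + d) a) C w') {#}) =
    Diagram (joined n (refine A (one_arc (j + d) (w (j + d) @ a @ rev (w ((j + d) + 1)))))
       (refine C (one_arc j (rev (w' j) @ b @ w' (j + 1))))
       (\<lambda>u. w (place (one_arc (j + d) []) u) @ w' (place (one_arc j []) u))) {#}"
proof -
  interpret stacking n "n - 2" "n - 2" A "one_arc j b" "one_arc (j + 2 + d) a" C w w'
    using j by (intro stacking_one_arcs) auto
  have "lines (stack upper lower) = joined n (refine A (one_arc (j + d) (w (j + d) @ a @ rev (w ((j + d) + 1)))))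
       (refine C (one_arc j (rev (w' j) @ b @ w' (j + 1))))
       (\<lambda>u. w (place (one_arc (j + d) []) u) @ w' (place (one_arc j []) u))"
    apply (rule lines_stack)
    subgoal for r by (rule beside_arc_cases[of r "(j + d)"]) (simp_all add: turns_def crosses_def fate_one_arc place_one_arc)
    subgoal for s by (rule beside_arc_cases[of s "j"]) (simp_all add: turns_def crosses_def fate_one_arc place_one_arc)
    done
  moreover have "loops (stack upper lower) = {#}" by (rule no_loops) (auto simp: fate_one_arc split: if_splits)
  ultimately show ?thesis unfolding upper_def lower_def by (auto intro!: diagram_eqI)
qed

lemma stack_arc_far_left:
  assumes j: "1 \<le> j" "j + 2 + d < n"
  shows "stack (Diagram (joined n A (one_arc (j + 2 + d) b) w) {#}) (Diagram (joined n (one_arc j a) C w') {#}) =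
    Diagram (joined n (refine A (one_arc j (w j @ a @ rev (w (j + 1)))))
       (refine C (one_arc (j + d) (rev (w' (j + d)) @ b @ w' ((j + d) + 1))))
       (\<lambda>u. w (place (one_arc j []) u) @ w' (place (one_arc (j + d) []) u))) {#}"
proof -
  interpret stacking n "n - 2" "n - 2" A "one_arc (j + 2 + d) b" "one_arc j a" C w w'
    using j by (intro stacking_one_arcs) auto
  have "lines (stack upper lower) = joined n (refine A (one_arc j (w j @ a @ rev (w (j + 1)))))
       (refine C (one_arc (j + d) (rev (w' (j + d)) @ b @ w' ((j + d) + 1))))
       (\<lambda>u. w (place (one_arc j []) u) @ w' (place (one_arc (j + d) []) u))"
    apply (rule lines_stack)
    subgoal for r by (rule beside_arc_cases[of r "j"]) (simp_all add: turns_def crosses_def fate_one_arc place_one_arc)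
    subgoal for s by (rule beside_arc_cases[of s "(j + d)"]) (simp_all add: turns_def crosses_def fate_one_arc place_one_arc)
    done
  moreover have "loops (stack upper lower) = {#}" by (rule no_loops) (auto simp: fate_one_arc split: if_splits)
  ultimately show ?thesis unfolding upper_def lower_def by (auto intro!: diagram_eqI)
qed

end

section \<open>Reduction to the basis\<close>

lemma left_right_diagram_wires:
  assumes "left_right_diagram n D"
  obtains \<sigma> \<omega> where "wiring n \<sigma> \<omega>" "lines D = wires n \<sigma> \<omega>"
proof -
  interpret left_right_diagram n D by fact
  define \<omega> where "\<omega> x = fst (THE p. (x, p) \<in> lines D)" for x
  define \<sigma> where "\<sigma> x = snd (THE p. (x, p) \<in> lines D)" for x
  have uniq: "\<exists>!p. (x, p) \<in> lines D" if "x \<in> vertices n" for x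
    using matching[OF that] unfolding case_prod_unfold by simp
  have mem: "(x, w, y) \<in> lines D \<longleftrightarrow> x \<in> vertices n \<and> w = \<omega> x \<and> y = \<sigma> x" for x w y
  proof
    assume l: "(x, w, y) \<in> lines D"
    then have x: "x \<in> vertices n" using ends by blast
    have "(THE p. (x, p) \<in> lines D) = (w, y)" by (rule the1_equality[OF uniq[OF x] l])
    then show "x \<in> vertices n \<and> w = \<omega> x \<and> y = \<sigma> x" using x by (simp add: \<omega>_def \<sigma>_def)
  next
    assume h: "x \<in> vertices n \<and> w = \<omega> x \<and> y = \<sigma> x"
    have "(x, THE p. (x, p) \<in> lines D) \<in> lines D" by (rule theI'[OF uniq]) (use h in simp)
    moreover have "(w, y) = (THE p. (x, p) \<in> lines D)" using h unfolding \<omega>_def \<sigma>_def by simp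
    ultimately show "(x, w, y) \<in> lines D" by simp
  qed
  have "wiring n \<sigma> \<omega>"
  proof
    fix x assume x: "x \<in> vertices n"
    then have l: "(x, \<omega> x, \<sigma> x) \<in> lines D" by (simp add: mem)
    from ends[OF l] show "\<sigma> x \<in> vertices n" "\<sigma> x \<noteq> x" by auto
    from reverse[OF l] show "\<sigma> (\<sigma> x) = x" "\<omega> (\<sigma> x) = rev (\<omega> x)" unfolding mem by simp_all
  qed
  moreover have "lines D = wires n \<sigma> \<omega>"
  proof (rule Set.set_eqI)
    fix l show "l \<in> lines D \<longleftrightarrow> l \<in> wires n \<sigma> \<omega>" by (cases l) (simp only: mem mem_wires)
  qed
  ultimately show thesis by (rule that)
qed

lemma finite_vertices [simp]: "finite (vertices n)"
  by (simp add: vertices_def)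

lemma subseq_LR_iff: "subseq [LB, RB] w \<longleftrightarrow> (\<exists>u v u'. w = u @ LB # v @ RB # u')"
proof
  assume "subseq [LB, RB] w"
  then obtain u s where u: "w = u @ LB # s" "subseq [RB] s" by (auto dest: list_emb_ConsD)
  from u(2) obtain v u' where "s = v @ RB # u'" by (auto dest: list_emb_ConsD)
  with u show "\<exists>u v u'. w = u @ LB # v @ RB # u'" by blast
next
  assume "\<exists>u v u'. w = u @ LB # v @ RB # u'"
  then obtain u v u' where w: "w = u @ LB # v @ RB # u'" by blast
  have "subseq ([] @ [LB] @ [] @ [RB] @ []) (u @ [LB] @ v @ [RB] @ u')"
    by (intro list_emb_append_mono) auto
  then show "subseq [LB, RB] w" by (simp add: w)
qed

lemma subseq_set_subset: "subseq xs ys \<Longrightarrow> set xs \<subseteq> set ys"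
  by (auto elim: list_emb_set)

lemma subseq_rev: "subseq xs ys \<Longrightarrow> subseq (rev xs) (rev ys)"
proof (induction rule: list_emb.induct)
  case (list_emb_Cons xs ys y)
  then show ?case by (simp add: subseq_rev_drop_many)
next
  case (list_emb_Cons2 x y xs ys)
  then show ?case by (auto intro!: list_emb_append_mono)
qed simp

lemma mset_rotate [simp]: "mset (rotate k w) = mset w"
  by (metis append_take_drop_id mset_append rotate_drop_take union_commute)

lemma sides_mono: "set w \<subseteq> set w' \<Longrightarrow> sides n w \<subseteq> sides n w'"
  by (auto simp: sides_def)

text \<open>Taking blobs away shrinks the blocks, so nothing can begin to cross. The order condition concerns L
followed by R as a subsequence of a word, and subsequences of a smaller word are subsequences of the
larger one.\<close>

lemma left_right_diagram_thin:
  assumes D: "left_right_diagram n (Diagram (wires n \<sigma> \<omega>) M)" and W: "wiring n \<sigma> \<omega>'"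
    and sub: "\<And>x. x \<in> vertices n \<Longrightarrow> subseq (\<omega>' x) (\<omega> x)"
    and loops: "\<And>w. w \<in># M' \<Longrightarrow> \<exists>w0 \<in># M. set w \<subseteq> set w0"
    and loop_words: "\<And>w. w \<in># M' \<Longrightarrow> \<exists>k a b. rotate k w = replicate a LB @ replicate b RB"
  shows "left_right_diagram n (Diagram (wires n \<sigma> \<omega>') M')"
proof -
  interpret left_right_diagram n "Diagram (wires n \<sigma> \<omega>) M" by fact
  interpret W: wiring n \<sigma> \<omega>' by fact
  have block: "block n (x, \<omega>' x, y) \<subseteq> block n (x, \<omega> x, y)" if "x \<in> vertices n" for x y
    using sides_mono[of "\<omega>' x" "\<omega> x" n] subseq_set_subset[OF sub[OF that]] by (auto simp: block_def)
  show ?thesis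
  proof (unfold_locales, unfold diagram.sel)
    fix x w y assume "(x, w, y) \<in> wires n \<sigma> \<omega>'"
    then show "x \<in> vertices n \<and> y \<in> vertices n \<and> x \<noteq> y"
      using W.other_end W.no_fixpoint by (auto dest: sym)
  next
    fix x w y assume "(x, w, y) \<in> wires n \<sigma> \<omega>'"
    then show "(y, rev w, x) \<in> wires n \<sigma> \<omega>'" by (rule W.wires_reverse)
  next
    fix x assume "x \<in> vertices n"
    then show "\<exists>!(w, y). (x, w, y) \<in> wires n \<sigma> \<omega>'" by auto
  next
    fix x w y x' w' y' assume l: "(x, w, y) \<in> wires n \<sigma> \<omega>'" "(x', w', y') \<in> wires n \<sigma> \<omega>'"
      and ne: "{x, y} \<noteq> {x', y'}"
    from l have "noncrossing (block n (x, \<omega> x, y)) (block n (x', \<omega> x', y'))"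
      using ne by (intro lines_cross) auto
    then show "noncrossing (block n (x, w, y)) (block n (x', w', y'))"
      by (rule noncrossing_mono) (use block l in auto)
  next
    fix x u v u' y assume l: "(x, u @ LB # v @ RB # u', y) \<in> wires n \<sigma> \<omega>'"
    then have "subseq [LB, RB] (\<omega>' x)" by (auto simp: subseq_LR_iff intro: sym)
    then have "subseq [LB, RB] (\<omega> x)" using sub[of x] l by (auto intro: subseq_order.order_trans)
    then obtain u v u' where "\<omega> x = u @ LB # v @ RB # u'" by (auto simp: subseq_LR_iff)
    with l show "noncrossing {pos n x, left_pos} {pos n y, right_pos n}"
      by (intro left_right_diagram.order[OF D, of x u v u' y]) auto
  next
    fix w l assume w: "w \<in># M'" and l: "l \<in> wires n \<sigma> \<omega>'"
    from loops[OF w] obtain w0 where w0: "w0 \<in># M" "set w \<subseteq> set w0" by blast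
    from l obtain x where x: "l = (x, \<omega>' x, \<sigma> x)" "x \<in> vertices n" by (auto simp: wires_def)
    have "noncrossing (sides n w0) (block n (x, \<omega> x, \<sigma> x))" using w0 x by (intro loops_cross) auto
    then show "noncrossing (sides n w) (block n l)"
      by (rule noncrossing_mono) (use sides_mono w0 block x in auto)
  next
    fix w assume "w \<in># M'"
    then show "\<exists>k a b. rotate k w = replicate a LB @ replicate b RB" by (rule loop_words)
  qed
qed

lemma both_ways_single: "both_ways {(x, w, y)} = {(x, w, y), (y, rev w, x)}"
  by (auto simp: both_ways_def)

context wiring
begin

definition rewrite :: "vertex \<Rightarrow> blob list \<Rightarrow> vertex \<Rightarrow> blob list" where
  "rewrite x w = \<omega>(x := w, \<sigma> x := rev w)"

lemma rewrite_apply: "x \<in> vertices n \<Longrightarrow>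
   rewrite x w y = (if y = x then w else if y = \<sigma> x then rev w else \<omega> y)"
  using no_fixpoint[of x] by (auto simp: rewrite_def)

lemma wiring_rewrite:
  assumes x: "x \<in> vertices n"
  shows "wiring n \<sigma> (rewrite x w)"
proof
  fix y assume y: "y \<in> vertices n"
  show "\<sigma> y \<in> vertices n" "\<sigma> y \<noteq> y" "\<sigma> (\<sigma> y) = y" using y other_end no_fixpoint involution by auto
  have "\<sigma> y = x \<longleftrightarrow> y = \<sigma> x" "\<sigma> y = \<sigma> x \<longleftrightarrow> y = x" using x y involution by metis+
  then show "rewrite x w (\<sigma> y) = rev (rewrite x w y)"
    using x y no_fixpoint[OF x] by (auto simp: rewrite_apply word_reverse)
qed

lemma wires_rewrite:
  assumes x: "x \<in> vertices n"
  shows "wires n \<sigma> \<omega> - both_ways {(x, \<omega> x, \<sigma> x)} \<union> both_ways {(x, w, \<sigma> x)} = wires n \<sigma> (rewrite x w)"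
proof -
  have "(y, v, z) \<in> wires n \<sigma> \<omega> - both_ways {(x, \<omega> x, \<sigma> x)} \<union> both_ways {(x, w, \<sigma> x)} \<longleftrightarrow>
     (y, v, z) \<in> wires n \<sigma> (rewrite x w)" for y v z
    using x other_end[OF x] no_fixpoint[OF x] involution[OF x] word_reverse[OF x]
    by (auto simp: both_ways_single rewrite_apply)
  then show ?thesis by (simp only: set_eq_iff split_paired_All) blast
qed

lemma subseq_rewrite:
  assumes x: "x \<in> vertices n" and w: "subseq w (\<omega> x)"
  shows "subseq (rewrite x w y) (\<omega> y)"
proof -
  have "subseq (rev w) (\<omega> (\<sigma> x))" using w by (simp add: word_reverse[OF x] subseq_rev)
  then show ?thesis using w x by (simp add: rewrite_apply)
qed

end

text \<open>A diagram as an element of the space of linear combinations.\<close>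

abbreviation point :: "diagram \<Rightarrow> (diagram \<Rightarrow>\<^sub>0 'k::field)" where
  "point D \<equiv> Poly_Mapping.single D 1"

lemma line_rules_subseq: "(z, c, z') \<in> line_rules p \<Longrightarrow> subseq z' z \<and> length z' < length z \<and> z \<noteq> [] \<and> z' \<noteq> []"
  by (auto simp: line_rules_def)

lemma relation_combination:
  assumes "relation p n D c D1" and "point D1 - scale c' (point D2) \<in> combinations.span (relators p n)"
  shows "point D - scale (c * c') (point D2) \<in> combinations.span (relators p n)"
proof -
  have "point D - scale c (point D1) \<in> relators p n"
    using assms(1) by (auto simp: relators_def)
  then have "point D - scale c (point D1) +
      scale c (point D1 - scale c' (point D2)) \<in> combinations.span (relators p n)"
    by (intro combinations.span_add combinations.span_base combinations.span_scale assms(2))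
  then show ?thesis by (simp add: combinations.scale_right_diff_distrib)
qed

text \<open>The situation of the relation \<open>top_bottom\<close>, the only relation that changes connections.\<close>

definition both_arcs :: "diagram \<Rightarrow> bool" where
  "both_arcs D \<longleftrightarrow> (\<exists>i w j. (Top i, w, Top j) \<in> lines D \<and> {LB, RB} \<subseteq> set w) \<and>
     (\<exists>i w j. (Bot i, w, Bot j) \<in> lines D \<and> {LB, RB} \<subseteq> set w)"

lemma both_arcs_thin:
  assumes "\<And>x. x \<in> vertices n \<Longrightarrow> subseq (\<omega>' x) (\<omega> x)" and "\<not> both_arcs (Diagram (wires n \<sigma> \<omega>) M)"
  shows "\<not> both_arcs (Diagram (wires n \<sigma> \<omega>') M')"
  using assms(2) subseq_set_subset[OF assms(1)] unfolding both_arcs_def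
  by (simp del: vertices_simps) blast

lemma short_loop:
  assumes "rotate k w = replicate a LB @ replicate b RB" and "a \<le> 1" "b \<le> 1"
  shows "w \<in> {[], [LB], [RB], [LB, RB], [RB, LB]}"
proof -
  have m: "mset w = mset (replicate a LB @ replicate b RB)"
    using assms(1) by (metis mset_rotate)
  have count: "count (mset w) LB = a" "count (mset w) RB = b" by (simp_all only: m) simp_all
  have "length w = a + b" using arg_cong[OF assms(1), of length] by simp
  then have "length w = 0 \<or> length w = Suc 0 \<or> length w = Suc (Suc 0)" using assms(2,3) by linarith
  then consider "w = []" | x where "w = [x]" | x y where "w = [x, y]"
    unfolding length_Suc_conv by blast
  then show ?thesis
  proof cases
    case 2
    then show ?thesis by (cases x) auto
  next
    case 3
    then show ?thesis using count assms(2,3) by (cases x; cases y) auto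
  qed simp
qed

text \<open>Each rule for lines and loops makes words shorter or removes a loop, and when none applies any more, the
diagram is in the basis. A rule for lines leaves at least one blob where it applies, so the undecorated
lines stay the same.\<close>

lemma reduce_to_basis:
  assumes "left_right_diagram n (Diagram (wires n \<sigma> \<omega>) M)" and "wiring n \<sigma> \<omega>"
    and "\<not> both_arcs (Diagram (wires n \<sigma> \<omega>) M)"
  shows "\<exists>c \<omega>'. wiring n \<sigma> \<omega>' \<and> Diagram (wires n \<sigma> \<omega>') {#} \<in> basis_diagrams n \<and>
     (\<forall>x\<in>vertices n. subseq (\<omega>' x) (\<omega> x) \<and> (\<omega>' x = [] \<longleftrightarrow> \<omega> x = [])) \<and>
     point (Diagram (wires n \<sigma> \<omega>) M) -
       scale c (point (Diagram (wires n \<sigma> \<omega>') {#})) \<in> combinations.span (relators p n)"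
  (is "\<exists>c \<omega>'. ?P \<omega> M c \<omega>'")
  using assms
\<comment> \<open>Every loop counts once more than its length, so that removing a loop without blobs makes progress.\<close>
proof (induction "(\<Sum>x\<in>vertices n. length (\<omega> x)) + (\<Sum>w\<in>#M. length w + 1)" arbitrary: \<omega> M rule: less_induct)
  case less
  interpret left_right_diagram n "Diagram (wires n \<sigma> \<omega>) M" by fact
  interpret wiring n \<sigma> \<omega> by fact
  show ?case
  proof (cases "M = {#}")
    case False
    then obtain w N where M: "M = add_mset w N" by (metis multiset_nonemptyE mset_add)
    have loop_step: ?thesis if rel: "relation p n (Diagram (wires n \<sigma> \<omega>) M) c (Diagram (wires n \<sigma> \<omega>) M1)"
      and sub: "\<And>v. v \<in># M1 \<Longrightarrow> \<exists>v0 \<in># M. set v \<subseteq> set v0"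
      and ord: "\<And>v. v \<in># M1 \<Longrightarrow> \<exists>k a b. rotate k v = replicate a LB @ replicate b RB"
      and size: "(\<Sum>v\<in>#M1. length v + 1) < (\<Sum>v\<in>#M. length v + 1)" for c M1
    proof -
      have LR: "left_right_diagram n (Diagram (wires n \<sigma> \<omega>) M1)"
        by (rule left_right_diagram_thin[OF less.prems(1,2)]) (use sub ord in auto)
      have "\<not> both_arcs (Diagram (wires n \<sigma> \<omega>) M1)"
        by (rule both_arcs_thin[OF _ less.prems(3)]) simp
      with less.hyps[OF _ LR less.prems(2)] size obtain c' \<omega>' where "?P \<omega> M1 c' \<omega>'" by auto
      then have "?P \<omega> M (c * c') \<omega>'" using relation_combination[OF rel] by blast
      then show ?thesis by blast
    qed
    have wM: "w \<in># loops (Diagram (wires n \<sigma> \<omega>) M)" by (simp add: M)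
    from loop_order[OF wM] obtain k a b where k: "rotate k w = replicate a LB @ replicate b RB" by blast
    have ordN: "\<exists>k a b. rotate k v = replicate a LB @ replicate b RB" if "v \<in># N" for v
      using loop_order[of v] that by (simp add: M)
    have setw: "set w = set (replicate a LB @ replicate b RB)" and lenw: "length w = a + b"
      using arg_cong[OF k, of set] arg_cong[OF k, of length] by simp_all
    consider "2 \<le> a" | "a \<le> 1" "2 \<le> b" | "a \<le> 1" "b \<le> 1" by linarith
    then show ?thesis
    proof cases
      case 1
      then obtain a' where a: "a = Suc (Suc a')" using le_Suc_ex[of 2 a] by auto
      let ?v = "replicate a' LB @ replicate b RB"
      show ?thesis
      proof (rule loop_step)
        show "relation p n (Diagram (wires n \<sigma> \<omega>) M) (delta_L p) (Diagram (wires n \<sigma> \<omega>) (add_mset (LB # ?v) N))"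
          using less.prems(1) k unfolding M a by (intro relation.loop_LL[of n _ w N k]) auto
        show "\<exists>v0 \<in># M. set v \<subseteq> set v0" if "v \<in># add_mset (LB # ?v) N" for v
          using that by (auto simp: M setw a)
        show "\<exists>k a b. rotate k v = replicate a LB @ replicate b RB" if "v \<in># add_mset (LB # ?v) N" for v
        proof (cases "v \<in># N")
          case False
          with that have "rotate 0 v = replicate (Suc a') LB @ replicate b RB" by simp
          then show ?thesis by blast
        qed (rule ordN)
      qed (simp add: M lenw a)
    next
      case 2
      then obtain b' where b: "b = Suc (Suc b')" using le_Suc_ex[of 2 b] by auto
      let ?v = "replicate b' RB @ replicate a LB"
      \<comment> \<open>Read from its R-blobs on, the loop starts with RR.\<close>
      have "rotate (a + k) w = rotate a (replicate a LB @ replicate b RB)" by (simp add: k flip: rotate_rotate)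
      also have "\<dots> = replicate b RB @ replicate a LB"
        using rotate_append[of "replicate a LB" "replicate b RB"] by simp
      finally have k': "rotate (a + k) w = RB # RB # ?v" by (simp add: b)
      show ?thesis
      proof (rule loop_step)
        show "relation p n (Diagram (wires n \<sigma> \<omega>) M) (delta_R p) (Diagram (wires n \<sigma> \<omega>) (add_mset (RB # ?v) N))"
          using less.prems(1) k' unfolding M by (intro relation.loop_RR[of n _ w N "a + k"]) auto
        show "\<exists>v0 \<in># M. set v \<subseteq> set v0" if "v \<in># add_mset (RB # ?v) N" for v
          using that by (auto simp: M setw b)
        show "\<exists>k a b. rotate k v = replicate a LB @ replicate b RB" if "v \<in># add_mset (RB # ?v) N" for v
        proof (cases "v \<in># N")
          case False
          with that have "v = replicate (Suc b') RB @ replicate a LB" by simp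
          then have "rotate (Suc b') v = replicate a LB @ replicate (Suc b') RB"
            using rotate_append[of "replicate (Suc b') RB" "replicate a LB"] by simp
          then show ?thesis by blast
        qed (rule ordN)
      qed (simp add: M lenw b)
    next
      case 3
      from short_loop[OF k this] obtain c where c: "(w, c) \<in> loop_rules p" by (auto simp: loop_rules_def)
      show ?thesis
      proof (rule loop_step)
        show "relation p n (Diagram (wires n \<sigma> \<omega>) M) c (Diagram (wires n \<sigma> \<omega>) N)"
          using less.prems(1) c unfolding M by (rule relation.loop_removal)
      qed (use ordN in \<open>auto simp: M\<close>)
    qed
  next
    case M [simp]: True
    show ?thesis
    proof (cases "\<exists>x\<in>vertices n. \<exists>z c z'. (z, c, z') \<in> line_rules p \<and> sublist z (\<omega> x)")
      case True
      then obtain x z c z' u v where x: "x \<in> vertices n" and r: "(z, c, z') \<in> line_rules p"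
        and w: "\<omega> x = u @ z @ v" by (auto simp: sublist_def)
      let ?\<omega> = "rewrite x (u @ z' @ v)"
      note z = line_rules_subseq[OF r]
      have "subseq (u @ z' @ v) (\<omega> x)" using z unfolding w by (intro list_emb_append_mono) auto
      note sub = subseq_rewrite[OF x this]
      note W = wiring_rewrite[OF x, of "u @ z' @ v"]
      have LR: "left_right_diagram n (Diagram (wires n \<sigma> ?\<omega>) {#})"
        by (rule left_right_diagram_thin[OF less.prems(1) W sub]) auto
      have rel: "relation p n (Diagram (wires n \<sigma> \<omega>) M) c (Diagram (wires n \<sigma> ?\<omega>) {#})"
        using relation.on_line[OF less.prems(1) r, of x u v "\<sigma> x"] x w wires_rewrite[OF x, of "u @ z' @ v"] by simp
      have "(\<Sum>y\<in>vertices n. length (?\<omega> y)) < (\<Sum>y\<in>vertices n. length (\<omega> y))"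
      proof (rule sum_strict_mono_ex1)
        show "\<forall>y\<in>vertices n. length (?\<omega> y) \<le> length (\<omega> y)" using sub list_emb_length by blast
        show "\<exists>y\<in>vertices n. length (?\<omega> y) < length (\<omega> y)"
          using x w z by (intro bexI[of _ x]) (auto simp: rewrite_apply)
      qed simp
      moreover have "\<not> both_arcs (Diagram (wires n \<sigma> ?\<omega>) {#})"
        by (rule both_arcs_thin[OF sub less.prems(3)])
      ultimately obtain c' \<omega>' where *: "?P ?\<omega> {#} c' \<omega>'" using less.hyps[OF _ LR W] by auto
      have empty: "?\<omega> y = [] \<longleftrightarrow> \<omega> y = []" if "y \<in> vertices n" for y
        using z w word_reverse[OF x] x by (auto simp: rewrite_apply)
      have "?P \<omega> M (c * c') \<omega>'"
        using * relation_combination[OF rel] empty sub by (auto intro: subseq_order.order_trans)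
      then show ?thesis by blast
    next
      case False
      have irreducible: "\<not> sublist z (\<omega> x)"
        if "x \<in> vertices n" "z \<in> {[LB, LB], [RB, RB], [LB, RB, LB], [RB, LB, RB]}" for x z
      proof -
        from that(2) have "\<exists>c z'. (z, c, z') \<in> line_rules p" by (auto simp: line_rules_def)
        with False that(1) show ?thesis by blast
      qed
      have "Diagram (wires n \<sigma> \<omega>) {#} \<in> basis_diagrams n"
        unfolding basis_diagrams_def mem_Collect_eq both_arcs_def[symmetric]
      proof (intro conjI)
        show "\<forall>(x, w, y)\<in>lines (Diagram (wires n \<sigma> \<omega>) {#}).
            \<forall>z\<in>{[LB, LB], [RB, RB], [LB, RB, LB], [RB, LB, RB]}. \<not> sublist z w"
          using irreducible unfolding wires_def diagram.sel by blast
      qed (use less.prems(1,3) in simp_all)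
      then have "?P \<omega> M 1 \<omega>" using less.prems(2) by (simp add: combinations.span_zero)
      then show ?thesis by blast
    qed
  qed
qed

section \<open>The coefficient of the generating diagram\<close>

definition extend :: "(diagram \<Rightarrow> 'k::field) \<Rightarrow> (diagram \<Rightarrow>\<^sub>0 'k) \<Rightarrow> 'k" where
  "extend f v = (\<Sum>D\<in>Poly_Mapping.keys v. Poly_Mapping.lookup v D * f D)"

lemma extend_superset:
  "finite S \<Longrightarrow> Poly_Mapping.keys v \<subseteq> S \<Longrightarrow> extend f v = (\<Sum>D\<in>S. Poly_Mapping.lookup v D * f D)"
  unfolding extend_def by (intro sum.mono_neutral_left) (auto simp: in_keys_iff)

lemma extend_add: "extend f (u + v) = extend f u + extend f v"
proof -
  let ?S = "Poly_Mapping.keys u \<union> Poly_Mapping.keys v"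
  have "Poly_Mapping.keys (u + v) \<subseteq> ?S" by (rule Poly_Mapping.keys_add)
  then show ?thesis
    using extend_superset[of ?S "u + v" f] extend_superset[of ?S u f] extend_superset[of ?S v f]
    by (simp add: lookup_add algebra_simps sum.distrib)
qed

lemma extend_scale: "extend f (scale c v) = c * extend f v"
proof -
  have "Poly_Mapping.keys (scale c v) \<subseteq> Poly_Mapping.keys v" by (auto simp: in_keys_iff)
  then show ?thesis
    using extend_superset[of "Poly_Mapping.keys v" "scale c v" f] extend_superset[of "Poly_Mapping.keys v" v f]
    by (simp add: sum_distrib_left mult.assoc)
qed

lemma extend_single [simp]: "extend f (point D) = f D"
  by (simp add: extend_def)

lemma extend_diff: "extend f (u - v) = extend f u - extend f v"
  using extend_add[of f "u - v" v] by simp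

text \<open>A linear functional that is compatible with the relations and vanishes on the small basis diagrams
detects elements outside the ideal.\<close>

lemma extend_ideal_T:
  assumes rel: "\<And>D c D'. relation p n D c D' \<Longrightarrow> f D = c * f D'"
    and small: "\<And>D. D \<in> basis_diagrams n \<Longrightarrow> int (undecorated_propagating D) \<le> m \<Longrightarrow> f D = 0"
    and v: "v \<in> ideal_T p n m"
  shows "extend f v = 0"
proof -
  have "ideal_T p n m \<subseteq> {v. extend f v = 0}"
    unfolding ideal_T_def
  proof (rule combinations.span_minimal)
    show "relators p n \<union> {point D |D. D \<in> basis_diagrams n \<and> int (undecorated_propagating D) \<le> m}
      \<subseteq> {v. extend f v = 0}"
      using rel small by (auto simp: relators_def extend_diff extend_scale)
    show "combinations.subspace {v. extend f v = 0}"
      unfolding combinations.subspace_def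
      by (auto simp: extend_add extend_scale) (simp add: extend_def)
  qed
  with v show ?thesis by blast
qed

text \<open>For \<open>d\<close> with at most one blob on each line, \<open>D\<close> differs from \<open>d\<close> by repetitions of blobs and by loops
only.\<close>

definition same_shape :: "diagram \<Rightarrow> diagram \<Rightarrow> bool" where
  "same_shape D d \<longleftrightarrow> (\<forall>(x, w, y)\<in>lines D. \<exists>w0. (x, w0, y) \<in> lines d \<and> set w = set w0)"

text \<open>The factor by which a word of \<open>a\<close> letters L or of \<open>b\<close> letters R reduces to one letter; truncated
subtraction makes the exponent of an absent letter \<open>0\<close>.\<close>

definition line_weight :: "'k::field parameters \<Rightarrow> blob list \<Rightarrow> 'k" where
  "line_weight p w = delta_L p ^ (count_list w LB - 1) * delta_R p ^ (count_list w RB - 1)"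

definition loop_weight :: "'k::field parameters \<Rightarrow> blob list \<Rightarrow> 'k" where
  "loop_weight p w = line_weight p w *
     (if LB \<in> set w then if RB \<in> set w then kappa_LR p else kappa_L p
      else if RB \<in> set w then kappa_R p else delta p)"

text \<open>The coefficient of \<open>d\<close> in the reduced form of \<open>D\<close>. Restricting the product to lines that start at the
top counts every propagating line once, and only these are decorated in the diagrams \<open>d\<close> below.\<close>

definition coefficient :: "'k::field parameters \<Rightarrow> diagram \<Rightarrow> diagram \<Rightarrow> 'k" where
  "coefficient p d D = (if same_shape D d
     then (\<Prod>l\<in>{l \<in> lines D. is_top (fst l)}. line_weight p (fst (snd l))) *
        prod_mset (image_mset (loop_weight p) (loops D))
     else 0)"

lemma line_weight_rev [simp]: "line_weight p (rev w) = line_weight p w"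
  by (simp add: line_weight_def)

lemma line_weight_simps [simp]:
  "line_weight p [] = 1" "line_weight p [b] = 1"
  by (cases b; simp add: line_weight_def)+

lemma line_weight_reduce:
  "line_weight p (u @ [LB, LB] @ v) = delta_L p * line_weight p (u @ [LB] @ v)"
  "line_weight p (u @ [RB, RB] @ v) = delta_R p * line_weight p (u @ [RB] @ v)"
  by (simp_all add: line_weight_def)

lemma loop_weight_rotate: "loop_weight p (rotate k w) = loop_weight p w"
proof -
  have "count_list (rotate k w) b = count_list w b" for b
    by (metis count_mset mset_rotate)
  then show ?thesis by (simp add: loop_weight_def line_weight_def)
qed

lemma loop_weight_reduce:
  "loop_weight p (LB # LB # v) = delta_L p * loop_weight p (LB # v)"
  "loop_weight p (RB # RB # v) = delta_R p * loop_weight p (RB # v)"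
  using line_weight_reduce[of p "[]" v] by (simp_all add: loop_weight_def)

lemma loop_weight_rules: "(w, c) \<in> loop_rules p \<Longrightarrow> loop_weight p w = c"
  by (auto simp: loop_rules_def loop_weight_def line_weight_def)

lemma top_lines_weight:
  "(\<Prod>l\<in>{l \<in> wires n \<sigma> \<omega>. is_top (fst l)}. line_weight p (fst (snd l))) = (\<Prod>i\<in>{1..n}. line_weight p (\<omega> (Top i)))"
proof (rule prod.reindex_cong)
  show "inj_on (\<lambda>i. (Top i, \<omega> (Top i), \<sigma> (Top i))) {1..n}" by (auto simp: inj_on_def)
  have "is_top x \<Longrightarrow> \<exists>i. x = Top i" for x by (cases x) auto
  then show "{l \<in> wires n \<sigma> \<omega>. is_top (fst l)} = (\<lambda>i. (Top i, \<omega> (Top i), \<sigma> (Top i))) ` {1..n}"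
    by (auto simp: wires_def image_iff) (metis vertices_simps(1) atLeastAtMost_iff One_nat_def)
qed simp

text \<open>With its tethers, a line carrying both blobs reaches from the left side to the right side, and so
separates the top edge from the bottom edge.\<close>

lemma no_doubly_decorated_line:
  assumes "left_right_diagram n D" and t: "(Top i, [], Bot j) \<in> lines D" and l: "(x, w, y) \<in> lines D"
  shows "\<not> {LB, RB} \<subseteq> set w"
proof
  assume w: "{LB, RB} \<subseteq> set w"
  interpret left_right_diagram n D by fact
  from ends[OF t] have ij: "i \<in> {1..n}" "j \<in> {1..n}" by auto
  have "{x, y} \<noteq> {Top i, Bot j}"
  proof
    assume "{x, y} = {Top i, Bot j}"
    then have "(Top i, w, Bot j) \<in> lines D \<or> (Top i, rev w, Bot j) \<in> lines D"
      using l reverse[OF l] by (auto simp: doubleton_eq_iff)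
    moreover have "v = []" if "(Top i, v, Bot j) \<in> lines D" for v
      using matching[of "Top i"] ij t that by (auto simp: case_prod_unfold)
    ultimately have "w = [] \<or> rev w = []" by metis
    then show False using w by auto
  qed
  from lines_cross[OF l t this]
  have nc: "noncrossing (block n (x, w, y)) (block n (Top i, [], Bot j))" .
  moreover have "0 \<in> block n (x, w, y)" "n + 1 \<in> block n (x, w, y)"
    using w by (auto simp: block_def sides_def left_pos_def right_pos_def)
  moreover have "i \<in> block n (Top i, [], Bot j)" "2 * n + 2 - j \<in> block n (Top i, [], Bot j)"
    by (auto simp: block_def)
  moreover have "0 < i \<and> i < n + 1 \<and> n + 1 < 2 * n + 2 - j" using ij by auto
  ultimately show False unfolding noncrossing_def by blast
qed

text \<open>The common features of the generating diagrams. The undecorated propagating line is essential: by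
\<open>no_doubly_decorated_line\<close>, it excludes lines with both blobs, so that \<open>\<kappa>\<^sub>L\<^sub>R\<close> never enters.\<close>

locale generator =
  fixes n :: nat and \<sigma>0 :: "vertex \<Rightarrow> vertex" and \<omega>0 :: "vertex \<Rightarrow> blob list" and d :: diagram
  assumes d: "d = Diagram (wires n \<sigma>0 \<omega>0) {#}"
    and left_right: "left_right_diagram n d"
    and wiring: "wiring n \<sigma>0 \<omega>0"
    and simple: "x \<in> vertices n \<Longrightarrow> \<omega>0 x \<in> {[], [LB], [RB]}"
    and decorated_propagating: "x \<in> vertices n \<Longrightarrow> \<omega>0 x \<noteq> [] \<Longrightarrow> is_top (\<sigma>0 x) \<noteq> is_top x"
    and undecorated: "\<exists>i j. (Top i, [], Bot j) \<in> lines d"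
begin

lemma same_shape_wires:
  "same_shape (Diagram (wires n \<sigma> \<omega>) M) d \<longleftrightarrow> (\<forall>x\<in>vertices n. \<sigma> x = \<sigma>0 x \<and> set (\<omega> x) = set (\<omega>0 x))"
  unfolding same_shape_def d diagram.sel by (fastforce simp: wires_def)

lemma not_both_letters: "x \<in> vertices n \<Longrightarrow> \<not> {LB, RB} \<subseteq> set (\<omega>0 x)"
  using simple[of x] by auto

lemma same_shape_undecorated:
  assumes D: "left_right_diagram n D" and s: "same_shape D d" and t: "(Top i, [], Bot j) \<in> lines d"
  shows "(Top i, [], Bot j) \<in> lines D"
proof -
  from D obtain \<sigma> \<omega> where "wiring n \<sigma> \<omega>" and L: "lines D = wires n \<sigma> \<omega>" by (rule left_right_diagram_wires)
  then have "D = Diagram (wires n \<sigma> \<omega>) (loops D)" by (simp add: diagram_eqI)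
  with s have s': "\<forall>x\<in>vertices n. \<sigma> x = \<sigma>0 x \<and> set (\<omega> x) = set (\<omega>0 x)" by (metis same_shape_wires)
  from t have t0: "Top i \<in> vertices n" "\<omega>0 (Top i) = []" "\<sigma>0 (Top i) = Bot j"
    unfolding d diagram.sel mem_wires by (elim conjE, simp)+
  from bspec[OF s' t0(1)] t0(2,3) have "\<sigma> (Top i) = Bot j \<and> \<omega> (Top i) = []" by simp
  with t0(1) show ?thesis unfolding L mem_wires by simp
qed

lemma same_shape_not_doubly_decorated:
  assumes "left_right_diagram n D" and "same_shape D d" and "(x, w, y) \<in> lines D"
  shows "\<not> {LB, RB} \<subseteq> set w"
  using undecorated same_shape_undecorated[OF assms(1,2)] no_doubly_decorated_line[OF assms(1) _ assms(3)] by blast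

lemma coefficient_wires:
  assumes "same_shape (Diagram (wires n \<sigma> \<omega>) M) d"
  shows "coefficient p d (Diagram (wires n \<sigma> \<omega>) M) =
    (\<Prod>i\<in>{1..n}. line_weight p (\<omega> (Top i))) * prod_mset (image_mset (loop_weight p) M)"
  using assms by (simp add: coefficient_def top_lines_weight)

lemma coefficient_self: "coefficient p d d = 1"
proof -
  have "same_shape d d" unfolding same_shape_def by auto
  moreover have "line_weight p (\<omega>0 (Top i)) = 1" if "i \<in> {1..n}" for i
    using simple[of "Top i"] that by auto
  ultimately show ?thesis using coefficient_wires[of \<sigma>0 \<omega>0 "{#}" p] by (simp flip: d)
qed

text \<open>The rules for LL and RR keep the shape and change the weight of one propagating line by their scalar.
For LRL and RLR both coefficients are \<open>0\<close>: a diagram of the shape of \<open>d\<close> on the right would have an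
undecorated propagating line, also present on the left next to the line with both blobs.\<close>

lemma coefficient_relation_on_line:
  assumes W: "wiring n \<sigma> \<omega>" and D: "left_right_diagram n (Diagram (wires n \<sigma> \<omega>) M)"
    and r: "(z, c, z') \<in> line_rules p" and x: "x \<in> vertices n" and w: "\<omega> x = u @ z @ v"
  shows "coefficient p d (Diagram (wires n \<sigma> \<omega>) M) =
    c * coefficient p d (Diagram (wires n \<sigma> (wiring.rewrite \<sigma> \<omega> x (u @ z' @ v))) M)"
proof -
  interpret wiring n \<sigma> \<omega> by fact
  let ?\<omega> = "rewrite x (u @ z' @ v)"
  have sx: "\<sigma> x \<in> vertices n" "\<sigma> x \<noteq> x" "\<omega> (\<sigma> x) = rev (\<omega> x)"
    using other_end no_fixpoint word_reverse x by auto
  have z: "z \<noteq> []" "z' \<noteq> []" using line_rules_subseq[OF r] by auto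
  show ?thesis
  proof (cases "set z' = set z")
    case True
    have "set (?\<omega> y) = set (\<omega> y)" for y using True x w sx by (simp add: rewrite_apply)
    then have same: "same_shape (Diagram (wires n \<sigma> ?\<omega>) M) d \<longleftrightarrow> same_shape (Diagram (wires n \<sigma> \<omega>) M) d"
      by (simp add: same_shape_wires)
    show ?thesis
    proof (cases "same_shape (Diagram (wires n \<sigma> \<omega>) M) d")
      case shape: True
      then have s: "\<sigma> y = \<sigma>0 y" "set (\<omega> y) = set (\<omega>0 y)" if "y \<in> vertices n" for y
        using that by (auto simp: same_shape_wires)
      have "\<omega>0 x \<noteq> []" using s(2)[OF x] w z by auto
      then have opp: "is_top (\<sigma> x) \<noteq> is_top x" using decorated_propagating[OF x] s(1)[OF x] by simp
      obtain i where i: "i \<in> {1..n}" "x = Top i \<and> (\<exists>j. \<sigma> x = Bot j) \<or> \<sigma> x = Top i \<and> (\<exists>j. x = Bot j)"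
        using opp x sx(1) by (cases x; cases "\<sigma> x") auto
      have wt: "line_weight p (\<omega> (Top i)) = c * line_weight p (?\<omega> (Top i))"
      proof -
        have "line_weight p (u @ z @ v) = c * line_weight p (u @ z' @ v)"
          using r True line_weight_reduce[of p u v] by (auto simp: line_rules_def)
        then show ?thesis using i(2) sx x w by (auto simp: rewrite_apply simp del: rev_append)
      qed
      have other: "?\<omega> (Top i') = \<omega> (Top i')" if "i' \<noteq> i" for i'
        using i(2) that x by (auto simp: rewrite_apply)
      have "(\<Prod>i\<in>{1..n}. line_weight p (\<omega> (Top i))) = c * (\<Prod>i\<in>{1..n}. line_weight p (?\<omega> (Top i)))"
        using i(1) by (simp add: prod.remove[of _ i] wt other mult.assoc)
      then show ?thesis using shape same by (simp add: coefficient_wires mult.assoc)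
    qed (use same in \<open>simp add: coefficient_def\<close>)
  next
    case False
    then have LR: "{LB, RB} \<subseteq> set z" using r by (auto simp: line_rules_def)
    have "\<not> same_shape (Diagram (wires n \<sigma> \<omega>) M) d"
    proof
      assume "same_shape (Diagram (wires n \<sigma> \<omega>) M) d"
      then have "set (\<omega> x) = set (\<omega>0 x)" using x by (auto simp: same_shape_wires)
      with not_both_letters[OF x] w LR show False by auto
    qed
    moreover have "\<not> same_shape (Diagram (wires n \<sigma> ?\<omega>) M) d"
    proof
      assume s: "same_shape (Diagram (wires n \<sigma> ?\<omega>) M) d"
      from undecorated obtain i j where "(Top i, [], Bot j) \<in> lines d" by blast
      then have ij: "Top i \<in> vertices n" "\<omega>0 (Top i) = []" "\<sigma>0 (Top i) = Bot j"
        unfolding d diagram.sel mem_wires by (elim conjE, simp)+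
      from bspec[OF s[unfolded same_shape_wires] ij(1)] ij(2,3)
      have "\<sigma> (Top i) = Bot j" "?\<omega> (Top i) = []" by simp_all
      with z ij have "(Top i, [], Bot j) \<in> wires n \<sigma> \<omega>" using x by (auto simp: rewrite_apply split: if_splits)
      with no_doubly_decorated_line[OF D, of i j x "\<omega> x" "\<sigma> x"] x w LR show False by auto
    qed
    ultimately show ?thesis by (simp add: coefficient_def)
  qed
qed

text \<open>In the relation \<open>top_bottom\<close> both coefficients are \<open>0\<close>: if the right-hand side had the shape of \<open>d\<close>, its
undecorated propagating line would already occur on the left, together with an arc reaching both
sides.\<close>

lemma coefficient_relation:
  assumes "relation p n D c D'"
  shows "coefficient p d D = c * coefficient p d D'"
  using assms
proof cases
  case (loop_removal S w M)
  then show ?thesis using loop_weight_rules[OF loop_removal(4)]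
    by (simp add: coefficient_def same_shape_def)
next
  case (loop_LL S w M k v)
  have "loop_weight p w = delta_L p * loop_weight p (LB # v)"
    using loop_weight_rotate[of p k w] by (simp add: loop_LL loop_weight_reduce)
  then show ?thesis by (simp add: loop_LL coefficient_def same_shape_def mult.left_commute)
next
  case (loop_RR S w M k v)
  have "loop_weight p w = delta_R p * loop_weight p (RB # v)"
    using loop_weight_rotate[of p k w] by (simp add: loop_RR loop_weight_reduce)
  then show ?thesis by (simp add: loop_RR coefficient_def same_shape_def mult.left_commute)
next
  case (on_line S M z z' x u v y)
  from left_right_diagram_wires[OF on_line(3)] obtain \<sigma> \<omega> where W: "wiring n \<sigma> \<omega>" and S: "S = wires n \<sigma> \<omega>"
    by auto
  interpret wiring n \<sigma> \<omega> by fact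
  from on_line(5) have x: "x \<in> vertices n" "\<omega> x = u @ z @ v" "y = \<sigma> x" by (auto simp: S)
  have "D' = Diagram (wires n \<sigma> (rewrite x (u @ z' @ v))) M"
    using wires_rewrite[OF x(1), of "u @ z' @ v"] x by (simp add: on_line(2) S)
  with coefficient_relation_on_line[OF W _ on_line(4) x(1,2)] on_line(1,3) show ?thesis by (simp add: S)
next
  case (top_bottom S M i j i' j' S')
  have "\<not> same_shape D d"
    using same_shape_not_doubly_decorated[of D] top_bottom(1,4,5) by fastforce
  moreover have "\<not> same_shape D' d"
  proof
    assume s: "same_shape D' d"
    from undecorated obtain a b where t: "(Top a, [], Bot b) \<in> lines d" by blast
    from same_shape_undecorated[OF _ s t] have "(Top a, [], Bot b) \<in> S'" using top_bottom(3,8) by simp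
    then have "(Top a, [], Bot b) \<in> S" unfolding top_bottom(7) by (auto simp: both_ways_def)
    then show False
      using no_doubly_decorated_line[OF top_bottom(4), of a b "Top i" "[LB, RB]" "Top j"] top_bottom(5) by simp
  qed
  ultimately show ?thesis by (simp add: coefficient_def)
qed

lemma undecorated_le:
  assumes D: "left_right_diagram n D" and s: "same_shape D d"
  shows "undecorated_propagating d \<le> undecorated_propagating D"
  unfolding undecorated_propagating_def
proof (rule card_mono)
  interpret left_right_diagram n D by fact
  have "{(i, j). (Top i, [], Bot j) \<in> lines D} \<subseteq> {1..n} \<times> {1..n}" using ends by force
  then show "finite {(i, j). (Top i, [], Bot j) \<in> lines D}" by (rule finite_subset) simp
  show "{(i, j). (Top i, [], Bot j) \<in> lines d} \<subseteq> {(i, j). (Top i, [], Bot j) \<in> lines D}"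
    using same_shape_undecorated[OF D s] by auto
qed

lemma extend_coefficient_ideal_T:
  assumes "m < int (undecorated_propagating d)" and "v \<in> ideal_T p n m"
  shows "extend (coefficient p d) v = 0"
proof (rule extend_ideal_T[OF coefficient_relation _ assms(2)])
  fix D assume D: "D \<in> basis_diagrams n" "int (undecorated_propagating D) \<le> m"
  then have "\<not> same_shape D d" using undecorated_le[of D] assms(1) by (auto simp: basis_diagrams_def)
  then show "coefficient p d D = 0" by (simp add: coefficient_def)
qed

lemma in_ideal_T:
  assumes D: "left_right_diagram n D" "\<not> both_arcs D" "int (undecorated_propagating D) \<le> m"
  shows "point D \<in> ideal_T p n m"
proof -
  from D(1) obtain \<sigma> \<omega> where W: "wiring n \<sigma> \<omega>" and L: "lines D = wires n \<sigma> \<omega>" by (rule left_right_diagram_wires)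
  from L obtain M where De: "D = Diagram (wires n \<sigma> \<omega>) M" by (cases D) auto
  from reduce_to_basis[OF D(1)[unfolded De] W D(2)[unfolded De], of p] obtain c \<omega>' where
    b: "Diagram (wires n \<sigma> \<omega>') {#} \<in> basis_diagrams n"
    and e: "\<forall>x\<in>vertices n. subseq (\<omega>' x) (\<omega> x) \<and> (\<omega>' x = [] \<longleftrightarrow> \<omega> x = [])"
    and s: "point D - scale c (point (Diagram (wires n \<sigma> \<omega>') {#})) \<in> combinations.span (relators p n)"
    unfolding De[symmetric] by blast
  let ?S = "relators p n \<union> {point D |D. D \<in> basis_diagrams n \<and> int (undecorated_propagating D) \<le> m}"
  have "(Top i, [], Bot j) \<in> wires n \<sigma> \<omega>' \<longleftrightarrow> (Top i, [], Bot j) \<in> wires n \<sigma> \<omega>" for i j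
    using e[rule_format, of "Top i"] by auto
  then have "undecorated_propagating (Diagram (wires n \<sigma> \<omega>') {#}) = undecorated_propagating D"
    by (simp only: undecorated_propagating_def diagram.sel L)
  then have "point (Diagram (wires n \<sigma> \<omega>') {#}) \<in> combinations.span ?S"
    using b D(3) by (intro combinations.span_base UnI2 CollectI exI[of _ "Diagram (wires n \<sigma> \<omega>') {#}"]) simp
  then have "(point D - scale c (point (Diagram (wires n \<sigma> \<omega>') {#})))
     + scale c (point (Diagram (wires n \<sigma> \<omega>') {#})) \<in> combinations.span ?S"
    using s combinations.span_mono[of "relators p n" ?S]
    by (intro combinations.span_add combinations.span_scale) auto
  then show ?thesis by (simp add: ideal_T_def)
qed

text \<open>The reduced form of \<open>D\<close> has the connections of \<open>d\<close>, and its words consist of the letters of the words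
of \<open>d\<close> without repetition, so it is \<open>d\<close>.\<close>

lemma same_shape_multiple:
  assumes D: "left_right_diagram n D" and shape: "same_shape D d"
  shows "\<exists>c. point D - scale c (point d) \<in> ideal_T p n m"
proof -
  from D obtain \<sigma> \<omega> where W: "wiring n \<sigma> \<omega>" and L: "lines D = wires n \<sigma> \<omega>" by (rule left_right_diagram_wires)
  from L obtain M where De: "D = Diagram (wires n \<sigma> \<omega>) M" by (cases D) auto
  have "\<not> both_arcs D" using same_shape_not_doubly_decorated[OF D shape] by (auto simp: both_arcs_def)
  from reduce_to_basis[OF D[unfolded De] W this[unfolded De], of p] obtain c \<omega>' where
    b: "Diagram (wires n \<sigma> \<omega>') {#} \<in> basis_diagrams n"
    and e: "\<forall>x\<in>vertices n. subseq (\<omega>' x) (\<omega> x) \<and> (\<omega>' x = [] \<longleftrightarrow> \<omega> x = [])"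
    and s: "point D - scale c (point (Diagram (wires n \<sigma> \<omega>') {#})) \<in> combinations.span (relators p n)"
    unfolding De[symmetric] by blast
  have shape': "\<forall>x\<in>vertices n. \<sigma> x = \<sigma>0 x \<and> set (\<omega> x) = set (\<omega>0 x)"
    using shape De by (metis same_shape_wires)
  have "\<sigma> x = \<sigma>0 x \<and> \<omega>' x = \<omega>0 x" if x: "x \<in> vertices n" for x
  proof -
    from shape' x have "\<sigma> x = \<sigma>0 x" and so: "set (\<omega> x) = set (\<omega>0 x)" by blast+
    moreover have "\<omega>' x = \<omega>0 x"
    proof (cases "\<omega>0 x = []")
      case False
      then obtain l where l: "\<omega>0 x = [l]" using simple[OF x] by auto
      have ne: "\<omega>' x \<noteq> []" using so l e x by auto
      have sub: "set (\<omega>' x) \<subseteq> {l}" using so l e x subseq_set_subset by fastforce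
      have "(x, \<omega>' x, \<sigma> x) \<in> lines (Diagram (wires n \<sigma> \<omega>') {#})" using x by simp
      then have irr: "\<not> sublist [l, l] (\<omega>' x)" using b unfolding basis_diagrams_def by (cases l) fastforce+
      from ne obtain l1 w where w: "\<omega>' x = l1 # w" by (cases "\<omega>' x") auto
      show ?thesis
      proof (cases w)
        case Nil
        then show ?thesis using w sub l by simp
      next
        case (Cons l2 w2)
        then have "\<omega>' x = [] @ [l, l] @ w2" using w sub by simp
        then have "sublist [l, l] (\<omega>' x)" by (metis sublist_appendI)
        then show ?thesis using irr by simp
      qed
    qed (use so e x in auto)
    ultimately show ?thesis by simp
  qed
  then have "wires n \<sigma> \<omega>' = wires n \<sigma>0 \<omega>0" by (intro wires_cong) blast
  then have "Diagram (wires n \<sigma> \<omega>') {#} = d" by (simp add: d)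
  with s have "point D - scale c (point d) \<in> combinations.span (relators p n)" by simp
  then show ?thesis unfolding ideal_T_def using combinations.span_mono[of "relators p n"] by blast
qed

text \<open>Reduction shows that the required scalar exists, and the functional determines it.\<close>

lemma inner_prod_eq_coefficient:
  assumes l: "cell_generator n l = d" "int (undecorated_propagating d) = \<bar>l\<bar>"
    and D: "stack (flip b2) b1 = D" "left_right_diagram n D"
    and cases: "same_shape D d \<or> int (undecorated_propagating D) < \<bar>l\<bar> \<and> \<not> both_arcs D"
  shows "inner_prod p n l b1 b2 = coefficient p d D"
proof -
  have unique: "c = coefficient p d D"
    if "point D - scale c (point d) \<in> ideal_T p n (\<bar>l\<bar> - 1)" for c
    using extend_coefficient_ideal_T[OF _ that] l(2)
    by (simp add: extend_diff extend_scale coefficient_self)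
  have "\<exists>c. point D - scale c (point d) \<in> ideal_T p n (\<bar>l\<bar> - 1)"
    using cases
  proof
    assume "int (undecorated_propagating D) < \<bar>l\<bar> \<and> \<not> both_arcs D"
    then have "point D \<in> ideal_T p n (\<bar>l\<bar> - 1)" by (intro in_ideal_T D(2)) auto
    then show ?thesis by (intro exI[of _ 0]) simp
  qed (rule same_shape_multiple[OF D(2)])
  then obtain c where c: "point D - scale c (point d) \<in> ideal_T p n (\<bar>l\<bar> - 1)" ..
  show ?thesis unfolding inner_prod_def l(1) D(1)
  proof (rule the_equality)
    show "point D - scale (coefficient p d D) (point d) \<in> ideal_T p n (\<bar>l\<bar> - 1)"
      using c unfolding unique[OF c] .
  qed (rule unique)
qed

end

section \<open>The cell bases\<close>

lemma gen_joined:
  "gen_e n = Diagram (joined n no_arc no_arc (\<lambda>r. if r = 1 then [LB] else [])) {#}"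
  "gen_f n = Diagram (joined n no_arc no_arc (\<lambda>r. if r = n then [RB] else [])) {#}"
proof -
  have id: "both_ways {(Top j, if j = k then [b] else [], Bot j) | j. j \<in> {1..n}} =
      joined n no_arc no_arc (\<lambda>r. if r = k then [b] else [])" (is "?S = ?J") for k b
  proof -
    have "(x, w, y) \<in> ?S \<longleftrightarrow> (x, w, y) \<in> ?J" for x w y
      by (cases x; cases y) (auto simp: both_ways_def joined_def)
    then show ?thesis by (simp only: set_eq_iff split_paired_All) blast
  qed
  show "gen_e n = Diagram (joined n no_arc no_arc (\<lambda>r. if r = 1 then [LB] else [])) {#}"
    "gen_f n = Diagram (joined n no_arc no_arc (\<lambda>r. if r = n then [RB] else [])) {#}"
    unfolding gen_e_def gen_f_def id by simp_all
qed

lemma gen_U_joined: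
  assumes "1 \<le> i" "i < n"
  shows "gen_U n i = Diagram (joined n (one_arc i []) (one_arc i []) (\<lambda>_. [])) {#}"
proof -
  let ?S = "both_ways ({(Top i, [], Top (i + 1)), (Bot i, [], Bot (i + 1))} \<union>
     {(Top j, [], Bot j) | j. j \<in> {1..n} - {i, i + 1}})"
  let ?J = "joined n (one_arc i []) (one_arc i []) (\<lambda>_. [])"
  have "(x, w, y) \<in> ?S \<longleftrightarrow> (x, w, y) \<in> ?J" for x w y
    using assms by (cases x; cases y) (auto simp: both_ways_def joined_def fate_one_arc place_one_arc split: if_splits)
  then have "?S = ?J" by (simp only: set_eq_iff split_paired_All) blast
  then show ?thesis by (simp add: gen_U_def)
qed

text \<open>Position of the top arc of the \<open>k\<close>-th cell basis element; elements \<open>0\<close> and \<open>n\<close> repeat the positions of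
their neighbours, with a blob on the arc.\<close>

definition arc_pos :: "nat \<Rightarrow> nat \<Rightarrow> nat" where
  "arc_pos n k = (if k = 0 then 1 else if k = n then n - 1 else k)"

definition arc_word :: "nat \<Rightarrow> nat \<Rightarrow> blob list" where
  "arc_word n k = (if k = 0 then [LB] else if k = n then [RB] else [])"

text \<open>\<open>deco\<close> is the set of blobs on the propagating lines of the generating diagram. Its four possible
values give the four cell modules, and the bound on \<open>n\<close> says that one of the \<open>n - 2\<close> propagating
lines is undecorated.\<close>

locale cell =
  fixes n :: nat and deco :: "blob set"
  assumes size: "3 + of_bool (LB \<in> deco) + of_bool (RB \<in> deco) \<le> n"
begin

definition line_word :: "nat \<Rightarrow> blob list" where
  "line_word r = (if LB \<in> deco \<and> r = 1 then [LB] else []) @ (if RB \<in> deco \<and> r = n - 2 then [RB] else [])"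

definition gen_pos :: nat where
  "gen_pos = (if LB \<in> deco then 2 else 1)"

definition cell_diagram :: "nat \<Rightarrow> diagram" where
  "cell_diagram k = Diagram (joined n (one_arc (arc_pos n k) (arc_word n k)) (one_arc gen_pos []) line_word) {#}"

definition label :: int where
  "label = (if LB \<in> deco then if RB \<in> deco then int n - 4 else int n - 3 else if RB \<in> deco then - (int n - 3) else - (int n - 2))"

lemma n3: "3 \<le> n" using size by simp

lemma gen_pos: "1 \<le> gen_pos" "gen_pos < n" "arc_pos n gen_pos = gen_pos" "arc_word n gen_pos = []"
  using size by (auto simp: gen_pos_def arc_pos_def arc_word_def)

lemma cell_generator_label: "cell_generator n label = cell_diagram gen_pos"
proof -
  have U: "gen_U n gen_pos = Diagram (joined n (one_arc gen_pos []) (one_arc gen_pos []) (\<lambda>_. [])) {#}"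
    using gen_pos by (intro gen_U_joined)
  have Uf: "stack (gen_U n gen_pos) (gen_f n) = Diagram (joined n (one_arc gen_pos []) (one_arc gen_pos [])
      (\<lambda>r. if r = n - 2 then [RB] else [])) {#}" if "RB \<in> deco"
  proof -
    have "[] @ (if place (one_arc gen_pos []) u = n then [RB] else []) = (if u = n - 2 then [RB] else [])" for u
      using that size by (auto simp: place_one_arc gen_pos_def)
    then show ?thesis unfolding U gen_joined
      using gen_pos that size by (subst stack_one_arc_no_arc[OF half_one_arc half_no_arc]) (auto simp: gen_pos_def)
  qed
  have eU: "stack (gen_e n) (Diagram (joined n (one_arc gen_pos []) C w) {#}) =
      Diagram (joined n (one_arc gen_pos []) C (\<lambda>r. (if r = 1 then [LB] else []) @ w r)) {#}"
    if "LB \<in> deco" "half_diagram n (n - 2) C" for C w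
  proof -
    have "(if place (one_arc gen_pos []) u = 1 then [LB] else []) = (if u = 1 then [LB] else [])" for u
      using that by (auto simp: place_one_arc gen_pos_def)
    then show ?thesis unfolding gen_joined
      using gen_pos that by (subst stack_no_arc_one_arc[OF half_no_arc]) (simp_all add: gen_pos_def)
  qed
  have C: "half_diagram n (n - 2) (one_arc gen_pos [])" using gen_pos by (intro half_one_arc)
  have g: "gen_U n (if LB \<in> deco then 2 else 1) = gen_U n gen_pos" by (simp add: gen_pos_def)
  have lw: "line_word = (\<lambda>r. (if LB \<in> deco \<and> r = 1 then [LB] else []) @ (if RB \<in> deco \<and> r = n - 2 then [RB] else []))"
    by (simp add: fun_eq_iff line_word_def)
  consider "LB \<in> deco" "RB \<in> deco" | "LB \<in> deco" "\<not> RB \<in> deco" | "\<not> LB \<in> deco" "RB \<in> deco" | "\<not> LB \<in> deco" "\<not> RB \<in> deco" by blast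
  then show ?thesis
  proof cases
    case 1
    then have "cell_generator n label = stack (gen_e n) (stack (gen_U n gen_pos) (gen_f n))"
      using size by (simp add: cell_generator_def label_def gen_pos_def)
    then show ?thesis using 1 C by (simp add: Uf eU cell_diagram_def gen_pos lw)
  next
    case 2
    then have "cell_generator n label = stack (gen_e n) (gen_U n gen_pos)"
      using size by (auto simp: cell_generator_def label_def gen_pos_def)
    then show ?thesis using 2 C by (simp add: U eU cell_diagram_def gen_pos lw)
  next
    case 3
    then have "cell_generator n label = stack (gen_U n gen_pos) (gen_f n)"
      using size by (auto simp: cell_generator_def label_def gen_pos_def)
    then show ?thesis using 3 by (simp add: Uf cell_diagram_def gen_pos lw)
  next
    case 4
    then have "cell_generator n label = gen_U n gen_pos"
      using size by (auto simp: cell_generator_def label_def gen_pos_def)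
    then show ?thesis using 4 by (simp add: U cell_diagram_def gen_pos lw)
  qed
qed

lemma half_gen: "half_diagram n (n - 2) (one_arc gen_pos [])"
  using gen_pos by (intro half_one_arc)

lemma stack_e_cell: "stack (gen_e n) (cell_diagram 1) = cell_diagram 0"
proof -
  have "(if place (one_arc 1 []) u = 1 then [LB] else []) @ line_word u = line_word u" for u
    by (simp add: place_one_arc)
  then show ?thesis
    unfolding cell_diagram_def gen_joined
    using n3 half_gen by (subst stack_no_arc_one_arc[OF half_no_arc]) (auto simp: arc_pos_def arc_word_def)
qed

lemma stack_f_cell: "stack (gen_f n) (cell_diagram (n - 1)) = cell_diagram n"
proof -
  have "(if place (one_arc (n - 1) []) u = n then [RB] else []) @ line_word u = line_word u" for u
    using n3 by (auto simp: place_one_arc)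
  then show ?thesis
    unfolding cell_diagram_def gen_joined
    using n3 half_gen by (subst stack_no_arc_one_arc[OF half_no_arc]) (auto simp: arc_pos_def arc_word_def)
qed

lemma stack_U_cell_up:
  assumes "1 \<le> j" "j + 1 < n"
  shows "stack (gen_U n (j + 1)) (cell_diagram j) = cell_diagram (j + 1)"
proof -
  have "stack (gen_U n (j + 1)) (cell_diagram j) =
    Diagram (joined n (one_arc (j + 1) []) (one_arc gen_pos []) (\<lambda>u. [] @ (if u = j then [] @ [] else []) @ line_word u)) {#}"
    using stack_previous_arc[of n "one_arc (j + 1) []" "one_arc gen_pos []" j "[]" "\<lambda>_. []" "[]" line_word]
      assms half_gen half_one_arc[of "j + 1" n] by (simp add: cell_diagram_def gen_U_joined arc_pos_def arc_word_def)
  then show ?thesis using assms by (simp add: cell_diagram_def arc_pos_def arc_word_def cong: if_cong)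
qed

lemma stack_U_cell_down:
  assumes "LB \<in> deco"
  shows "stack (gen_U n 1) (cell_diagram 2) = cell_diagram 1"
proof -
  have "stack (gen_U n 1) (cell_diagram 2) =
    Diagram (joined n (one_arc 1 []) (one_arc gen_pos []) (\<lambda>u. [] @ (if u = 1 then rev [] @ rev [] else []) @ line_word u)) {#}"
    using stack_next_arc[of n "one_arc 1 []" "one_arc gen_pos []" 1 "[]" "\<lambda>_. []" "[]" line_word]
      assms size half_gen half_one_arc[of 1 n] by (simp add: cell_diagram_def gen_U_joined arc_pos_def arc_word_def numeral_2_eq_2)
  then show ?thesis using n3 by (simp add: cell_diagram_def arc_pos_def arc_word_def cong: if_cong)
qed

lemma climb_cell:
  assumes "gen_pos \<le> j" "j < n"
  shows "climb n (gen_pos + 1) j (cell_diagram gen_pos) = cell_diagram j"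
  using assms
proof (induction j rule: dec_induct)
  case base
  then show ?case by (simp add: climb_def)
next
  case (step j)
  then have "climb n (gen_pos + 1) (Suc j) (cell_diagram gen_pos) = stack (gen_U n (j + 1)) (cell_diagram j)"
    by (simp add: climb_def)
  with step gen_pos(1) show ?case by (simp add: stack_U_cell_up[simplified])
qed

lemma cell_basis_label:
  assumes k: "k \<le> n"
  shows "cell_basis n label ! k = cell_diagram k"
proof (cases "LB \<in> deco")
  case True
  then have g: "gen_pos = 2" by (simp add: gen_pos_def)
  have "cell_basis n label = [cell_diagram 0, cell_diagram 1] @ map cell_diagram [2..<n] @ [cell_diagram n]"
  proof -
    have "\<not> (label = - (int n - 2) \<or> label = - (int n - 3))" "label = int n - 3 \<or> label = int n - 4"
      using True size by (auto simp: label_def)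
    moreover have "map (\<lambda>j. climb n 3 j (cell_diagram 2)) [2..<n] = map cell_diagram [2..<n]"
      using climb_cell[unfolded g] by (intro map_cong) auto
    moreover have "climb n 3 (n - 1) (cell_diagram 2) = cell_diagram (n - 1)"
      using climb_cell[unfolded g, of "n - 1"] n3 by simp
    ultimately show ?thesis
      by (simp add: cell_basis_def cell_generator_label g Let_def stack_U_cell_down[OF True, simplified]
          stack_e_cell[simplified] stack_f_cell[simplified] del: upt.simps)
  qed
  moreover have "k = 0 \<or> k = 1 \<or> k = n \<or> 2 \<le> k \<and> k < n" using k by linarith
  ultimately show ?thesis using n3
    by (auto simp: nth_append nth_Cons' Suc_diff_Suc simp del: upt.simps)
next
  case False
  then have g: "gen_pos = 1" by (simp add: gen_pos_def)
  have "cell_basis n label = [cell_diagram 0] @ map cell_diagram [1..<n] @ [cell_diagram n]"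
  proof -
    have "label = - (int n - 2) \<or> label = - (int n - 3)"
      using False size by (auto simp: label_def)
    moreover have "map (\<lambda>j. climb n 2 j (cell_diagram 1)) [1..<n] = map cell_diagram [1..<n]"
      using climb_cell[unfolded g] by (intro map_cong) (auto simp: numeral_2_eq_2)
    moreover have "climb n 2 (n - 1) (cell_diagram 1) = cell_diagram (n - 1)"
      using climb_cell[unfolded g, of "n - 1"] n3 by (simp add: numeral_2_eq_2)
    ultimately show ?thesis
      by (simp add: cell_basis_def cell_generator_label g Let_def
          stack_e_cell[simplified] stack_f_cell[simplified] del: upt.simps)
  qed
  moreover have "k = 0 \<or> k = n \<or> 1 \<le> k \<and> k < n" using k by linarith
  ultimately show ?thesis using n3
    by (auto simp: nth_append nth_Cons' simp del: upt.simps)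
qed

end

section \<open>Inner products of cell basis elements\<close>

lemma undecorated_joined:
  assumes "half_diagram n p A" and "half_diagram n p C"
  shows "undecorated_propagating (Diagram (joined n A C w) M) = card {r \<in> {1..p}. w r = []}"
proof -
  interpret A: half_diagram n p A by fact
  interpret C: half_diagram n p C by fact
  have "(Top i, [], Bot j) \<in> joined n A C w \<longleftrightarrow> (i, j) \<in> (\<lambda>r. (place A r, place C r)) ` {r \<in> {1..p}. w r = []}" for i j
  proof
    assume "(Top i, [], Bot j) \<in> joined n A C w"
    then have h: "i \<in> {1..n}" "join_word A C w (Top i) = []" "join_end A C (Top i) = Bot j"
      unfolding joined_def mem_wires by simp_all
    then obtain r where r: "fate A i = Thru r" by (cases "fate A i") auto
    with A.thru[OF h(1) r] h(2,3) have "r \<in> {1..p}" "w r = []" "(i, j) = (place A r, place C r)" by auto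
    then show "(i, j) \<in> (\<lambda>r. (place A r, place C r)) ` {r \<in> {1..p}. w r = []}" by blast
  next
    assume "(i, j) \<in> (\<lambda>r. (place A r, place C r)) ` {r \<in> {1..p}. w r = []}"
    then obtain r where "r \<in> {1..p}" "w r = []" "i = place A r" "j = place C r" by auto
    with A.place[of r] show "(Top i, [], Bot j) \<in> joined n A C w" by (simp add: joined_def)
  qed
  then have "{(i, j). (Top i, [], Bot j) \<in> lines (Diagram (joined n A C w) M)} =
      (\<lambda>r. (place A r, place C r)) ` {r \<in> {1..p}. w r = []}" unfolding diagram.sel by blast
  moreover have "inj_on (\<lambda>r. (place A r, place C r)) {r \<in> {1..p}. w r = []}"
  proof (rule inj_onI)
    fix r s assume h: "r \<in> {r \<in> {1..p}. w r = []}" "s \<in> {r \<in> {1..p}. w r = []}" "(place A r, place C r) = (place A s, place C s)"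
    then have "Thru r = Thru s" using A.place[of r] A.place[of s] by (metis (mono_tags, lifting) mem_Collect_eq prod.inject)
    then show "r = s" by simp
  qed
  ultimately show ?thesis by (simp add: undecorated_propagating_def card_image)
qed

lemma top_arc_word:
  assumes "(Top i, w, Top j) \<in> joined n A C u"
  shows "i \<in> {1..n} \<and> fate A i = Arc w j"
  using assms by (auto simp: joined_def split: fate.splits)

lemma bottom_arc_word:
  assumes "(Bot i, w, Bot j) \<in> joined n A C u"
  shows "i \<in> {1..n} \<and> fate C i = Arc w j"
  using assms by (auto simp: joined_def split: fate.splits)

lemma planar_one_undecorated: "1 \<le> j \<Longrightarrow> j < n \<Longrightarrow> planar_half n (n - 2) (one_arc j [])"
  by (rule planar_one_arc[of _ _ _ 0 0]) auto

lemma fate_one_undecorated: "fate (one_arc j []) i = Arc v k \<Longrightarrow> v = []"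
  by (auto simp: fate_one_arc split: if_splits)

text \<open>The arc is undecorated and has weight \<open>F [] = 1\<close>, so only propagating lines contribute.\<close>

lemma prod_join_word:
  fixes F :: "blob list \<Rightarrow> 'k::comm_monoid_mult"
  assumes j: "1 \<le> j" "j < n" and F: "F [] = 1"
  shows "(\<Prod>i\<in>{1..n}. F (join_word (one_arc j []) C w (Top i))) = (\<Prod>r\<in>{1..n - 2}. F (w r))"
proof -
  interpret half_diagram n "n - 2" "one_arc j []" using j by (rule half_one_arc)
  have "(\<Prod>i\<in>{1..n}. F (join_word (one_arc j []) C w (Top i))) =
     (\<Prod>i\<in>place (one_arc j []) ` {1..n - 2}. F (join_word (one_arc j []) C w (Top i)))"
  proof (rule prod.mono_neutral_right)
    show "\<forall>i\<in>{1..n} - place (one_arc j []) ` {1..n - 2}. F (join_word (one_arc j []) C w (Top i)) = 1"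
    proof
      fix i assume i: "i \<in> {1..n} - place (one_arc j []) ` {1..n - 2}"
      show "F (join_word (one_arc j []) C w (Top i)) = 1"
      proof (cases "fate (one_arc j []) i")
        case (Arc v k)
        then show ?thesis using fate_one_undecorated[OF Arc] F by simp
      next
        case (Thru r)
        with thru[of i r] i show ?thesis by auto
      qed
    qed
    show "place (one_arc j []) ` {1..n - 2} \<subseteq> {1..n}" using place by blast
  qed simp
  also have "\<dots> = (\<Prod>r\<in>{1..n - 2}. F (w r))"
  proof (rule prod.reindex_cong[OF _ refl])
    show "inj_on (place (one_arc j [])) {1..n - 2}"
      by (auto simp: inj_on_def place_one_arc split: if_splits)
    show "F (join_word (one_arc j []) C w (Top (place (one_arc j []) r))) = F (w r)" if "r \<in> {1..n - 2}" for r
      using place[OF that] by simp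
  qed
  finally show ?thesis .
qed

lemma sorted_word:
  assumes "a \<in> {[], [LB], [RB]}"
  shows "\<exists>x y. (if P then [LB] else []) @ a @ (if Q then [RB] else []) = replicate x LB @ replicate y RB"
  using assms
  by (intro exI[of _ "(if P then 1 else 0) + count_list a LB"] exI[of _ "count_list a RB + (if Q then 1 else 0)"])
     (auto simp: numeral_2_eq_2)

context cell
begin

abbreviation gen_half :: half where
  "gen_half \<equiv> one_arc gen_pos []"

abbreviation cell_gen :: diagram where
  "cell_gen \<equiv> cell_diagram gen_pos"

lemma cell_gen_eq: "cell_gen = Diagram (joined n gen_half gen_half line_word) {#}"
  by (simp add: cell_diagram_def gen_pos)

lemma line_word_letters:
  "LB \<in> set (line_word r) \<longleftrightarrow> LB \<in> deco \<and> r = 1" "RB \<in> set (line_word r) \<longleftrightarrow> RB \<in> deco \<and> r = n - 2"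
  by (auto simp: line_word_def)

lemma ends_distinct: "LB \<in> deco \<or> RB \<in> deco \<Longrightarrow> n - 2 \<noteq> 1"
  using size by auto

lemma line_word_cases: "line_word r \<in> {[], [LB], [RB]}"
  using ends_distinct by (auto simp: line_word_def)

lemma rev_line_word [simp]: "rev (line_word r) = line_word r"
  using line_word_cases[of r] by auto

lemma planar_gen_half: "planar_half n (n - 2) gen_half"
  using gen_pos by (intro planar_one_undecorated)

lemma left_right_cell:
  assumes "\<And>r. LB \<in> set (w r) \<Longrightarrow> r = 1" and "\<And>r. RB \<in> set (w r) \<Longrightarrow> r = n - 2"
    and "\<And>u. u \<in># M \<Longrightarrow> LB \<notin> set u \<or> RB \<notin> set u"
  shows "left_right_diagram n (Diagram (joined n gen_half gen_half w) M)"
  by (rule left_right_joined[OF planar_gen_half planar_gen_half]) (use assms in blast)+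

lemma generator_cell_gen:
  "generator n (join_end gen_half gen_half) (join_word gen_half gen_half line_word) cell_gen"
proof (rule generator.intro)
  show "cell_gen = Diagram (wires n (join_end gen_half gen_half) (join_word gen_half gen_half line_word)) {#}"
    by (simp add: cell_gen_eq joined_def)
  show "left_right_diagram n cell_gen"
    unfolding cell_gen_eq by (rule left_right_cell) (auto simp: line_word_letters)
  show "wiring n (join_end gen_half gen_half) (join_word gen_half gen_half line_word)"
    by (rule wiring_joined[OF half_gen half_gen])
  fix x
  show "join_word gen_half gen_half line_word x \<in> {[], [LB], [RB]}"
    using line_word_cases by (cases x) (auto split: fate.splits dest: fate_one_undecorated)
  show "is_top (join_end gen_half gen_half x) \<noteq> is_top x"
    if "join_word gen_half gen_half line_word x \<noteq> []"
    using that by (cases x) (auto split: fate.splits dest: fate_one_undecorated)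
next
  interpret half_diagram n "n - 2" gen_half by (rule half_gen)
  \<comment> \<open>Line \<open>2\<close> if the first one carries an L, and line \<open>1\<close> otherwise; it differs from the last line if that carries an R.\<close>
  have "gen_pos \<in> {1..n - 2}" "line_word gen_pos = []" using size by (auto simp: line_word_def gen_pos_def)
  with place[of gen_pos] show "\<exists>i j. (Top i, [], Bot j) \<in> lines cell_gen"
    by (intro exI[of _ "place gen_half gen_pos"]) (auto simp: cell_gen_eq joined_def)
qed

sublocale generator n "join_end gen_half gen_half" "join_word gen_half gen_half line_word" cell_gen
  by (rule generator_cell_gen)

lemma undecorated_lines: "card {r \<in> {1..n - 2}. line_word r = []} = n - 2 - of_bool (LB \<in> deco) - of_bool (RB \<in> deco)"
proof -
  define L :: "nat set" where "L = (if LB \<in> deco then {1} else {})"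
  define R :: "nat set" where "R = (if RB \<in> deco then {n - 2} else {})"
  have "line_word r = [] \<longleftrightarrow> r \<notin> L \<union> R" for r by (simp add: line_word_def L_def R_def)
  then have "{r \<in> {1..n - 2}. line_word r = []} = {1..n - 2} - (L \<union> R)" by blast
  moreover have "L \<union> R \<subseteq> {1..n - 2}" using n3 by (auto simp: L_def R_def)
  moreover have "card (L \<union> R) = of_bool (LB \<in> deco) + of_bool (RB \<in> deco)"
    using ends_distinct by (simp add: L_def R_def)
  moreover have "finite (L \<union> R)" by (simp add: L_def R_def)
  ultimately show ?thesis by (simp add: card_Diff_subset)
qed

lemma undecorated_cell_gen: "int (undecorated_propagating cell_gen) = \<bar>label\<bar>"
proof -
  have "undecorated_propagating cell_gen = n - 2 - of_bool (LB \<in> deco) - of_bool (RB \<in> deco)"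
    unfolding cell_gen_eq undecorated_joined[OF half_gen half_gen] by (rule undecorated_lines)
  then show ?thesis using size by (auto simp: label_def)
qed

text \<open>If the word \<open>v\<close> coming from the two arcs lands on a line already carrying its letters, the product has
the shape of the generating diagram. Every L of the generating diagram occurs twice and contributes
one factor \<open>\<delta>\<^sub>L\<close>, and every L in \<open>v\<close> another one; likewise for R.\<close>

lemma inner_prod_same_decoration:
  assumes v: "LB \<in> set v \<Longrightarrow> LB \<in> deco \<and> s = 1" "RB \<in> set v \<Longrightarrow> RB \<in> deco \<and> s = n - 2"
    and D: "D = Diagram (joined n gen_half gen_half (\<lambda>r. line_word r @ (if r = s then v else []) @ line_word r)) M"
    and M: "\<And>u. u \<in># M \<Longrightarrow> LB \<notin> set u \<or> RB \<notin> set u"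
    and st: "stack (flip b2) b1 = D"
  shows "inner_prod p n label b1 b2 =
     (if LB \<in> deco then delta_L p else 1) * (if RB \<in> deco then delta_R p else 1) *
     (delta_L p ^ count_list v LB * delta_R p ^ count_list v RB * prod_mset (image_mset (loop_weight p) M))"
proof -
  define w where "w = (\<lambda>r. line_word r @ (if r = s then v else []) @ line_word r)"
  have D': "D = Diagram (joined n gen_half gen_half w) M" by (simp add: D w_def)
  have L: "LB \<in> set (w r) \<longleftrightarrow> LB \<in> set (line_word r)" and R: "RB \<in> set (w r) \<longleftrightarrow> RB \<in> set (line_word r)" for r
    using v by (auto simp: w_def line_word_letters)
  have set: "set (w r) = set (line_word r)" for r
  proof (rule Set.set_eqI)
    fix b show "b \<in> set (w r) \<longleftrightarrow> b \<in> set (line_word r)" using L R by (cases b) auto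
  qed
  have LR: "left_right_diagram n D"
    unfolding D' by (rule left_right_cell) (use L R M in \<open>auto simp: line_word_letters\<close>)
  have shape: "same_shape D cell_gen"
    unfolding D' joined_def same_shape_wires
  proof (intro ballI conjI refl)
    fix x show "set (join_word gen_half gen_half w x) = set (join_word gen_half gen_half line_word x)"
      by (cases x) (auto simp: set split: fate.splits)
  qed
  have weight: "line_weight p (w r) = (if r = 1 then if LB \<in> deco then delta_L p ^ Suc (count_list v LB) else 1 else 1) *
     (if r = n - 2 then if RB \<in> deco then delta_R p ^ Suc (count_list v RB) else 1 else 1)" for r
  proof -
    have "count_list (w r) LB - 1 = (if r = 1 \<and> LB \<in> deco then Suc (count_list v LB) else 0)"
      using v(1) by (cases "LB \<in> set v") (auto simp: w_def line_word_def count_list_0_iff)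
    moreover have "count_list (w r) RB - 1 = (if r = n - 2 \<and> RB \<in> deco then Suc (count_list v RB) else 0)"
      using v(2) by (cases "RB \<in> set v") (auto simp: w_def line_word_def count_list_0_iff)
    ultimately show ?thesis by (simp add: line_weight_def)
  qed
  have "Suc 0 \<le> n - 2" using n3 by simp
  have cL: "LB \<notin> deco \<Longrightarrow> count_list v LB = 0" and cR: "RB \<notin> deco \<Longrightarrow> count_list v RB = 0"
    using v unfolding count_list_0_iff by blast+
  have "(\<Prod>i\<in>{1..n}. line_weight p (join_word gen_half gen_half w (Top i))) = (\<Prod>r\<in>{1..n - 2}. line_weight p (w r))"
    using gen_pos by (intro prod_join_word) auto
  also have "\<dots> = (if LB \<in> deco then delta_L p ^ Suc (count_list v LB) else 1) *
      (if RB \<in> deco then delta_R p ^ Suc (count_list v RB) else 1)"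
    using \<open>Suc 0 \<le> n - 2\<close> by (simp add: weight prod.distrib prod.delta)
  also have "\<dots> = (if LB \<in> deco then delta_L p else 1) * (if RB \<in> deco then delta_R p else 1) *
     (delta_L p ^ count_list v LB * delta_R p ^ count_list v RB)"
    by (simp add: cL cR)
  finally have weights: "(\<Prod>i\<in>{1..n}. line_weight p (join_word gen_half gen_half w (Top i))) =
     (if LB \<in> deco then delta_L p else 1) * (if RB \<in> deco then delta_R p else 1) *
     (delta_L p ^ count_list v LB * delta_R p ^ count_list v RB)" .
  have "coefficient p cell_gen D = (if LB \<in> deco then delta_L p else 1) * (if RB \<in> deco then delta_R p else 1) *
     (delta_L p ^ count_list v LB * delta_R p ^ count_list v RB) * prod_mset (image_mset (loop_weight p) M)"
    unfolding D' joined_def coefficient_wires[OF shape[unfolded D' joined_def]] weights ..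
  moreover have "inner_prod p n label b1 b2 = coefficient p cell_gen D"
    by (rule inner_prod_eq_coefficient[OF cell_generator_label undecorated_cell_gen st LR]) (use shape in blast)
  ultimately show ?thesis by (simp add: mult.assoc)
qed

lemma inner_prod_zero:
  assumes st: "stack (flip b2) b1 = D" and LR: "left_right_diagram n D"
    and und: "int (undecorated_propagating D) < \<bar>label\<bar>" and arcs: "\<not> both_arcs D"
  shows "inner_prod p n label b1 b2 = 0"
proof -
  have "\<not> same_shape D cell_gen" using undecorated_le[OF LR] und undecorated_cell_gen by auto
  then have "coefficient p cell_gen D = 0" by (simp add: coefficient_def)
  with inner_prod_eq_coefficient[OF cell_generator_label undecorated_cell_gen st LR, of p] und arcs show ?thesis by simp
qed

end

text \<open>The inner product without the factors \<open>\<delta>\<^sub>L\<close> and \<open>\<delta>\<^sub>R\<close> from the doubled blobs of the generating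
diagram.\<close>

definition gram_entry :: "'k::field parameters \<Rightarrow> nat \<Rightarrow> blob set \<Rightarrow> nat \<Rightarrow> nat \<Rightarrow> 'k" where
  "gram_entry p n deco k k' =
     (let j = arc_pos n k; j' = arc_pos n k'; v = arc_word n k @ arc_word n k'
      in if j = j' then loop_weight p v
         else if (j' = j + 1 \<or> j = j' + 1) \<and> set v \<subseteq> deco
           then delta_L p ^ count_list v LB * delta_R p ^ count_list v RB
         else 0)"

context cell
begin

lemma arc_word_cases: "arc_word n k \<in> {[], [LB], [RB]}"
  by (simp add: arc_word_def)

lemma rev_arc_word [simp]: "rev (arc_word n k) = arc_word n k"
  by (simp add: arc_word_def)

lemma arc_word_letters: "LB \<in> set (arc_word n k) \<longleftrightarrow> k = 0" "RB \<in> set (arc_word n k) \<longleftrightarrow> k = n"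
  using n3 by (auto simp: arc_word_def)

lemma arc_pos_bounds: "k \<le> n \<Longrightarrow> 1 \<le> arc_pos n k \<and> arc_pos n k < n"
  using n3 by (auto simp: arc_pos_def)

lemma arc_pos_ends: "arc_pos n 0 = 1" "arc_pos n n = n - 1"
  using n3 by (auto simp: arc_pos_def)

lemma flip_cell_diagram:
  "flip (cell_diagram k) = Diagram (joined n gen_half (one_arc (arc_pos n k) (arc_word n k)) line_word) {#}"
  by (simp add: cell_diagram_def flip_joined)

lemma cell_no_both_arcs: "\<not> both_arcs (Diagram (joined n gen_half C w) M)"
  by (auto simp: both_arcs_def dest!: top_arc_word fate_one_undecorated)

text \<open>A letter of \<open>v\<close> outside \<open>deco\<close> lands on a line that is undecorated in the generating diagram, so one
undecorated line is lost.\<close>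

lemma inner_prod_new_decoration:
  assumes v: "LB \<in> set v \<Longrightarrow> s = 1" "RB \<in> set v \<Longrightarrow> s = n - 2" "\<not> set v \<subseteq> deco" and s: "s \<in> {1..n - 2}"
    and D: "stack (flip b2) b1 =
      Diagram (joined n gen_half gen_half (\<lambda>r. line_word r @ (if r = s then v else []) @ line_word r)) {#}"
  shows "inner_prod p n label b1 b2 = 0"
proof (rule inner_prod_zero[OF D])
  let ?w = "\<lambda>r. line_word r @ (if r = s then v else []) @ line_word r"
  show "left_right_diagram n (Diagram (joined n gen_half gen_half ?w) {#})"
    using v(1,2) by (intro left_right_cell) (auto simp: line_word_letters split: if_splits)
  have "line_word s = []"
  proof -
    from v(3) obtain b where "b \<in> set v" "b \<notin> deco" by blast
    moreover have "b = LB \<or> b = RB" using blob.exhaust by blast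
    ultimately have "b = LB \<and> s = 1 \<or> b = RB \<and> s = n - 2" using v(1,2) by blast
    then show ?thesis using \<open>b \<notin> deco\<close> ends_distinct by (auto simp: line_word_def)
  qed
  moreover have "v \<noteq> []" using v(3) by auto
  ultimately have "{r \<in> {1..n - 2}. ?w r = []} \<subset> {r \<in> {1..n - 2}. line_word r = []}"
    using s by auto
  then have "card {r \<in> {1..n - 2}. ?w r = []} < card {r \<in> {1..n - 2}. line_word r = []}"
    by (rule psubset_card_mono[rotated]) simp
  then show "int (undecorated_propagating (Diagram (joined n gen_half gen_half ?w) {#})) < \<bar>label\<bar>"
    unfolding undecorated_cell_gen[symmetric] unfolding cell_gen_eq undecorated_joined[OF half_gen half_gen] by simp
qed (rule cell_no_both_arcs)

lemma inner_prod_same_arc: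
  assumes k: "k \<le> n" "k' \<le> n" and j: "arc_pos n k = arc_pos n k'"
  shows "inner_prod p n label (cell_diagram k) (cell_diagram k') =
    (if LB \<in> deco then delta_L p else 1) * (if RB \<in> deco then delta_R p else 1) * gram_entry p n deco k k'"
proof -
  \<comment> \<open>The arcs form a loop and no word lands on a propagating line; the word \<open>[]\<close> on line \<open>0\<close> only matches the form of \<open>inner_prod_same_decoration\<close>.\<close>
  have st: "stack (flip (cell_diagram k')) (cell_diagram k) =
     Diagram (joined n gen_half gen_half (\<lambda>r. line_word r @ (if r = 0 then [] else []) @ line_word r))
       {#arc_word n k' @ arc_word n k#}"
    unfolding flip_cell_diagram unfolding cell_diagram_def j[symmetric]
    using stack_same_arc[OF half_gen half_gen, of "arc_pos n k" "arc_word n k'" line_word "arc_word n k" line_word] arc_pos_bounds[OF k(1)]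
    by simp
  have M: "LB \<notin> set u \<or> RB \<notin> set u" if "u \<in># {#arc_word n k' @ arc_word n k#}" for u
  proof -
    have "arc_pos n 0 \<noteq> arc_pos n n" using arc_pos_ends n3 by simp
    then have "\<not> (k = 0 \<and> k' = n)" "\<not> (k = n \<and> k' = 0)" using j by metis+
    then show ?thesis using that n3 by (auto simp: arc_word_letters)
  qed
  have "loop_weight p (arc_word n k' @ arc_word n k) = loop_weight p (arc_word n k @ arc_word n k')"
    using loop_weight_rotate[of p "length (arc_word n k')" "arc_word n k' @ arc_word n k"] by (simp add: rotate_append)
  then have g: "gram_entry p n deco k k' = loop_weight p (arc_word n k' @ arc_word n k)"
    using j by (simp add: gram_entry_def)
  show ?thesis
    using inner_prod_same_decoration[of "[]" 0, OF _ _ refl M st, of p] by (simp add: g)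
qed

lemma inner_prod_adjacent_arcs:
  assumes k: "k \<le> n" "k' \<le> n" and j: "arc_pos n k' = arc_pos n k + 1 \<or> arc_pos n k = arc_pos n k' + 1"
  shows "inner_prod p n label (cell_diagram k) (cell_diagram k') =
    (if LB \<in> deco then delta_L p else 1) * (if RB \<in> deco then delta_R p else 1) * gram_entry p n deco k k'"
proof -
  define v where "v = arc_word n k @ arc_word n k'"
  define s where "s = min (arc_pos n k) (arc_pos n k')"
  note b = arc_pos_bounds[OF k(1)] arc_pos_bounds[OF k(2)]
  have s: "s \<in> {1..n - 2}" using b j by (auto simp: s_def)
  have L: "LB \<in> set v \<Longrightarrow> s = 1" using b arc_pos_ends by (auto simp: v_def s_def arc_word_letters)
  have R: "RB \<in> set v \<Longrightarrow> s = n - 2" using b j arc_pos_ends by (auto simp: v_def s_def arc_word_letters)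
  have st: "stack (flip (cell_diagram k')) (cell_diagram k) =
     Diagram (joined n gen_half gen_half (\<lambda>r. line_word r @ (if r = s then v else []) @ line_word r)) {#}"
    using j
  proof
    assume j: "arc_pos n k' = arc_pos n k + 1"
    then show ?thesis
      unfolding flip_cell_diagram v_def s_def unfolding cell_diagram_def
      using stack_previous_arc[OF half_gen half_gen, of "arc_pos n k" "arc_word n k'" line_word "arc_word n k" line_word] b
      by (simp cong: if_cong)
  next
    assume j: "arc_pos n k = arc_pos n k' + 1"
    then show ?thesis
      unfolding flip_cell_diagram v_def s_def unfolding cell_diagram_def
      using stack_next_arc[OF half_gen half_gen, of "arc_pos n k'" "arc_word n k'" line_word "arc_word n k" line_word] b
      by (simp cong: if_cong)
  qed
  have g: "gram_entry p n deco k k' =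
     (if set v \<subseteq> deco then delta_L p ^ count_list v LB * delta_R p ^ count_list v RB else 0)"
    using j by (auto simp: gram_entry_def v_def Let_def)
  show ?thesis
  proof (cases "set v \<subseteq> deco")
    case True
    have "LB \<in> set v \<Longrightarrow> LB \<in> deco \<and> s = 1" "RB \<in> set v \<Longrightarrow> RB \<in> deco \<and> s = n - 2"
      using True L R by auto
    from inner_prod_same_decoration[OF this refl _ st, of p] True show ?thesis by (simp add: g)
  next
    case False
    from inner_prod_new_decoration[OF L R False s st, of p] False show ?thesis by (simp add: g)
  qed
qed

lemma planar_two_arcs:
  assumes k: "k \<le> n" and r: "1 \<le> r" "r + 2 < n"
    and L: "k = 0 \<Longrightarrow> r = 1" and R: "k = n \<Longrightarrow> r = n - 3"
  defines "\<alpha> \<equiv> line_word r @ arc_word n k @ line_word (r + 1)"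
  shows "planar_half n (n - 2 - 2) (refine gen_half (one_arc r \<alpha>))"
    and "LB \<in> set \<alpha> \<longleftrightarrow> LB \<in> deco \<and> r = 1 \<or> k = 0"
    and "RB \<in> set \<alpha> \<longleftrightarrow> RB \<in> deco \<and> r = n - 3 \<or> k = n"
proof -
  have lw: "line_word r = (if LB \<in> deco \<and> r = 1 then [LB] else [])"
    "line_word (r + 1) = (if RB \<in> deco \<and> r + 1 = n - 2 then [RB] else [])"
    using r by (auto simp: line_word_def)
  show L': "LB \<in> set \<alpha> \<longleftrightarrow> LB \<in> deco \<and> r = 1 \<or> k = 0"
    and R': "RB \<in> set \<alpha> \<longleftrightarrow> RB \<in> deco \<and> r = n - 3 \<or> k = n"
    using r by (auto simp: \<alpha>_def line_word_letters arc_word_letters)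
  obtain x y where "\<alpha> = replicate x LB @ replicate y RB"
    using sorted_word[OF arc_word_cases] unfolding \<alpha>_def lw by blast
  then have "planar_half (n - 2) (n - 2 - 2) (one_arc r \<alpha>)"
    using r L R L' R' by (intro planar_one_arc) auto
  then show "planar_half n (n - 2 - 2) (refine gen_half (one_arc r \<alpha>))"
    by (rule planar_refine[OF planar_gen_half]) (rule fate_one_undecorated)
qed

text \<open>Only \<open>n - 4\<close> propagating lines are left. This is too few unless the generating diagram carries both
blobs; then at least one of the remaining lines is decorated, because for \<open>n \<ge> 5\<close> a single arc cannot
join the first propagating line to the last.\<close>

lemma inner_prod_distant_arcs:
  assumes k: "k \<le> n" "k' \<le> n" and j: "arc_pos n k + 2 \<le> arc_pos n k' \<or> arc_pos n k' + 2 \<le> arc_pos n k"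
  shows "inner_prod p n label (cell_diagram k) (cell_diagram k') = 0"
proof -
  note b = arc_pos_bounds[OF k(1)] arc_pos_bounds[OF k(2)]
  define r where "r = (if arc_pos n k + 2 \<le> arc_pos n k' then arc_pos n k else arc_pos n k - 2)"
  define s where "s = (if arc_pos n k + 2 \<le> arc_pos n k' then arc_pos n k' - 2 else arc_pos n k')"
  define \<alpha> where "\<alpha> = line_word r @ arc_word n k @ line_word (r + 1)"
  define \<beta> where "\<beta> = line_word s @ arc_word n k' @ line_word (s + 1)"
  define w where "w = (\<lambda>u. line_word (place (one_arc r []) u) @ line_word (place (one_arc s []) u))"
  let ?D = "Diagram (joined n (refine gen_half (one_arc r \<alpha>)) (refine gen_half (one_arc s \<beta>)) w) {#}"
  have st: "stack (flip (cell_diagram k')) (cell_diagram k) = ?D"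
  proof (cases "arc_pos n k + 2 \<le> arc_pos n k'")
    case True
    then obtain d where "arc_pos n k' = arc_pos n k + 2 + d"
      using le_Suc_ex[of "arc_pos n k + 2" "arc_pos n k'"] by auto
    then show ?thesis
      unfolding flip_cell_diagram \<alpha>_def \<beta>_def w_def r_def s_def unfolding cell_diagram_def
      using stack_arc_far_left[OF half_gen half_gen, of "arc_pos n k" d "arc_word n k'" line_word "arc_word n k" line_word] b
      by simp
  next
    case False
    with j obtain d where "arc_pos n k = arc_pos n k' + 2 + d"
      using le_Suc_ex[of "arc_pos n k' + 2" "arc_pos n k"] by auto
    then show ?thesis
      unfolding flip_cell_diagram \<alpha>_def \<beta>_def w_def r_def s_def unfolding cell_diagram_def
      using stack_arc_far_right[OF half_gen half_gen, of "arc_pos n k'" d "arc_word n k'" line_word "arc_word n k" line_word] b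
      by simp
  qed
  have rs: "1 \<le> r" "r + 2 < n" "1 \<le> s" "s + 2 < n"
    using b j by (auto simp: r_def s_def)
  have pos_ends: "k = 0 \<Longrightarrow> arc_pos n k = 1" "k = n \<Longrightarrow> arc_pos n k = n - 1"
    "k' = 0 \<Longrightarrow> arc_pos n k' = 1" "k' = n \<Longrightarrow> arc_pos n k' = n - 1" using arc_pos_ends by auto
  have ends: "k = 0 \<Longrightarrow> r = 1" "k = n \<Longrightarrow> r = n - 3" "k' = 0 \<Longrightarrow> s = 1" "k' = n \<Longrightarrow> s = n - 3"
    using b j pos_ends unfolding r_def s_def by (simp_all split: if_splits)
  note A = planar_two_arcs[OF k(1) rs(1,2) ends(1,2), folded \<alpha>_def]
  note B = planar_two_arcs[OF k(2) rs(3,4) ends(3,4), folded \<beta>_def]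
  interpret P: planar_half n "n - 2 - 2" "refine gen_half (one_arc r \<alpha>)" by (rule A(1))
  interpret Q: planar_half n "n - 2 - 2" "refine gen_half (one_arc s \<beta>)" by (rule B(1))
  have n4: "4 \<le> n" using rs by simp
  have wL: "u = 1" if "u \<in> {1..n - 2 - 2}" "LB \<in> set (w u)" for u
    using that by (auto simp: w_def line_word_letters place_one_arc split: if_splits)
  have wR: "u = n - 2 - 2" if "u \<in> {1..n - 2 - 2}" "RB \<in> set (w u)" for u
    using that rs by (auto simp: w_def line_word_letters place_one_arc split: if_splits)
  show ?thesis
  proof (rule inner_prod_zero[OF st])
    show "left_right_diagram n ?D"
      by (rule left_right_joined[OF A(1) B(1) wL wR]) auto
    have "card {u \<in> {1..n - 2 - 2}. w u = []} < n - 2 - of_bool (LB \<in> deco) - of_bool (RB \<in> deco)"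
    proof (cases "LB \<in> deco \<and> RB \<in> deco")
      case False
      have "card {u \<in> {1..n - 2 - 2}. w u = []} \<le> card {1..n - 2 - 2}" by (intro card_mono) auto
      then show ?thesis using False n4 by auto
    next
      case True
      then have n5: "5 \<le> n" using size by simp
      have "\<exists>u \<in> {1..n - 2 - 2}. w u \<noteq> []"
      proof (cases "r = 1")
        case r1: True
        \<comment> \<open>The first line of the upper factor is closed, but its last line remains, as line \<open>n - 4\<close> of the product.\<close>
        have "w (n - 4) \<noteq> []" using True r1 n5 by (auto simp: w_def line_word_def place_one_arc)
        then show ?thesis using n5 by (intro bexI[of _ "n - 4"]) auto
      next
        case False
        then have "w 1 \<noteq> []" using True rs by (auto simp: w_def line_word_def place_one_arc)
        then show ?thesis using n5 by (intro bexI[of _ 1]) auto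
      qed
      then have "{u \<in> {1..n - 2 - 2}. w u = []} \<subset> {1..n - 2 - 2}" by auto
      then have "card {u \<in> {1..n - 2 - 2}. w u = []} < card {1..n - 2 - 2}" by (rule psubset_card_mono[rotated]) simp
      then show ?thesis using True n5 by simp
    qed
    then show "int (undecorated_propagating ?D) < \<bar>label\<bar>"
      unfolding undecorated_cell_gen[symmetric]
      unfolding cell_gen_eq undecorated_joined[OF half_gen half_gen] undecorated_lines
        undecorated_joined[OF P.half_diagram_axioms Q.half_diagram_axioms] by (simp only: of_nat_less_iff)
    show "\<not> both_arcs ?D"
    proof
      assume "both_arcs ?D"
      then obtain i v m i' v' m' where
        l: "(Top i, v, Top m) \<in> lines ?D" "{LB, RB} \<subseteq> set v"
        "(Bot i', v', Bot m') \<in> lines ?D" "{LB, RB} \<subseteq> set v'"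
        unfolding both_arcs_def by (elim conjE exE)
      have "fate (refine gen_half (one_arc r \<alpha>)) i = Arc v m"
        "fate (refine gen_half (one_arc s \<beta>)) i' = Arc v' m'"
        using top_arc_word[OF l(1)[unfolded diagram.sel]] bottom_arc_word[OF l(3)[unfolded diagram.sel]] by simp_all
      moreover have "set v \<subseteq> set a" if "fate (refine gen_half (one_arc x a)) i = Arc v m" for x a i v m
        using that by (auto simp: refine_def fate_one_arc split: fate.splits if_splits)
      ultimately have "{LB, RB} \<subseteq> set \<alpha>" "{LB, RB} \<subseteq> set \<beta>" using l(2,4) by (meson subset_trans)+
      then have L: "LB \<in> deco \<and> r = 1 \<or> k = 0" "LB \<in> deco \<and> s = 1 \<or> k' = 0"
        and R: "RB \<in> deco \<and> r = n - 3 \<or> k = n" "RB \<in> deco \<and> s = n - 3 \<or> k' = n"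
        using A(2,3) B(2,3) by auto
      have "arc_pos n k \<noteq> arc_pos n k'" using j by auto
      then have "\<not> (k = 0 \<and> k' = 0)" "\<not> (k = n \<and> k' = n)" by metis+
      then have "LB \<in> deco" "RB \<in> deco" using L R by auto
      then have "5 \<le> n" using size by simp
      moreover have "r = 1" "r = n - 3" using L(1) R(1) ends by auto
      ultimately show False by simp
    qed
  qed
qed

lemma inner_prod_cell:
  assumes "k \<le> n" "k' \<le> n"
  shows "inner_prod p n label (cell_diagram k) (cell_diagram k') =
    (if LB \<in> deco then delta_L p else 1) * (if RB \<in> deco then delta_R p else 1) * gram_entry p n deco k k'"
proof -
  consider "arc_pos n k = arc_pos n k'" | "arc_pos n k' = arc_pos n k + 1 \<or> arc_pos n k = arc_pos n k' + 1"
    | "arc_pos n k + 2 \<le> arc_pos n k' \<or> arc_pos n k' + 2 \<le> arc_pos n k" by linarith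
  then show ?thesis
  proof cases
    case 1
    then show ?thesis by (rule inner_prod_same_arc[OF assms])
  next
    case 2
    then show ?thesis by (rule inner_prod_adjacent_arcs[OF assms])
  next
    case 3
    then have "arc_pos n k \<noteq> arc_pos n k'" "\<not> (arc_pos n k' = arc_pos n k + 1 \<or> arc_pos n k = arc_pos n k' + 1)"
      by linarith+
    then have "gram_entry p n deco k k' = 0" unfolding gram_entry_def Let_def by simp
    then show ?thesis using inner_prod_distant_arcs[OF assms 3] by simp
  qed
qed

end

section \<open>Determinants\<close>

lemma sum_single: "finite S \<Longrightarrow> a \<in> S \<Longrightarrow> (\<And>x. x \<in> S \<Longrightarrow> x \<noteq> a \<Longrightarrow> g x = 0) \<Longrightarrow> sum g S = g a"
  for g :: "'a \<Rightarrow> 'b::comm_monoid_add"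
  by (metis (no_types, lifting) sum.remove sum.neutral Diff_iff singletonI add.right_neutral)

lemma det_row_almost_multiple:
  fixes f :: "nat \<Rightarrow> nat \<Rightarrow> 'k::field"
  assumes k: "k < m" "l < m" "k \<noteq> l" and c: "c < m"
    and row: "\<And>j. j < m \<Longrightarrow> j \<noteq> c \<Longrightarrow> f k j = x * f l j"
  shows "det (mat m m (\<lambda>(i, j). f i j)) = (- 1) ^ (k + c) * (f k c - x * f l c) *
    det (mat (m - 1) (m - 1) (\<lambda>(i, j). f (if i < k then i else Suc i) (if j < c then j else Suc j)))"
proof -
  let ?A = "mat m m (\<lambda>(i, j). f i j)"
  let ?B = "addrow (- x) k l ?A"
  have B: "?B \<in> carrier_mat m m" by simp
  have Bk: "?B $$ (k, j) = (if j = c then f k c - x * f l c else 0)" if "j < m" for j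
    using that k row[OF that] by auto
  have "det ?A = det ?B" using k by (simp add: det_addrow[of _ m])
  also have "\<dots> = (\<Sum>j<m. ?B $$ (k, j) * cofactor ?B k j)" using laplace_expansion_row[OF B k(1)] by simp
  also have "\<dots> = ?B $$ (k, c) * cofactor ?B k c" using c Bk by (intro sum_single) auto
  also have "\<dots> = (- 1) ^ (k + c) * (f k c - x * f l c) * det (mat_delete ?B k c)"
    using c Bk by (simp add: cofactor_def)
  also have "mat_delete ?B k c = mat (m - 1) (m - 1) (\<lambda>(i, j). f (if i < k then i else Suc i) (if j < c then j else Suc j))"
    using k by (intro eq_matI) (auto simp: mat_delete_def)
  finally show ?thesis .
qed

lemma det_tridiagonal:
  fixes f :: "nat \<Rightarrow> nat \<Rightarrow> 'k::field"
  assumes row: "\<And>j. j < m \<Longrightarrow> f (m + 1) j = 0" and column: "\<And>i. i < m \<Longrightarrow> f i (m + 1) = 0"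
  shows "det (mat (m + 2) (m + 2) (\<lambda>(i, j). f i j)) =
    f (m + 1) (m + 1) * det (mat (m + 1) (m + 1) (\<lambda>(i, j). f i j)) -
    f m (m + 1) * f (m + 1) m * det (mat m m (\<lambda>(i, j). f i j))"
proof -
  define A where "A = mat (m + 2) (m + 2) (\<lambda>(i, j). f i j)"
  define C where "C = mat_delete A (m + 1) m"
  have A: "A \<in> carrier_mat (m + 2) (m + 2)" by (simp add: A_def)
  have C: "C \<in> carrier_mat (m + 1) (m + 1)" by (rule carrier_matI) (simp_all add: A_def C_def mat_delete_def)
  have Cm: "C $$ (i, m) = (if i = m then f m (m + 1) else 0)" if "i < m + 1" for i
    using that column[of i] by (auto simp: A_def C_def mat_delete_def)
  have minors: "mat_delete C m m = mat m m (\<lambda>(i, j). f i j)"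
    "mat_delete A (m + 1) (m + 1) = mat (m + 1) (m + 1) (\<lambda>(i, j). f i j)"
    by (rule eq_matI; auto simp: A_def C_def mat_delete_def)+
  have "det C = (\<Sum>i<m + 1. C $$ (i, m) * cofactor C i m)" by (rule laplace_expansion_column[OF C]) simp
  also have "\<dots> = C $$ (m, m) * cofactor C m m" using Cm by (intro sum_single) auto
  also have "\<dots> = f m (m + 1) * det (mat_delete C m m)" using Cm[of m] by (simp add: cofactor_def)
  finally have detC: "det C = f m (m + 1) * det (mat m m (\<lambda>(i, j). f i j))" by (simp only: minors)
  have Arow: "A $$ (m + 1, j) = f (m + 1) j" if "j < m + 2" for j using that by (simp add: A_def)
  have "det A = (\<Sum>j<m + 2. A $$ (m + 1, j) * cofactor A (m + 1) j)" by (rule laplace_expansion_row[OF A]) simp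
  also have "\<dots> = (\<Sum>j<m + 2. f (m + 1) j * cofactor A (m + 1) j)" by (intro sum.cong refl) (simp only: Arow lessThan_iff)
  also have "\<dots> = f (m + 1) m * cofactor A (m + 1) m + f (m + 1) (m + 1) * cofactor A (m + 1) (m + 1)"
    using row by (simp add: lessThan_Suc)
  also have "cofactor A (m + 1) m = - det C" by (simp add: cofactor_def C_def)
  also have "cofactor A (m + 1) (m + 1) = det (mat (m + 1) (m + 1) (\<lambda>(i, j). f i j))"
    unfolding cofactor_def minors by simp
  finally show ?thesis unfolding detC A_def by simp
qed

text \<open>The leading minors of a tridiagonal matrix satisfy a three-term recurrence, so any solution of it
with the right initial values gives them.\<close>

lemma leading_minors:
  fixes f :: "nat \<Rightarrow> nat \<Rightarrow> 'k::field"
  assumes tri: "\<And>i j. i < N \<Longrightarrow> j < N \<Longrightarrow> i + 1 < j \<or> j + 1 < i \<Longrightarrow> f i j = 0"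
    and one_arc: "f 0 0 = X 1" and two: "2 \<le> N \<Longrightarrow> f 1 1 * X 1 - f 0 1 * f 1 0 = X 2"
    and step: "\<And>k. 2 \<le> k \<Longrightarrow> k < N \<Longrightarrow> f k k * X k - f (k - 1) k * f k (k - 1) * X (k - 1) = X (k + 1)"
    and k: "1 \<le> k" "k \<le> N"
  shows "det (mat k k (\<lambda>(i, j). f i j)) = X k"
  using k
proof (induction k rule: less_induct)
  case (less k)
  have d1: "det (mat 1 1 (\<lambda>(i, j). f i j)) = f 0 0" by (subst det_single[of _]) auto
  have d0: "det (mat 0 0 (\<lambda>(i, j). f i j)) = 1" by (rule det_dim_zero) simp
  consider "k = 1" | "k = 2" | m where "k = m + 2" "1 \<le> m"
    using less.prems(1) by (metis One_nat_def add.commute add_2_eq_Suc le_Suc_eq not_less_eq_eq numeral_2_eq_2 le_add_diff_inverse)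
  then show ?case
  proof cases
    case 1
    then show ?thesis using d1 one_arc by simp
  next
    case 2
    have "det (mat (0 + 2) (0 + 2) (\<lambda>(i, j). f i j)) =
      f (0 + 1) (0 + 1) * det (mat (0 + 1) (0 + 1) (\<lambda>(i, j). f i j)) -
      f 0 (0 + 1) * f (0 + 1) 0 * det (mat 0 0 (\<lambda>(i, j). f i j))" by (rule det_tridiagonal) auto
    then show ?thesis using 2 d1 d0 one_arc two less.prems by (simp add: numeral_2_eq_2)
  next
    case 3
    have "det (mat (m + 2) (m + 2) (\<lambda>(i, j). f i j)) =
      f (m + 1) (m + 1) * det (mat (m + 1) (m + 1) (\<lambda>(i, j). f i j)) -
      f m (m + 1) * f (m + 1) m * det (mat m m (\<lambda>(i, j). f i j))"
      using less.prems(2) 3 by (intro det_tridiagonal tri) auto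
    also have "\<dots> = f (m + 1) (m + 1) * X (m + 1) - f m (m + 1) * f (m + 1) m * X m"
      using less.IH[of "m + 1"] less.IH[of m] 3 less.prems by simp
    also have "\<dots> = X (m + 2)" using step[of "m + 1"] 3 less.prems by simp
    finally show ?thesis using 3 by simp
  qed
qed

section \<open>Quantum numbers\<close>

lemma diff_eq_minusD:
  fixes x y z :: "'a::ab_group_add"
  assumes "x - y = - z"
  shows "y - x = z"
proof -
  have "- (y - x) = - z" using assms by simp
  then show ?thesis by (simp only: neg_equal_iff_equal)
qed

context
  fixes q Q1 Q2 :: "'k::field"
  assumes q: "q \<noteq> 0" "q \<noteq> inverse q" and Q: "Q1 \<noteq> 0" "Q2 \<noteq> 0"
begin

text \<open>Writing \<open>[a] = (x - 1/x) / (q - 1/q)\<close> and \<open>[b] = (y - 1/y) / (q - 1/q)\<close>, the terms \<open>x/y\<close> and \<open>y/x\<close>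
occur in both products and cancel.\<close>

lemma quantum_product:
  "quantum q Q1 Q2 a b c * quantum q Q1 Q2 a' b' c' - quantum q Q1 Q2 a b (c + 1) * quantum q Q1 Q2 a' b' (c' + 1)
    = - quantum q Q1 Q2 (a + a') (b + b') (c + c' + 1)"
proof -
  define x where "x = Q1 powi a * Q2 powi b * q powi c"
  define y where "y = Q1 powi a' * Q2 powi b' * q powi c'"
  define h where "h = q - inverse q"
  have nz: "x \<noteq> 0" "y \<noteq> 0" "h \<noteq> 0" using q Q by (auto simp: x_def y_def h_def)
  have e: "Q1 powi a * Q2 powi b * q powi (c + 1) = x * q" "Q1 powi a' * Q2 powi b' * q powi (c' + 1) = y * q"
    "Q1 powi (a + a') * Q2 powi (b + b') * q powi (c + c' + 1) = x * y * q"
    using q Q by (simp_all add: x_def y_def power_int_add)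
  have "(x - inverse x) * (y - inverse y) - (x * q - inverse (x * q)) * (y * q - inverse (y * q)) =
      - (x * y * q - inverse (x * y * q)) * h"
  proof -
    have "(x - x') * (y - y') - (x * q - x' * q') * (y * q - y' * q') =
        - (x * y * q - x' * y' * q') * (q - q')" if "q * q' = 1" for x' y' q'
    proof -
      have "(x - x') * (y - y') - (x * q - x' * q') * (y * q - y' * q') - (- (x * y * q - x' * y' * q') * (q - q')) =
          (x * y' + x' * y - x * y - x' * y') * (q * q' - 1)"
        by (simp add: algebra_simps)
      also have "\<dots> = 0" by (simp only: that diff_self mult_zero_right)
      finally show ?thesis by (simp only: right_minus_eq)
    qed
    from this[of "inverse q" "inverse x" "inverse y"] show ?thesis
      using q(1) by (simp add: h_def mult.commute)
  qed
  moreover have "u / h * (v / h) - s / h * (t / h) = - (w / h)" if "u * v - s * t = - w * h" for u v s t w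
  proof -
    have "u / h * (v / h) - s / h * (t / h) = (u * v - s * t) / (h * h)" by (simp add: diff_divide_distrib)
    also have "\<dots> = - (w / h)" unfolding that using nz(3) by simp
    finally show ?thesis .
  qed
  ultimately have "(x - inverse x) / h * ((y - inverse y) / h) - (x * q - inverse (x * q)) / h * ((y * q - inverse (y * q)) / h) =
      - ((x * y * q - inverse (x * y * q)) / h)"
    by blast
  then show ?thesis
    unfolding quantum_def Let_def e x_def[symmetric] y_def[symmetric] h_def[symmetric] .
qed

lemma quantum_minus: "quantum q Q1 Q2 (- a) (- b) (- c) = - quantum q Q1 Q2 a b c"
  by (simp add: quantum_def Let_def power_int_minus minus_divide_left)

lemma quantum_product':
  "quantum q Q1 Q2 a b c * quantum q Q1 Q2 a' b' c' - quantum q Q1 Q2 a b (c + 1) * quantum q Q1 Q2 a' b' (c' - 1)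
    = quantum q Q1 Q2 (a - a') (b - b') (c - c' + 1)"
proof -
  have n: "quantum q Q1 Q2 (- a') (- b') (- c' + 1) = - quantum q Q1 Q2 a' b' (c' - 1)"
    using quantum_minus[of a' b' "c' - 1"] by simp
  have r: "a + - a' = a - a'" "b + - b' = b - b'" "c + - c' + 1 = c - c' + 1" by simp_all
  have "- (quantum q Q1 Q2 a b c * quantum q Q1 Q2 a' b' c') - - (quantum q Q1 Q2 a b (c + 1) * quantum q Q1 Q2 a' b' (c' - 1)) =
      - quantum q Q1 Q2 (a - a') (b - b') (c - c' + 1)"
    using quantum_product[of a b c "- a'" "- b'" "- c'"] unfolding n quantum_minus r mult_minus_right .
  then show ?thesis by (metis diff_eq_minusD minus_diff_minus)
qed

lemma quantum_one: "quantum q Q1 Q2 0 0 1 = 1"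
  using q by (simp add: quantum_def)

lemma quantum_recurrence:
  "quantum q Q1 Q2 0 0 2 * quantum q Q1 Q2 a b c - quantum q Q1 Q2 a b (c - 1) = quantum q Q1 Q2 a b (c + 1)"
proof (rule diff_eq_minusD)
  show "quantum q Q1 Q2 a b (c - 1) - quantum q Q1 Q2 0 0 2 * quantum q Q1 Q2 a b c = - quantum q Q1 Q2 a b (c + 1)"
    using quantum_product[of 0 0 1 a b "c - 1"] by (simp add: quantum_one add.commute)
qed

end

section \<open>The Gram matrix\<close>

context cell
begin

lemma gram_entry_symmetric: "gram_entry p n deco i j = gram_entry p n deco j i"
proof -
  have "loop_weight p (arc_word n i @ arc_word n j) = loop_weight p (arc_word n j @ arc_word n i)"
    using loop_weight_rotate[of p "length (arc_word n i)" "arc_word n i @ arc_word n j"] by (simp add: rotate_append)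
  then show ?thesis by (auto simp: gram_entry_def Let_def mult.commute add.commute)
qed

lemma loop_weight_simps:
  "loop_weight p [] = delta p" "loop_weight p [LB] = kappa_L p" "loop_weight p [RB] = kappa_R p"
  "loop_weight p [LB, LB] = delta_L p * kappa_L p" "loop_weight p [RB, RB] = delta_R p * kappa_R p"
  by (simp_all add: loop_weight_def line_weight_def)

text \<open>The two corners of the Gram matrix. Two decorated arcs form a loop with two blobs, a decorated and an
undecorated arc at the same place a loop with one blob, and next to each other they put the blob on
a propagating line.\<close>

lemma gram_left:
  "gram_entry p n deco 0 0 = delta_L p * kappa_L p"
  "gram_entry p n deco 0 1 = kappa_L p"
  "gram_entry p n deco 0 2 = (if LB \<in> deco then delta_L p else 0)"
  using n3 by (simp_all add: gram_entry_def arc_pos_def arc_word_def loop_weight_simps)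

lemma gram_right:
  "gram_entry p n deco n n = delta_R p * kappa_R p"
  "gram_entry p n deco (n - 1) n = kappa_R p"
  "gram_entry p n deco (n - 2) n = (if RB \<in> deco then delta_R p else 0)"
  using n3 by (auto simp: gram_entry_def Let_def arc_pos_def arc_word_def loop_weight_simps)

lemma gram_middle:
  assumes "1 \<le> i" "i < n"
  shows "gram_entry p n deco i i = delta p"
    and "i + 1 < n \<Longrightarrow> gram_entry p n deco i (i + 1) = 1"
  using assms by (simp_all add: gram_entry_def arc_pos_def arc_word_def loop_weight_simps)

lemma gram_zero:
  assumes "i + 1 < j" "j \<le> n" and "i = 0 \<Longrightarrow> j = 2 \<Longrightarrow> LB \<notin> deco" "j = n \<Longrightarrow> i = n - 2 \<Longrightarrow> RB \<notin> deco"
  shows "gram_entry p n deco i j = 0"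
proof -
  have "\<not> (arc_pos n i = arc_pos n j)" using assms n3 by (auto simp: arc_pos_def)
  moreover have "\<not> set (arc_word n i @ arc_word n j) \<subseteq> deco"
    if "arc_pos n j = arc_pos n i + 1 \<or> arc_pos n i = arc_pos n j + 1"
  proof -
    from that assms(1,2) n3 have "i = 0 \<and> j = 2 \<or> j = n \<and> i = n - 2 \<or> i = 0 \<and> j = n \<and> n = 3"
      by (auto simp: arc_pos_def split: if_splits)
    then show ?thesis using assms(3,4) size n3 by (auto simp: arc_word_def)
  qed
  ultimately have "arc_pos n i \<noteq> arc_pos n j"
    "\<not> ((arc_pos n j = arc_pos n i + 1 \<or> arc_pos n i = arc_pos n j + 1) \<and> set (arc_word n i @ arc_word n j) \<subseteq> deco)"
    by blast+
  then show ?thesis unfolding gram_entry_def Let_def by (simp only: if_False)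
qed

lemma gram_det_label:
  "gram_det p n label = ((if LB \<in> deco then delta_L p else 1) * (if RB \<in> deco then delta_R p else 1)) ^ (n + 1) *
     det (mat (n + 1) (n + 1) (\<lambda>(i, j). gram_entry p n deco i j))"
proof -
  let ?c = "(if LB \<in> deco then delta_L p else 1) * (if RB \<in> deco then delta_R p else 1)"
  have "mat (n + 1) (n + 1) (\<lambda>(i, j). inner_prod p n label (cell_basis n label ! i) (cell_basis n label ! j)) =
     ?c \<cdot>\<^sub>m mat (n + 1) (n + 1) (\<lambda>(i, j). gram_entry p n deco i j)"
    by (intro eq_matI) (simp_all add: cell_basis_label inner_prod_cell)
  then show ?thesis by (simp add: gram_det_def)
qed

text \<open>Element \<open>0\<close> is \<open>e\<close> times element \<open>1\<close>, and \<open>e\<close> is self-adjoint. For \<open>j \<noteq> 1\<close> the line at vertex \<open>1\<close> of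
element \<open>j\<close> already carries an L, so \<open>e\<close> multiplies this element by \<open>\<delta>\<^sub>L\<close>.\<close>

lemma gram_row_left:
  assumes "LB \<in> deco" "j \<le> n" "j \<noteq> 1"
  shows "gram_entry p n deco 0 j = delta_L p * gram_entry p n deco 1 j"
proof -
  have n4: "4 \<le> n" using size assms(1) by simp
  consider "j = 0" | "j = 2" | "3 \<le> j" using assms(3) by linarith
  then show ?thesis
  proof cases
    case 1
    then show ?thesis using gram_left(1,2)[of p] gram_entry_symmetric[of p 1 0] by simp
  next
    case 2
    then show ?thesis using gram_left(3)[of p] gram_middle(2)[of 1 p] assms(1) n4 by (simp add: numeral_2_eq_2)
  next
    case 3
    then show ?thesis using gram_zero[of 0 j p] gram_zero[of 1 j p] assms(2) n4 by simp
  qed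
qed

text \<open>The mirror image of \<open>gram_row_left\<close>, with \<open>f\<close> in place of \<open>e\<close>.\<close>

lemma gram_row_right:
  assumes "RB \<in> deco" "j \<le> n" "j \<noteq> n - 1"
  shows "gram_entry p n deco n j = delta_R p * gram_entry p n deco (n - 1) j"
proof -
  have n4: "4 \<le> n" using size assms(1) by simp
  consider "j = n" | "j = n - 2" | "j + 2 < n" using assms(2,3) by linarith
  then show ?thesis
  proof cases
    case 1
    then show ?thesis using gram_right(1,2)[of p] by simp
  next
    case 2
    have "Suc (n - 2) = n - 1" using n4 by simp
    then show ?thesis
      using 2 gram_right(3)[of p] gram_middle(2)[of "n - 2" p] assms(1) n4 gram_entry_symmetric[of p n "n - 2"]
        gram_entry_symmetric[of p "n - 1" "n - 2"] by simp
  next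
    case 3
    then show ?thesis using gram_zero[of j n p] gram_zero[of j "n - 1" p] n4
        gram_entry_symmetric[of p n j] gram_entry_symmetric[of p "n - 1" j] by simp
  qed
qed

end

section \<open>The four determinants\<close>

text \<open>The last step of the expansion is kept separate because the last row and column involve the other
corner of the Gram matrix.\<close>

lemma det_bordered:
  fixes f :: "nat \<Rightarrow> nat \<Rightarrow> 'k::field"
  assumes minors: "\<And>k. 1 \<le> k \<Longrightarrow> k \<le> N \<Longrightarrow> det (mat k k (\<lambda>(i, j). f i j)) = X k"
    and N: "2 \<le> N" and zero: "\<And>i. i + 1 < N \<Longrightarrow> f N i = 0" "\<And>i. i + 1 < N \<Longrightarrow> f i N = 0"
  shows "det (mat (N + 1) (N + 1) (\<lambda>(i, j). f i j)) = f N N * X N - f (N - 1) N * f N (N - 1) * X (N - 1)"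
proof -
  obtain m where m: "N = m + 1" "1 \<le> m" using N by (intro that[of "N - 1"]) auto
  have "det (mat (m + 2) (m + 2) (\<lambda>(i, j). f i j)) =
    f (m + 1) (m + 1) * det (mat (m + 1) (m + 1) (\<lambda>(i, j). f i j)) -
    f m (m + 1) * f (m + 1) m * det (mat m m (\<lambda>(i, j). f i j))"
    using zero m by (intro det_tridiagonal) auto
  then show ?thesis using minors[of m] minors[of N] m by simp
qed

locale quantum_cell = cell n deco
  for n :: nat and deco :: "blob set" +
  fixes q Q1 Q2 \<kappa> :: "'k::field"
  assumes q: "q \<noteq> 0" "q \<noteq> inverse q" and Q: "Q1 \<noteq> 0" "Q2 \<noteq> 0"
begin

definition "p = quantum_parameters q Q1 Q2 \<kappa>"

abbreviation qn :: "int \<Rightarrow> int \<Rightarrow> int \<Rightarrow> 'k" where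
  "qn \<equiv> quantum q Q1 Q2"

abbreviation g :: "nat \<Rightarrow> nat \<Rightarrow> 'k" where
  "g \<equiv> gram_entry p n deco"

lemma p_simps [simp]: "delta p = qn 0 0 2" "delta_L p = qn 1 0 0" "delta_R p = qn 0 1 0"
  "kappa_L p = qn 1 0 1" "kappa_R p = qn 0 1 1"
  by (simp_all add: p_def quantum_parameters_def)

lemmas recurrence = quantum_recurrence[OF q Q]

lemma g_tridiagonal:
  assumes "i < n" "j < n" "i + 1 < j \<or> j + 1 < i" and "LB \<in> deco \<Longrightarrow> i \<noteq> 0 \<and> j \<noteq> 0"
  shows "g i j = 0"
proof (cases "i + 1 < j")
  case True
  then show ?thesis using assms by (intro gram_zero) auto
next
  case False
  then have "g j i = 0" using assms by (intro gram_zero) auto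
  then show ?thesis using gram_entry_symmetric[of p i j] by simp
qed

lemma g_next:
  assumes "1 \<le> k" "k + 1 < n"
  shows "g k (k + 1) = 1" "g (k + 1) k = 1"
  using gram_middle(2)[of k p] assms gram_entry_symmetric[of p "k + 1" k] by simp_all

text \<open>The decorated arc makes the first two minors \<open>[w\<^sub>1 + 1] [w\<^sub>1]\<close> and \<open>[w\<^sub>1 + 1] [w\<^sub>1 - 1]\<close>, and the
recurrence continues downwards.\<close>

lemma minors_undecorated:
  assumes L: "LB \<notin> deco" and N: "N \<le> n" and f: "\<And>i j. i < N \<Longrightarrow> j < N \<Longrightarrow> f i j = g i j"
    and k: "1 \<le> k" "k \<le> N"
  shows "det (mat k k (\<lambda>(i, j). f i j)) = qn 1 0 1 * qn 1 0 (1 - int k)"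
proof (rule leading_minors[where X = "\<lambda>k. qn 1 0 1 * qn 1 0 (1 - int k)" and N = N])
  show "f i j = 0" if "i < N" "j < N" "i + 1 < j \<or> j + 1 < i" for i j
    using g_tridiagonal[of i j] that N L f[OF that(1,2)] by simp
  show "f 0 0 = qn 1 0 1 * qn 1 0 (1 - int 1)" using f[of 0 0] k gram_left(1)[of p] by simp
  show "f 1 1 * (qn 1 0 1 * qn 1 0 (1 - int 1)) - f 0 1 * f 1 0 = qn 1 0 1 * qn 1 0 (1 - int 2)" if "2 \<le> N"
  proof -
    have "f 0 1 = qn 1 0 1" "f 1 0 = qn 1 0 1" "f 1 1 = qn 0 0 2"
      using f[of 0 1] f[of 1 0] f[of 1 1] that gram_left(2)[of p] gram_entry_symmetric[of p 0 1] gram_middle(1)[of 1 p] n3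
      by simp_all
    then have "f 1 1 * (qn 1 0 1 * qn 1 0 (1 - int 1)) - f 0 1 * f 1 0 = qn 1 0 1 * (qn 0 0 2 * qn 1 0 0 - qn 1 0 1)"
      by (simp add: algebra_simps)
    also have "qn 0 0 2 * qn 1 0 0 - qn 1 0 1 = qn 1 0 (- 1)"
      using recurrence[of 1 0 0] by (simp add: algebra_simps)
    finally show ?thesis by simp
  qed
  fix k assume h: "2 \<le> k" "k < N"
  have "g (k - 1) k = 1" "g k (k - 1) = 1" using g_next[of "k - 1"] h N by simp_all
  then have e: "f (k - 1) k = 1" "f k (k - 1) = 1" "f k k = qn 0 0 2"
    using f[of "k - 1" k] f[of k "k - 1"] f[of k k] gram_middle(1)[of k p] h N by simp_all
  have "f k k * (qn 1 0 1 * qn 1 0 (1 - int k)) - f (k - 1) k * f k (k - 1) * (qn 1 0 1 * qn 1 0 (1 - int (k - 1))) =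
      qn 1 0 1 * (qn 0 0 2 * qn 1 0 (1 - int k) - qn 1 0 (1 - int k + 1))"
    using e h by (simp add: algebra_simps of_nat_diff)
  also have "qn 0 0 2 * qn 1 0 (1 - int k) - qn 1 0 (1 - int k + 1) = qn 1 0 (1 - int k - 1)"
    using recurrence[of 1 0 "1 - int k"] by (simp add: algebra_simps)
  finally show "f k k * (qn 1 0 1 * qn 1 0 (1 - int k)) - f (k - 1) k * f k (k - 1) * (qn 1 0 1 * qn 1 0 (1 - int (k - 1))) =
      qn 1 0 1 * qn 1 0 (1 - int (k + 1))" by (simp add: algebra_simps)
qed (use k in auto)

text \<open>Up to size \<open>N\<close>, \<open>f\<close> is the Gram matrix without row \<open>0\<close> and column \<open>1\<close>. Its first two minors are \<open>[w\<^sub>1 + 1]\<close> and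
\<open>[w\<^sub>1 + 2]\<close>, so here the recurrence goes upwards.\<close>

lemma minors_decorated:
  assumes L: "LB \<in> deco" and N: "N < n"
    and f: "\<And>i j. i < N \<Longrightarrow> j < N \<Longrightarrow> f i j = g (Suc i) (if j < 1 then j else Suc j)"
    and k: "1 \<le> k" "k \<le> N"
  shows "det (mat k k (\<lambda>(i, j). f i j)) = qn 1 0 (int k)"
proof (rule leading_minors[where X = "\<lambda>k. qn 1 0 (int k)" and N = N])
  have n4: "4 \<le> n" using size L by simp
  show "f i j = 0" if "i < N" "j < N" "i + 1 < j \<or> j + 1 < i" for i j
  proof (cases j)
    case 0
    then have "f i j = g 0 (Suc i)" using f[OF that(1,2)] gram_entry_symmetric[of p "Suc i" 0] by simp
    then show ?thesis using gram_zero[of 0 "Suc i" p] that 0 N n4 by simp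
  next
    case (Suc j')
    then show ?thesis using f[OF that(1,2)] g_tridiagonal[of "Suc i" "Suc j"] that N by auto
  qed
  show "f 0 0 = qn 1 0 (int 1)" using f[of 0 0] k gram_left(2)[of p] gram_entry_symmetric[of p 1 0] by simp
  show "f 1 1 * qn 1 0 (int 1) - f 0 1 * f 1 0 = qn 1 0 (int 2)" if "2 \<le> N"
  proof -
    have "f 0 1 = 1" "f 1 0 = qn 1 0 0" "f 1 1 = qn 0 0 2"
      using f[of 0 1] f[of 1 0] f[of 1 1] that gram_left(3)[of p] gram_entry_symmetric[of p 2 0]
        gram_middle(1)[of 2 p] g_next(1)[of 1] n4 L by (simp_all add: numeral_2_eq_2)
    then show ?thesis using recurrence[of 1 0 1] by simp
  qed
  fix k assume h: "2 \<le> k" "k < N"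
  have "g k (Suc k) = 1" "g (Suc k) k = 1" using g_next[of k] h N by simp_all
  then have e: "f (k - 1) k = 1" "f k (k - 1) = 1" "f k k = qn 0 0 2"
    using f[of "k - 1" k] f[of k "k - 1"] f[of k k] gram_middle(1)[of "Suc k" p] h N by auto
  then show "f k k * qn 1 0 (int k) - f (k - 1) k * f k (k - 1) * qn 1 0 (int (k - 1)) = qn 1 0 (int (k + 1))"
    using recurrence[of 1 0 "int k"] h by (simp add: of_nat_diff algebra_simps)
qed (use k in auto)

lemma det_undecorated:
  assumes d: "deco = {}"
  shows "det (mat (n + 1) (n + 1) (\<lambda>(i, j). g i j)) = - (qn 1 0 1 * qn 0 1 1 * qn 1 1 (- int n + 2))"
proof -
  have "det (mat (n + 1) (n + 1) (\<lambda>(i, j). g i j)) =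
      g n n * (qn 1 0 1 * qn 1 0 (1 - int n)) - g (n - 1) n * g n (n - 1) * (qn 1 0 1 * qn 1 0 (1 - int (n - 1)))"
  proof (rule det_bordered)
    show "det (mat k k (\<lambda>(i, j). g i j)) = qn 1 0 1 * qn 1 0 (1 - int k)" if "1 \<le> k" "k \<le> n" for k
      using that d by (intro minors_undecorated) auto
    show "g i n = 0" if "i + 1 < n" for i using gram_zero[of i n p] that d by simp
    then show "g n i = 0" if "i + 1 < n" for i using that gram_entry_symmetric[of p n i] by simp
  qed (use n3 in simp)
  also have "\<dots> = qn 1 0 1 * qn 0 1 1 * (qn 0 1 0 * qn 1 0 (1 - int n) - qn 0 1 (0 + 1) * qn 1 0 (1 - int n + 1))"
    using n3 gram_right[of p] gram_entry_symmetric[of p n "n - 1"] by (simp add: of_nat_diff algebra_simps)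
  also have "\<dots> = - (qn 1 0 1 * qn 0 1 1 * qn 1 1 (- int n + 2))"
    unfolding quantum_product[OF q Q] by (simp add: algebra_simps)
  finally show ?thesis .
qed

text \<open>Removing row \<open>n\<close> and column \<open>n - 1\<close> leaves column \<open>n\<close> as the last column, which contains \<open>\<delta>\<^sub>R\<close> and
\<open>\<kappa>\<^sub>R\<close> in its last two entries.\<close>

lemma det_right:
  assumes d: "deco = {RB}"
  shows "det (mat (n + 1) (n + 1) (\<lambda>(i, j). g i j)) = - (qn 0 1 (- 1) * qn 1 0 1 * qn (- 1) 1 (int n - 2))"
proof -
  define f where "f i j = g (if i < n then i else Suc i) (if j < n - 1 then j else Suc j)" for i j
  have n4: "4 \<le> n" using size d by simp
  have "det (mat (n + 1) (n + 1) (\<lambda>(i, j). g i j)) = (- 1) ^ (n + (n - 1)) * (g n (n - 1) - qn 0 1 0 * g (n - 1) (n - 1)) *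
      det (mat (n + 1 - 1) (n + 1 - 1) (\<lambda>(i, j). f i j))"
    unfolding f_def using n4 gram_row_right[of _ p] d by (intro det_row_almost_multiple) auto
  also have "(- 1) ^ (n + (n - 1)) = (- 1 :: 'k)" using n4 by (cases n) simp_all
  also have "g n (n - 1) - qn 0 1 0 * g (n - 1) (n - 1) = - qn 0 1 (- 1)"
    using recurrence[of 0 1 0] gram_right(2)[of p] gram_entry_symmetric[of p n "n - 1"] gram_middle(1)[of "n - 1" p] n4
    by (simp add: algebra_simps)
  also have "det (mat (n + 1 - 1) (n + 1 - 1) (\<lambda>(i, j). f i j)) = det (mat (n - 1 + 1) (n - 1 + 1) (\<lambda>(i, j). f i j))"
    using n4 by simp
  also have "\<dots> = f (n - 1) (n - 1) * (qn 1 0 1 * qn 1 0 (1 - int (n - 1))) -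
      f (n - 1 - 1) (n - 1) * f (n - 1) (n - 1 - 1) * (qn 1 0 1 * qn 1 0 (1 - int (n - 1 - 1)))"
  proof (rule det_bordered)
    show "det (mat k k (\<lambda>(i, j). f i j)) = qn 1 0 1 * qn 1 0 (1 - int k)" if "1 \<le> k" "k \<le> n - 1" for k
      using that d by (intro minors_undecorated[of "n - 1"]) (auto simp: f_def)
    show "f i (n - 1) = 0" if "i + 1 < n - 1" for i using gram_zero[of i n p] that d by (simp add: f_def)
    show "f (n - 1) i = 0" if "i + 1 < n - 1" for i using g_tridiagonal[of "n - 1" i] that d by (simp add: f_def)
  qed (use n4 in simp)
  also have "\<dots> = - (qn 1 0 1 * (qn 0 1 0 * qn 1 0 (3 - int n) - qn 0 1 (0 + 1) * qn 1 0 (3 - int n - 1)))"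
  proof -
    have "g (n - 1) (n - 2) = 1" using g_next(2)[of "n - 2"] n4 by (simp add: Suc_diff_Suc numeral_2_eq_2)
    then have "f (n - 1) (n - 1) = qn 0 1 1" "f (n - 1 - 1) (n - 1) = qn 0 1 0" "f (n - 1) (n - 1 - 1) = 1"
      using gram_right[of p] d n4 by (simp_all add: f_def numeral_2_eq_2)
    then show ?thesis using n4 by (simp add: of_nat_diff algebra_simps)
  qed
  also have "qn 0 1 0 * qn 1 0 (3 - int n) - qn 0 1 (0 + 1) * qn 1 0 (3 - int n - 1) = qn (- 1) 1 (int n - 2)"
    unfolding quantum_product'[OF q Q] by (simp add: algebra_simps)
  finally show ?thesis by (simp add: algebra_simps)
qed

lemma det_left_row:
  assumes L: "LB \<in> deco"
  shows "det (mat (n + 1) (n + 1) (\<lambda>(i, j). g i j)) = qn 1 0 (- 1) *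
    det (mat n n (\<lambda>(i, j). g (Suc i) (if j < 1 then j else Suc j)))"
proof -
  have n4: "4 \<le> n" using size L by simp
  have "det (mat (n + 1) (n + 1) (\<lambda>(i, j). g i j)) = (- 1) ^ (0 + 1) * (g 0 1 - qn 1 0 0 * g 1 1) *
      det (mat (n + 1 - 1) (n + 1 - 1) (\<lambda>(i, j). g (if i < 0 then i else Suc i) (if j < 1 then j else Suc j)))"
    using n4 gram_row_left[OF L, of _ p] by (intro det_row_almost_multiple) auto
  also have "g 0 1 - qn 1 0 0 * g 1 1 = - qn 1 0 (- 1)"
    using recurrence[of 1 0 0] gram_left(2)[of p] gram_middle(1)[of 1 p] n4
    by (simp add: algebra_simps)
  finally show ?thesis by simp
qed

lemma det_left:
  assumes d: "deco = {LB}"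
  shows "det (mat (n + 1) (n + 1) (\<lambda>(i, j). g i j)) = - (qn 1 0 (- 1) * qn 0 1 1 * qn 1 (- 1) (int n - 2))"
proof -
  define f where "f i j = g (Suc i) (if j < 1 then j else Suc j)" for i j
  have n4: "4 \<le> n" using size d by simp
  have "det (mat n n (\<lambda>(i, j). f i j)) = det (mat (n - 1 + 1) (n - 1 + 1) (\<lambda>(i, j). f i j))"
    using n4 by simp
  also have "\<dots> = f (n - 1) (n - 1) * qn 1 0 (int (n - 1)) - f (n - 1 - 1) (n - 1) * f (n - 1) (n - 1 - 1) * qn 1 0 (int (n - 1 - 1))"
  proof (rule det_bordered)
    show "det (mat k k (\<lambda>(i, j). f i j)) = qn 1 0 (int k)" if "1 \<le> k" "k \<le> n - 1" for k
      using that d n4 by (intro minors_decorated[of "n - 1"]) (auto simp: f_def)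
    have z: "g i n = 0" if "i + 1 < n" "i \<noteq> 0 \<or> n \<noteq> 2" for i using gram_zero[of i n p] that d by auto
    show "f i (n - 1) = 0" if "i + 1 < n - 1" for i using z[of "Suc i"] that n4 by (simp add: f_def)
    show "f (n - 1) i = 0" if "i + 1 < n - 1" for i
    proof -
      have "g i n = 0" "g (Suc i) n = 0" using z[of i] z[of "Suc i"] that n4 by auto
      then show ?thesis using n4 gram_entry_symmetric[of p n] by (auto simp: f_def)
    qed
  qed (use n4 in simp)
  also have "\<dots> = qn 0 1 1 * (qn 0 1 0 * qn 1 0 (int n - 1) - qn 0 1 (0 + 1) * qn 1 0 (int n - 1 - 1))"
  proof -
    have "f (n - 1) (n - 1) = qn 0 1 0 * qn 0 1 1" "f (n - 1 - 1) (n - 1) = qn 0 1 1" "f (n - 1) (n - 1 - 1) = qn 0 1 1"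
      using gram_right[of p] gram_entry_symmetric[of p n "n - 1"] n4 by (simp_all add: f_def Suc_diff_Suc numeral_2_eq_2)
    then show ?thesis using n4 by (simp add: of_nat_diff algebra_simps)
  qed
  also have "qn 0 1 0 * qn 1 0 (int n - 1) - qn 0 1 (0 + 1) * qn 1 0 (int n - 1 - 1) = - qn 1 (- 1) (int n - 2)"
    unfolding quantum_product'[OF q Q] using quantum_minus[OF q Q, of 1 "- 1" "int n - 2"] by simp
  finally have "det (mat n n (\<lambda>(i, j). f i j)) = qn 0 1 1 * (- qn 1 (- 1) (int n - 2))" .
  moreover have "det (mat (n + 1) (n + 1) (\<lambda>(i, j). g i j)) = qn 1 0 (- 1) * det (mat n n (\<lambda>(i, j). f i j))"
    unfolding f_def using d by (intro det_left_row) simp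
  ultimately show ?thesis by (simp only:) (simp add: mult_ac)
qed

text \<open>Both reductions are applied in turn: \<open>f\<close> arises from the Gram matrix by the one on the left, \<open>f'\<close> from
\<open>f\<close> by the one on the right.\<close>

lemma det_both:
  assumes d: "deco = {LB, RB}"
  shows "det (mat (n + 1) (n + 1) (\<lambda>(i, j). g i j)) = qn 1 0 (- 1) * qn 0 1 (- 1) * qn 1 1 (int n - 2)"
proof -
  define f where "f i j = g (Suc i) (if j < 1 then j else Suc j)" for i j
  define f' where "f' i j = f (if i < n - 1 then i else Suc i) (if j < n - 2 then j else Suc j)" for i j
  have n5: "5 \<le> n" using size d by simp
  have corner: "f (n - 1) (n - 2) = qn 0 1 1" "f (n - 2) (n - 2) = qn 0 0 2"
    using gram_right(2)[of p] gram_entry_symmetric[of p n "n - 1"] gram_middle(1)[of "n - 1" p] n5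
    by (simp_all add: f_def Suc_diff_Suc numeral_2_eq_2)
  have "det (mat n n (\<lambda>(i, j). f i j)) = (- 1) ^ (n - 1 + (n - 2)) * (f (n - 1) (n - 2) - qn 0 1 0 * f (n - 2) (n - 2)) *
      det (mat (n - 1) (n - 1) (\<lambda>(i, j). f' i j))"
    unfolding f'_def
  proof (rule det_row_almost_multiple)
    fix j assume j: "j < n" "j \<noteq> n - 2"
    have "Suc (n - 1) = n" "Suc (n - 2) = n - 1" using n5 by simp_all
    then show "f (n - 1) j = qn 0 1 0 * f (n - 2) j"
      using gram_row_right[of "if j < 1 then j else Suc j" p] j d n5 by (simp add: f_def split: if_splits)
  qed (use n5 in auto)
  also have "(- 1) ^ (n - 1 + (n - 2)) = (- 1 :: 'k)"
  proof -
    have "n - 1 + (n - 2) = 2 * (n - 2) + 1" using n5 by simp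
    then show ?thesis by simp
  qed
  also have "f (n - 1) (n - 2) - qn 0 1 0 * f (n - 2) (n - 2) = - qn 0 1 (- 1)"
    unfolding corner using recurrence[of 0 1 0] by (simp add: algebra_simps)
  also have "det (mat (n - 1) (n - 1) (\<lambda>(i, j). f' i j)) = det (mat (n - 2 + 1) (n - 2 + 1) (\<lambda>(i, j). f' i j))"
  proof -
    have "n - 1 = n - 2 + 1" using n5 by simp
    then show ?thesis by simp
  qed
  also have "\<dots> = f' (n - 2) (n - 2) * qn 1 0 (int (n - 2)) - f' (n - 2 - 1) (n - 2) * f' (n - 2) (n - 2 - 1) * qn 1 0 (int (n - 2 - 1))"
  proof (rule det_bordered)
    show "det (mat k k (\<lambda>(i, j). f' i j)) = qn 1 0 (int k)" if "1 \<le> k" "k \<le> n - 2" for k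
      using that d n5 by (intro minors_decorated[of "n - 2"]) (auto simp: f_def f'_def)
    have s: "Suc (Suc (n - 2)) = n" "Suc (n - 2) = n - 1" using n5 by simp_all
    show "f' i (n - 2) = 0" if "i + 1 < n - 2" for i
      using gram_zero[of "Suc i" n p] that n5 s by (simp add: f_def f'_def)
    show "f' (n - 2) i = 0" if "i + 1 < n - 2" for i
    proof -
      have "g i (n - 1) = 0" "g (Suc i) (n - 1) = 0"
        using gram_zero[of i "n - 1" p] gram_zero[of "Suc i" "n - 1" p] that n5 by auto
      then show ?thesis using that n5 s gram_entry_symmetric[of p "n - 1"] by (auto simp: f_def f'_def)
    qed
  qed (use n5 in simp)
  also have "\<dots> = - (qn 0 1 0 * qn 1 0 (int n - 3) - qn 0 1 (0 + 1) * qn 1 0 (int n - 3 + 1))"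
  proof -
    have s: "Suc (Suc (n - 2)) = n" "Suc (n - 2) = n - 1" "Suc (n - 3) = n - 2" "n - 2 - 1 = n - 3" using n5 by simp_all
    have "g (n - 1) (n - 2) = 1" using g_next(2)[of "n - 2"] n5 s by simp
    then have "f' (n - 2) (n - 2) = qn 0 1 1" "f' (n - 2 - 1) (n - 2) = qn 0 1 0" "f' (n - 2) (n - 2 - 1) = 1"
      using gram_right[of p] d n5 s by (simp_all add: f_def f'_def)
    then show ?thesis using n5 by (simp add: of_nat_diff algebra_simps)
  qed
  also have "qn 0 1 0 * qn 1 0 (int n - 3) - qn 0 1 (0 + 1) * qn 1 0 (int n - 3 + 1) = - qn 1 1 (int n - 2)"
    unfolding quantum_product[OF q Q] by (simp add: algebra_simps)
  finally have "det (mat n n (\<lambda>(i, j). f i j)) = - 1 * - qn 0 1 (- 1) * - (- qn 1 1 (int n - 2))" .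
  moreover have "det (mat (n + 1) (n + 1) (\<lambda>(i, j). g i j)) = qn 1 0 (- 1) * det (mat n n (\<lambda>(i, j). f i j))"
    unfolding f_def using d by (intro det_left_row) simp
  ultimately show ?thesis by (simp only:) (simp add: mult_ac)
qed

end

theorem proposition6p2p1:
  fixes q Q\<^sub>1 Q\<^sub>2 \<kappa>\<^sub>L\<^sub>R :: "'k::field" and n :: nat
  defines "qn \<equiv> quantum q Q\<^sub>1 Q\<^sub>2"
    and "\<Gamma> \<equiv> gram_det (quantum_parameters q Q\<^sub>1 Q\<^sub>2 \<kappa>\<^sub>L\<^sub>R) n"
  assumes "q \<noteq> 0" and "q \<noteq> inverse q" and "Q\<^sub>1 \<noteq> 0" and "Q\<^sub>2 \<noteq> 0"
  shows
    "(n \<ge> 3 \<longrightarrow> (\<exists>s\<in>{1, -1}. \<Gamma> (- (int n - 2)) =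
        s * (qn 1 0 1 * qn 0 1 1 * qn 1 1 (- int n + 2)))) \<and>
     (n \<ge> 4 \<longrightarrow> (\<exists>s\<in>{1, -1}. \<Gamma> (- (int n - 3)) =
        s * (qn 0 1 0 ^ (n + 1) * qn 0 1 (- 1) * qn 1 0 1 * qn (- 1) 1 (int n - 2)))) \<and>
     (n \<ge> 4 \<longrightarrow> (\<exists>s\<in>{1, -1}. \<Gamma> (int n - 3) =
        s * (qn 1 0 0 ^ (n + 1) * qn 1 0 (- 1) * qn 0 1 1 * qn 1 (- 1) (int n - 2)))) \<and>
     (n \<ge> 5 \<longrightarrow> (\<exists>s\<in>{1, -1}. \<Gamma> (int n - 4) =
        s * (qn 1 0 0 ^ (n + 1) * qn 0 1 0 ^ (n + 1) * qn 1 0 (- 1) * qn 0 1 (- 1) *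
             qn 1 1 (int n - 2))))"
proof (intro conjI impI)
  assume "n \<ge> 3"
  then interpret quantum_cell n "{}" q Q\<^sub>1 Q\<^sub>2 \<kappa>\<^sub>L\<^sub>R by unfold_locales (use assms in auto)
  have "\<Gamma> (- (int n - 2)) = - (qn 1 0 1 * qn 0 1 1 * qn 1 1 (- int n + 2))"
    using gram_det_label[of p] det_undecorated by (simp add: label_def \<Gamma>_def qn_def p_def)
  then show "\<exists>s\<in>{1, -1}. \<Gamma> (- (int n - 2)) = s * (qn 1 0 1 * qn 0 1 1 * qn 1 1 (- int n + 2))" by simp
next
  assume "n \<ge> 4"
  then interpret quantum_cell n "{RB}" q Q\<^sub>1 Q\<^sub>2 \<kappa>\<^sub>L\<^sub>R by unfold_locales (use assms in auto)
  have "\<Gamma> (- (int n - 3)) = - (qn 0 1 0 ^ (n + 1) * qn 0 1 (- 1) * qn 1 0 1 * qn (- 1) 1 (int n - 2))"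
    using gram_det_label[of p] det_right p_simps by (simp add: label_def \<Gamma>_def qn_def p_def mult.assoc)
  then show "\<exists>s\<in>{1, -1}. \<Gamma> (- (int n - 3)) =
      s * (qn 0 1 0 ^ (n + 1) * qn 0 1 (- 1) * qn 1 0 1 * qn (- 1) 1 (int n - 2))" by simp
next
  assume "n \<ge> 4"
  then interpret quantum_cell n "{LB}" q Q\<^sub>1 Q\<^sub>2 \<kappa>\<^sub>L\<^sub>R by unfold_locales (use assms in auto)
  have "\<Gamma> (int n - 3) = - (qn 1 0 0 ^ (n + 1) * qn 1 0 (- 1) * qn 0 1 1 * qn 1 (- 1) (int n - 2))"
    using gram_det_label[of p] det_left p_simps by (simp add: label_def \<Gamma>_def qn_def p_def mult.assoc)
  then show "\<exists>s\<in>{1, -1}. \<Gamma> (int n - 3) =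
      s * (qn 1 0 0 ^ (n + 1) * qn 1 0 (- 1) * qn 0 1 1 * qn 1 (- 1) (int n - 2))" by simp
next
  assume "n \<ge> 5"
  then interpret quantum_cell n "{LB, RB}" q Q\<^sub>1 Q\<^sub>2 \<kappa>\<^sub>L\<^sub>R by unfold_locales (use assms in auto)
  have "\<Gamma> (int n - 4) = qn 1 0 0 ^ (n + 1) * qn 0 1 0 ^ (n + 1) * qn 1 0 (- 1) * qn 0 1 (- 1) * qn 1 1 (int n - 2)"
    using gram_det_label[of p] det_both p_simps by (simp add: label_def \<Gamma>_def qn_def p_def power_mult_distrib mult.assoc)
  then show "\<exists>s\<in>{1, -1}. \<Gamma> (int n - 4) =
      s * (qn 1 0 0 ^ (n + 1) * qn 0 1 0 ^ (n + 1) * qn 1 0 (- 1) * qn 0 1 (- 1) * qn 1 1 (int n - 2))" by simp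
qed

end
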